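(* Let $m\ge2$ be an integer. Then $$ \begin{aligned} \sum_{r=1}^{m-1}\gamma_1^2\!\left(\frac rm\right)=\;&(m-1)\gamma_1^2-m\gamma_1(2\gamma+\ln m)\ln m+\frac m4\sum_{l=1}^{m-1}\left\{\zeta''\!\left(0,\frac lm\right)+\zeta''\!\left(0,1-\frac lm\right)\right\}^2\\ &+m(\gamma+\ln 2\pi m)\sum_{l=1}^{m-1}\left\{\zeta''\!\left(0,\frac lm\right)+\zeta''\!\left(0,1-\frac lm\right)\right\}\ln\sin\frac{\pi l}{m}+m\pi^2\sum_{l=1}^{m-1}\ln^2\Gamma\!\left(\frac lm\right)\\ &+2\pi^2(\gamma+\ln2\pi m)\sum_{l=1}^{m-1}l\,\ln\Gamma\!\left(\frac lm\right)+\frac m4\left[4(\gamma+\ln2\pi m)^2-\pi^2\right]\sum_{l=1}^{m-1}\ln^2\sin\frac{\pi l}{m}+C_m, \end{aligned} $$ where $$ \begin{aligned} C_m=\;&-m(m-1)\ln^4 2-m(m-1)(2\ln m+2\gamma+3\ln\pi)\ln^3 2-m(m-2)\ln^2 m\cdot\ln^2 2\\ &-2m\left[2(m-1)\ln\pi+\gamma(m-2)\right]\ln m\cdot\ln^2 2\\ &-m(m-1)\left[3\ln^2\pi+4\gamma\ln\pi+\gamma^2+\tfrac5{12}\pi^2+\tfrac1{6m}\pi^2\right]\ln^2 2\\ &-m\left[\left(m-\tfrac52\right)\ln\pi-3\gamma\right]\ln^2 m\cdot\ln2+2m\left[(1-m)\ln^2\pi-\left(m-\tfrac52\right)\gamma\ln\pi\right]\ln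 m\cdot\ln2\\ &+\tfrac1{12}\Big[\left((6\pi^2+24\gamma^2)m+4\pi^2(1-m^2)\right)\ln m-4(m-1)\Big(3m\ln^3\pi+6m\gamma\ln^2\pi+\gamma\pi^2(m+1)\\ &\qquad+\left(\left(\tfrac{13}4\pi^2+3\gamma^2\right)m+\pi^2\right)\ln\pi\Big)\Big]\ln2\\ &+\tfrac14m\ln^4 m+m\left(\gamma+\tfrac12\ln\pi\right)\ln^3 m\\ &+\tfrac1{12}\left[6m\ln^2\pi+18\gamma m\ln\pi+\pi^2m^2+(12\gamma^2+3\pi^2)m+2\pi^2\right]\ln^2 m+m\ln^3 m\cdot\ln2\\ &+\tfrac1{12}\left[12m\gamma\ln^2\pi+\left((12\gamma^2+9\pi^2)m+4\pi^2(1-m^2)\right)\ln\pi+2\pi^2(2+m^2)\gamma\right]\ln m\\ &-\tfrac1{12}(m-1)\left[2\pi^2(4m+1)\ln^2\pi+4\gamma\pi^2(m+1)\ln\pi-\pi^2\gamma^2(m-2)\right]\\ &-\tfrac14m\left[4(\gamma+\ln2\pi m)^2-\pi^2\right]\cdot\left[(1-m)\ln2+\ln m\right]\ln\pi\\ &+m(\gamma+\ln2\pi m)\left(\tfrac12\ln m+\ln2\pi\right)\ln\pi\cdot\ln m. \end{aligned} $$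
   Context: $\zeta(s,v)$ is the Hurwitz zeta function, $\zeta(s,v)=\sum_{n\ge0}(n+v)^{-s}$ for $\operatorname{Re}s>1$, continued meromorphically in $s$. The generalized Stieltjes constants $\gamma_n(v)$ are defined by the Laurent expansion at $s=1$: $\zeta(s,v)=\frac1{s-1}+\sum_{n\ge0}\frac{(-1)^n(s-1)^n}{n!}\gamma_n(v)$; the Stieltjes constants are $\gamma_n=\gamma_n(1)$, and $\gamma=\gamma_0$ is Euler's constant. $\zeta''(0,v)$ denotes the second derivative of $\zeta(s,v)$ with respect to $s$ at $s=0$. Notation: $\gamma_1^2(x)=(\gamma_1(x))^2$, $\ln^k x=(\ln x)^k$, $\ln^2\Gamma(x)=(\ln\Gamma(x))^2$, $\ln^2\sin x=(\ln\sin x)^2$, $\ln2\pi m=\ln(2\pi m)$, $\ln 2\pi=\ln(2\pi)$. *)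

theory Defs
  imports "HOL-Complex_Analysis.Complex_Analysis"
begin

(* Meant for v > 0. The meromorphic continuation to the whole plane is made unique as a total
   function by the library's normal form for meromorphic functions: poles take the value 0
   and removable singularities are removed. For n + v > 0 the complex powr below is the
   ordinary power with the real logarithm. *)
definition hurwitz_zeta :: "real \<Rightarrow> complex \<Rightarrow> complex" where
  "hurwitz_zeta v = (THE f. f nicely_meromorphic_on UNIV \<and>
     (\<forall>s. Re s > 1 \<longrightarrow> (\<lambda>n. of_real (real n + v) powr (- s)) sums f s))"

definition stieltjes :: "nat \<Rightarrow> real \<Rightarrow> complex" where
  "stieltjes n v = (- 1) ^ n * fact n * fls_nth (laurent_expansion (hurwitz_zeta v) 1) (int n)"

definition hurwitz_zeta_dd0 :: "real \<Rightarrow> complex" where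
  "hurwitz_zeta_dd0 v = (deriv ^^ 2) (hurwitz_zeta v) 0"

abbreviation euler_gamma :: real ("\<gamma>") where
  "\<gamma> \<equiv> euler_mascheroni"

definition C_const :: "real \<Rightarrow> real" where
  "C_const m =
     - m * (m - 1) * ln 2 ^ 4
     - m * (m - 1) * (2 * ln m + 2 * \<gamma> + 3 * ln pi) * ln 2 ^ 3
     - m * (m - 2) * ln m ^ 2 * ln 2 ^ 2
     - 2 * m * (2 * (m - 1) * ln pi + \<gamma> * (m - 2)) * ln m * ln 2 ^ 2
     - m * (m - 1) * (3 * ln pi ^ 2 + 4 * \<gamma> * ln pi + \<gamma> ^ 2 + 5 / 12 * pi ^ 2
                       + 1 / (6 * m) * pi ^ 2) * ln 2 ^ 2
     - m * ((m - 5 / 2) * ln pi - 3 * \<gamma>) * ln m ^ 2 * ln 2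
     + 2 * m * ((1 - m) * ln pi ^ 2 - (m - 5 / 2) * \<gamma> * ln pi) * ln m * ln 2
     + 1 / 12 * (((6 * pi ^ 2 + 24 * \<gamma> ^ 2) * m + 4 * pi ^ 2 * (1 - m ^ 2)) * ln m
         - 4 * (m - 1) * (3 * m * ln pi ^ 3 + 6 * m * \<gamma> * ln pi ^ 2 + \<gamma> * pi ^ 2 * (m + 1)
             + ((13 / 4 * pi ^ 2 + 3 * \<gamma> ^ 2) * m + pi ^ 2) * ln pi)) * ln 2
     + 1 / 4 * m * ln m ^ 4 + m * (\<gamma> + 1 / 2 * ln pi) * ln m ^ 3
     + 1 / 12 * (6 * m * ln pi ^ 2 + 18 * \<gamma> * m * ln pi + pi ^ 2 * m ^ 2
         + (12 * \<gamma> ^ 2 + 3 * pi ^ 2) * m + 2 * pi ^ 2) * ln m ^ 2 + m * ln m ^ 3 * ln 2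
     + 1 / 12 * (12 * m * \<gamma> * ln pi ^ 2
         + ((12 * \<gamma> ^ 2 + 9 * pi ^ 2) * m + 4 * pi ^ 2 * (1 - m ^ 2)) * ln pi
         + 2 * pi ^ 2 * (2 + m ^ 2) * \<gamma>) * ln m
     - 1 / 12 * (m - 1) * (2 * pi ^ 2 * (4 * m + 1) * ln pi ^ 2
         + 4 * \<gamma> * pi ^ 2 * (m + 1) * ln pi - pi ^ 2 * \<gamma> ^ 2 * (m - 2))
     - 1 / 4 * m * (4 * (\<gamma> + ln (2 * pi * m)) ^ 2 - pi ^ 2) * ((1 - m) * ln 2 + ln m) * ln pi
     + m * (\<gamma> + ln (2 * pi * m)) * (1 / 2 * ln m + ln (2 * pi)) * ln pi * ln m"

end

theory Submission
  imports Defs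
begin

text \<open>
  For rational argument the Hurwitz formula is a finite Fourier transform: with \<open>H(e) = \<Gamma>(1+e) (2\<pi>)\<^sup>-\<^sup>1\<^sup>-\<^sup>e m\<^sup>-\<^sup>e\<close>,
  \<open>-m \<zeta>(-e, l/m) = 2 H(e) \<Sum>\<^sub>r sin(\<pi>e/2 - 2\<pi>rl/m) \<zeta>(1+e, r/m)\<close>. Comparing Taylor coefficients at \<open>e = 0\<close>
  expresses the cosine transform of \<open>\<gamma>\<^sub>1(r/m)\<close> by \<open>\<zeta>''(0, l/m) + \<zeta>''(0, 1 - l/m)\<close> and \<open>ln sin(\<pi>l/m)\<close>, and the sine
  transform by \<open>ln \<Gamma>(l/m)\<close>; the theorem is Parseval's identity for these transforms. The functional equation
  is obtained from Jonquiere's formula: for real \<open>-1 < s < 0\<close>, the Mellin transform of \<open>1/(e\<^sup>u/z - 1)\<close>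
  minus its value at \<open>u = 0\<close>, where \<open>z\<close> is an \<open>m\<close>-th root of unity, is evaluated by expanding the kernel in powers
  of \<open>e\<^sup>-\<^sup>u\<close> and in partial fractions. The functional equation also continues \<open>\<zeta>(s, l/m)\<close> from \<open>Re s > -1\<close>, where the
  trapezoidal rule suffices, to the whole plane.
\<close>

subsection \<open>The Hurwitz zeta function on the half-plane \<open>Re s > -1\<close>\<close>

text \<open>The analytic work concerns \<open>hurwitz_num\<close>, that is (s - 1) zeta(s, v): it is
  holomorphic at s = 1 too, so one half-plane contains neighbourhoods of both 1 and 0, where gamma_1
  and zeta'' are read off. The interval -1 < s < 0 for the Mellin transform is forced. Once its
  value at u = 0 is subtracted, the kernel vanishes there to first order, which gives convergence at
  0 for s > -1; at infinity it is only bounded, which requires s < 0. A pole at distance a from the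
  origin contributes a multiple of a^(s - 1), and these are summable for s < 0 as well. But there
  the series of z^n n^(-s) diverges, so it is handled through its second differences, at the cost of
  a factor (1 - z)^2. This excludes z = 1, and the functional equation of zeta itself has to be
  recovered from z = -1. In the part of the functional equation that is even under l -> m - l, the
  factor sin(pi e / 2) has a simple zero; therefore zeta'' and gamma_1 meet in the coefficient of
  e^3. C_m consists of the contribution of l = m to Parseval's identity and of the sums over l that
  have closed forms.\<close>

lemma has_vector_derivative_of_real_powr:
  fixes a :: complex and x :: real
  assumes "x > 0"
  shows "((\<lambda>t. of_real t powr a) has_vector_derivative a * of_real x powr (a - 1)) (at x within S)"
proof -
  have "((\<lambda>z. z powr a) has_field_derivative a * of_real x powr (a - 1)) (at (of_real x :: complex))"
    using assms by (auto intro!: derivative_eq_intros simp: complex_nonpos_Reals_iff)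
  from has_vector_derivative_real_field[OF this] show ?thesis .
qed

lemma norm_of_real_powr:
  fixes s :: complex
  assumes "x > 0"
  shows "norm (of_real x powr s) = x powr Re s"
  using assms by (simp add: norm_powr_real_powr)

text \<open>This is s - 1 times the error of the trapezoidal rule for the integral of t^(-s) over
  [x, x + 1]. The factor clears the denominator of the integral, so that the expression also makes
  sense at s = 1.\<close>

definition trapezoid_error :: "real \<Rightarrow> complex \<Rightarrow> complex" where
  "trapezoid_error x s = (s - 1) / 2 * (of_real x powr (- s) + of_real (x + 1) powr (- s))
     - of_real x powr (1 - s) + of_real (x + 1) powr (1 - s)"

lemma norm_diff_le_of_vector_derivative:
  fixes f :: "real \<Rightarrow> complex"
  assumes "\<And>t. t \<in> {0..1} \<Longrightarrow> (f has_vector_derivative f' t) (at t within {0..1})"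
    and "\<And>t. t \<in> {0..1} \<Longrightarrow> norm (f' t) \<le> B" and "x \<in> {0..1}"
  shows "norm (f x - f 0) \<le> B"
proof -
  have "B \<ge> 0" using assms(2)[OF assms(3)] norm_ge_zero order_trans by blast
  have "norm (f x - f 0) \<le> B * norm (x - 0)"
    by (rule differentiable_bound[where S = "{0..1}" and f' = "\<lambda>t h. h *\<^sub>R f' t"])
       (use assms \<open>B \<ge> 0\<close> in \<open>auto simp: has_vector_derivative_def mult.commute[of _ "norm (f' _)"]
          intro!: onorm_bound mult_right_mono\<close>)
  also have "\<dots> \<le> B" using \<open>B \<ge> 0\<close> assms(3) by (simp add: mult_left_le)
  finally show ?thesis .
qed

text \<open>With a step of variable length t, the error and its first derivative vanish at t = 0,
  and the second derivative is (s - 1) s (s + 1) t / 2 times (x + t)^(-s - 2). Two mean value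
  estimates on [0, 1] give the bound. Its exponent makes the errors at x = n + v summable exactly
  for Re s > -1.\<close>

lemma norm_trapezoid_error_le:
  assumes x: "x > 0" and s: "Re s \<ge> -2"
  shows "norm (trapezoid_error x s) \<le> norm ((s - 1) * s * (s + 1)) * x powr (- Re s - 2)"
proof -
  define B where "B = norm ((s - 1) * s * (s + 1)) * x powr (- Re s - 2)"
  define E where "E t = (s - 1) * of_real t / 2 * (of_real x powr (- s) + of_real (x + t) powr (- s))
     - of_real x powr (1 - s) + of_real (x + t) powr (1 - s)" for t
  define E1 where "E1 t = (s - 1) / 2 * (of_real x powr (- s) - of_real (x + t) powr (- s))
     - (s - 1) * s * of_real t / 2 * of_real (x + t) powr (- s - 1)" for t
  define E2 where "E2 t = (s - 1) * s * (s + 1) * of_real t / 2 * of_real (x + t) powr (- s - 2)" for t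
  have D: "((\<lambda>t. of_real (x + t) powr a) has_vector_derivative a * of_real (x + t) powr (a - 1))
      (at t within {0..1})" if "t \<in> {0..1}" for t and a :: complex
  proof -
    have "x + t > 0" using that x by simp
    have "((\<lambda>t. x + t) has_vector_derivative 1) (at t within {0..1})"
      by (auto intro!: derivative_eq_intros)
    from vector_diff_chain_within[OF this has_vector_derivative_of_real_powr[OF \<open>x + t > 0\<close>, of a]]
    show ?thesis by (simp add: o_def)
  qed
  have d1: "(E has_vector_derivative E1 t) (at t within {0..1})" if "t \<in> {0..1}" for t
    unfolding E_def E1_def
    by (rule derivative_eq_intros D that refl | simp add: field_simps)+
  have d2: "(E1 has_vector_derivative E2 t) (at t within {0..1})" if "t \<in> {0..1}" for t
    unfolding E2_def E1_def
    by (rule derivative_eq_intros D that refl | simp add: field_simps)+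
  have b2: "norm (E2 t) \<le> B" if "t \<in> {0..1}" for t
  proof -
    have "(x + t) powr (- Re s - 2) \<le> x powr (- Re s - 2)"
      using that x s by (intro powr_mono2') auto
    moreover have "t / 2 \<le> 1" using that by simp
    ultimately have "t / 2 * (x + t) powr (- Re s - 2) \<le> 1 * x powr (- Re s - 2)"
      using that by (intro mult_mono) auto
    hence "norm ((s - 1) * s * (s + 1)) * (t / 2 * (x + t) powr (- Re s - 2)) \<le> B"
      unfolding B_def by (intro mult_left_mono) auto
    moreover have "norm (E2 t) = norm ((s - 1) * s * (s + 1)) * (t / 2 * (x + t) powr (- Re s - 2))"
      using that x by (simp add: E2_def norm_mult norm_divide norm_of_real_powr del: of_real_add)
    ultimately show ?thesis by simp
  qed
  have b1: "norm (E1 t) \<le> B" if "t \<in> {0..1}" for t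
    using norm_diff_le_of_vector_derivative[OF d2 b2 that] by (simp add: E1_def)
  have "norm (E 1) \<le> B"
    using norm_diff_le_of_vector_derivative[OF d1 b1, of 1] by (simp add: E_def)
  thus ?thesis by (simp add: E_def trapezoid_error_def B_def)
qed

text \<open>By the Euler--Maclaurin formula, \<open>hurwitz_num v s = (s - 1) \<zeta>(s, v)\<close>.\<close>
definition hurwitz_num :: "real \<Rightarrow> complex \<Rightarrow> complex" where
  "hurwitz_num v s = of_real v powr (1 - s) + (s - 1) / 2 * of_real v powr (- s)
     + (\<Sum>n. trapezoid_error (real n + v) s)"

text \<open>Up to the factor s - 1: the first N terms, half of the next one, and the integral of
  t^(-s) from N + v to infinity in its continued form.\<close>

definition hurwitz_num_partial :: "real \<Rightarrow> nat \<Rightarrow> complex \<Rightarrow> complex" where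
  "hurwitz_num_partial v N s =
     (s - 1) * ((\<Sum>n<N. of_real (real n + v) powr (- s)) + of_real (real N + v) powr (- s) / 2)
     + of_real (real N + v) powr (1 - s)"

lemma hurwitz_num_partial_eq:
  "hurwitz_num_partial v N s = of_real v powr (1 - s) + (s - 1) / 2 * of_real v powr (- s)
     + (\<Sum>n<N. trapezoid_error (real n + v) s)"
proof (induction N)
  case 0
  show ?case by (simp add: hurwitz_num_partial_def)
next
  case (Suc N)
  have "hurwitz_num_partial v (Suc N) s = hurwitz_num_partial v N s + trapezoid_error (real N + v) s"
    unfolding hurwitz_num_partial_def trapezoid_error_def by (simp add: field_simps)
  thus ?case using Suc by simp
qed

lemma continuous_on_compact_norm_bound:
  fixes f :: "complex \<Rightarrow> complex"
  assumes "compact K" "continuous_on K f"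
  obtains C where "C \<ge> 0" "\<And>s. s \<in> K \<Longrightarrow> norm (f s) \<le> C"
proof -
  have "bounded (f ` K)"
    using assms by (intro compact_imp_bounded compact_continuous_image)
  then obtain C where "C > 0" "\<forall>x\<in>f ` K. norm x \<le> C"
    unfolding bounded_pos by blast
  with that[of C] show ?thesis by auto
qed

lemma hurwitz_num_uniform_limit:
  assumes v: "v > 0" and K: "compact K" "K \<subseteq> {s. Re s > -1}"
  shows "uniform_limit K (hurwitz_num_partial v) (hurwitz_num v) sequentially"
proof (cases "K = {}")
  case False
  obtain s0 where s0: "s0 \<in> K" "\<And>s. s \<in> K \<Longrightarrow> Re s0 \<le> Re s"
    using continuous_attains_inf[OF K(1) False, of Re] continuous_on_Re[OF continuous_on_id] by auto
  obtain C where C0: "C \<ge> 0" and C: "\<And>s. s \<in> K \<Longrightarrow> norm ((s - 1) * s * (s + 1)) \<le> C"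
    by (rule continuous_on_compact_norm_bound[OF K(1), of "\<lambda>s. (s - 1) * s * (s + 1)"])
      (auto intro!: continuous_intros)
  \<comment> \<open>The smallest real part on K exceeds -1, so this exponent gives one convergent
    majorant for all of K.\<close>
  define e where "e = - Re s0 - 2"
  have e: "e < -1" using s0 K by (auto simp: e_def)
  have "uniform_limit K (\<lambda>N s. \<Sum>n<N. trapezoid_error (real n + v) s)
      (\<lambda>s. \<Sum>n. trapezoid_error (real n + v) s) sequentially"
  proof (rule Weierstrass_m_test_ev)
    \<comment> \<open>The estimate is claimed only eventually: at n = 0 the majorant is 0, since
      \<open>0 powr e = 0\<close>.\<close>
    show "\<forall>\<^sub>F n in sequentially. \<forall>s\<in>K. norm (trapezoid_error (real n + v) s) \<le> C * real n powr e"
      using eventually_ge_at_top[of 1]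
    proof eventually_elim
      case (elim n)
      show ?case
      proof
        fix s assume s: "s \<in> K"
        have "Re s > -1" using s K by auto
        have "norm (trapezoid_error (real n + v) s)
            \<le> norm ((s - 1) * s * (s + 1)) * (real n + v) powr (- Re s - 2)"
          using v elim \<open>Re s > -1\<close> by (intro norm_trapezoid_error_le) auto
        also have "(real n + v) powr (- Re s - 2) \<le> (real n + v) powr e"
          using s0(2)[OF s] elim v by (intro powr_mono) (auto simp: e_def)
        also have "(real n + v) powr e \<le> real n powr e"
          using e elim v by (intro powr_mono2') auto
        finally show "norm (trapezoid_error (real n + v) s) \<le> C * real n powr e"
          using C[OF s] C0 by (smt (verit) mult_mono norm_ge_zero powr_ge_zero mult_left_mono)
      qed
    qed
    show "summable (\<lambda>n. C * real n powr e)"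
      using e by (intro summable_mult) (simp add: summable_real_powr_iff)
  qed
  from uniform_limit_add[OF uniform_limit_const this,
      of "\<lambda>s. of_real v powr (1 - s) + (s - 1) / 2 * of_real v powr (- s)"]
  show ?thesis
    by (simp add: hurwitz_num_def [abs_def] hurwitz_num_partial_eq [abs_def])
qed auto

lemma holomorphic_hurwitz_num_partial:
  "v > 0 \<Longrightarrow> hurwitz_num_partial v N holomorphic_on A"
  unfolding hurwitz_num_partial_def [abs_def]
  by (intro holomorphic_intros) (auto simp: complex_eq_iff)

lemma hurwitz_num_cball:
  assumes "v > 0" "Re s > -1"
  obtains d where "d > 0" "cball s d \<subseteq> {s. Re s > -1}"
    "uniform_limit (cball s d) (hurwitz_num_partial v) (hurwitz_num v) sequentially"
proof -
  have "open {s. Re s > -1}" by (simp add: open_halfspace_Re_gt)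
  then obtain d where "d > 0" "cball s d \<subseteq> {s. Re s > -1}"
    using assms open_contains_cball by blast
  with that hurwitz_num_uniform_limit[OF assms(1) compact_cball this(2)] show ?thesis by blast
qed

lemma holomorphic_hurwitz_num:
  assumes v: "v > 0"
  shows "hurwitz_num v holomorphic_on {s. Re s > -1}"
proof (rule holomorphic_uniform_sequence)
  show "open {s. Re s > -1}" by (simp add: open_halfspace_Re_gt)
  show "hurwitz_num_partial v n holomorphic_on {s. Re s > -1}" for n
    using v by (rule holomorphic_hurwitz_num_partial)
  show "\<exists>d>0. cball s d \<subseteq> {s. Re s > -1} \<and>
      uniform_limit (cball s d) (hurwitz_num_partial v) (hurwitz_num v) sequentially"
    if "s \<in> {s. Re s > -1}" for s
    using hurwitz_num_cball[OF v, of s] that by blast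
qed

lemma holomorphic_hurwitz_num_compose:
  assumes "v > 0" "h holomorphic_on A" "\<And>e. e \<in> A \<Longrightarrow> Re (h e) > -1"
  shows "(\<lambda>e. hurwitz_num v (h e)) holomorphic_on A"
  using holomorphic_on_compose_gen[OF assms(2) holomorphic_hurwitz_num[OF assms(1)]] assms(3)
  by (auto simp: o_def)

lemma hurwitz_num_LIMSEQ:
  assumes "v > 0" "Re s > -1"
  shows "(\<lambda>N. hurwitz_num_partial v N s) \<longlonglongrightarrow> hurwitz_num v s"
  using hurwitz_num_uniform_limit[OF assms(1), of "{s}"] assms
  by (intro tendsto_uniform_limitI[where S = "{s}"]) auto

lemma tendsto_of_real_powr_0:
  assumes "Re a < 0"
  shows "(\<lambda>N. complex_of_real (real N + v) powr a) \<longlonglongrightarrow> 0"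
proof (rule Lim_null_comparison)
  have "\<forall>\<^sub>F N in sequentially. real N + v > 0"
    by real_asymp
  thus "\<forall>\<^sub>F N in sequentially. norm (complex_of_real (real N + v) powr a) \<le> (real N + v) powr Re a"
    by eventually_elim (simp add: norm_of_real_powr del: of_real_add)
  show "(\<lambda>N. (real N + v) powr Re a) \<longlonglongrightarrow> 0"
    using assms by real_asymp
qed

text \<open>For Re s > 1 the two boundary terms of the partial sum, the half term and the integral
  of the tail, tend to 0 and only the Dirichlet series remains.\<close>

lemma hurwitz_sums:
  assumes v: "v > 0" and s: "Re s > 1"
  shows "(\<lambda>n. of_real (real n + v) powr (- s)) sums (hurwitz_num v s / (s - 1))"
proof -
  have s1: "s \<noteq> 1" using s by auto
  have "(\<lambda>N. (hurwitz_num_partial v N s - of_real (real N + v) powr (1 - s)) / (s - 1)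
      - of_real (real N + v) powr (- s) / 2) \<longlonglongrightarrow> (hurwitz_num v s - 0) / (s - 1) - 0 / 2"
    using s s1 v by (intro tendsto_intros hurwitz_num_LIMSEQ tendsto_of_real_powr_0) auto
  also have "(\<lambda>N. (hurwitz_num_partial v N s - of_real (real N + v) powr (1 - s)) / (s - 1)
      - of_real (real N + v) powr (- s) / 2) = (\<lambda>N. \<Sum>n<N. of_real (real n + v) powr (- s))"
    using s1 by (auto simp: hurwitz_num_partial_def fun_eq_iff field_simps)
  finally show ?thesis by (simp add: sums_def)
qed

text \<open>At s = 0 the integrand is constant and the trapezoidal rule is exact.\<close>

lemma hurwitz_num_0:
  assumes "v > 0"
  shows "hurwitz_num v 0 = of_real v - 1 / 2"
proof -
  have "trapezoid_error (real n + v) 0 = 0" for n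
  proof -
    have "real n + v > 0" using assms by simp
    hence "complex_of_real (real n + v) \<noteq> 0" "complex_of_real (real n + v + 1) \<noteq> 0"
      by (auto simp del: of_real_add)
    thus ?thesis by (simp add: trapezoid_error_def del: of_real_add) simp
  qed
  thus ?thesis using assms by (simp add: hurwitz_num_def)
qed

text \<open>In terms of zeta(s, v), this is the residue 1 at s = 1.\<close>

lemma hurwitz_num_1:
  assumes "v > 0"
  shows "hurwitz_num v 1 = 1"
proof -
  have "trapezoid_error (real n + v) 1 = 0" for n
  proof -
    have "real n + v > 0" using assms by simp
    hence "complex_of_real (real n + v) \<noteq> 0" "complex_of_real (real n + v + 1) \<noteq> 0"
      by (auto simp del: of_real_add)
    thus ?thesis by (simp add: trapezoid_error_def del: of_real_add)
  qed
  thus ?thesis using assms by (simp add: hurwitz_num_def)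
qed

section \<open>The derivative at s = 0 and ln Gamma\<close>

lemma has_field_derivative_powr_minus:
  assumes "x > 0"
  shows "((\<lambda>s. complex_of_real x powr (a - s)) has_field_derivative
     - of_real (ln x) * of_real x powr (a - s)) (at s within A)"
proof -
  have "((\<lambda>s. exp ((a - s) * of_real (ln x))) has_field_derivative
     - of_real (ln x) * exp ((a - s) * of_real (ln x))) (at s within A)"
    by (auto intro!: derivative_eq_intros)
  thus ?thesis using assms by (simp add: powr_def Ln_of_real)
qed

text \<open>Locally uniform convergence of holomorphic functions carries over to their derivatives,
  so the partial sums may be differentiated at 0.\<close>

lemma deriv_hurwitz_num_0_LIMSEQ:
  assumes v: "v > 0"
  shows "(\<lambda>N. of_real (real N + 1 / 2 + (\<Sum>n<N. ln (real n + v)) + ln (real N + v) / 2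
      - (real N + v) * ln (real N + v))) \<longlonglongrightarrow> deriv (hurwitz_num v) 0"
proof -
  obtain d where d: "d > 0" "cball 0 d \<subseteq> {s. Re s > -1}"
    "uniform_limit (cball 0 d) (hurwitz_num_partial v) (hurwitz_num v) sequentially"
    by (rule hurwitz_num_cball[OF v, of 0]) auto
  have "(\<lambda>N. (deriv ^^ 1) (hurwitz_num_partial v N) 0) \<longlonglongrightarrow> (deriv ^^ 1) (hurwitz_num v) 0"
    using d by (intro higher_deriv_complex_uniform_limit[where A = "ball 0 d"]
        uniform_limit_on_subset[OF d(3)] always_eventually allI holomorphic_hurwitz_num_partial v) auto
  moreover have "deriv (hurwitz_num_partial v N) 0 = of_real (real N + 1 / 2
     + (\<Sum>n<N. ln (real n + v)) + ln (real N + v) / 2 - (real N + v) * ln (real N + v))" for N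
  proof (rule DERIV_imp_deriv)
    have D: "((\<lambda>s. complex_of_real (real n + v) powr (- s)) has_field_derivative
      - of_real (ln (real n + v))) (at 0)" for n
      using has_field_derivative_powr_minus[of "real n + v" 0 0 UNIV] v
      by (simp add: add_nonneg_pos del: of_real_add)
    have D1: "((\<lambda>s. complex_of_real (real n + v) powr (1 - s)) has_field_derivative
      - of_real (ln (real n + v)) * of_real (real n + v)) (at 0)" for n
      using has_field_derivative_powr_minus[of "real n + v" 1 0 UNIV] v
      by (simp add: add_nonneg_pos del: of_real_add)
    have nz: "complex_of_real (real n + v) \<noteq> 0" for n
      using v by (metis add_nonneg_pos less_irrefl of_nat_0_le_iff of_real_eq_0_iff)
    show "(hurwitz_num_partial v N has_field_derivative of_real (real N + 1 / 2
     + (\<Sum>n<N. ln (real n + v)) + ln (real N + v) / 2 - (real N + v) * ln (real N + v))) (at 0)"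
      unfolding hurwitz_num_partial_def [abs_def]
      by (rule DERIV_cong[OF DERIV_add[OF DERIV_mult[OF DERIV_diff[OF DERIV_ident DERIV_const]
            DERIV_add[OF DERIV_sum[OF D] DERIV_cdivide[OF D]]] D1]])
        (use nz in \<open>simp add: sum_negf del: of_real_add\<close>, simp add: algebra_simps)
  qed
  ultimately show ?thesis by simp
qed

text \<open>Lerch's formula up to a constant independent of v, which the difference removes; the
  constant is found later from the distribution relation. The sums of logarithms are those of the
  limit formula for ln Gamma.\<close>

lemma deriv_hurwitz_num_0_diff:
  assumes v: "v > 0"
  shows "deriv (hurwitz_num v) 0 - deriv (hurwitz_num 1) 0 = of_real (1 - v - ln (Gamma v))"
proof -
  define F where "F = (\<lambda>v N. real N + 1 / 2 + (\<Sum>n<N. ln (real n + v)) + ln (real N + v) / 2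
      - (real N + v) * ln (real N + v))"
  \<comment> \<open>\<open>R\<close> collects what remains beside \<open>ln_Gamma_series\<close>.
    The partial sums are taken at \<open>Suc n\<close> because that series runs over 1, ..., n,
    while the sum of logarithms also contains ln v.\<close>
  define R where "R = (\<lambda>n. v * ln (real n) - ln (real n + 1) + ln (real n + 1 + v) / 2 - ln (real n + 2) / 2
      - (real n + 1 + v) * ln (real n + 1 + v) + (real n + 2) * ln (real n + 2))"
  have R: "R \<longlonglongrightarrow> 1 - v"
    unfolding R_def using v by real_asymp
  have eq: "F v (Suc n) - F 1 (Suc n) = R n - ln_Gamma_series v n" for n
  proof -
    have "(\<Sum>k<Suc n. ln (real k + v)) = ln v + (\<Sum>k=1..n. ln (real k + v))"
      by (simp add: lessThan_Suc_atMost sum.atMost_shift sum.atLeast1_atMost_eq del: sum.lessThan_Suc)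
    also have "(\<Sum>k=1..n. ln (real k + v)) = (\<Sum>k=1..n. ln (v / real k + 1) + ln (real k))"
    proof (rule sum.cong)
      fix k assume "k \<in> {1..n}"
      hence "real k > 0" by simp
      hence "ln (v / real k + 1) + ln (real k) = ln ((v / real k + 1) * real k)"
        using v \<open>real k > 0\<close> by (intro ln_mult_pos [symmetric] add_nonneg_pos) auto
      also have "(v / real k + 1) * real k = real k + v"
        using \<open>real k > 0\<close> by (simp add: field_simps)
      finally show "ln (real k + v) = ln (v / real k + 1) + ln (real k)" ..
    qed auto
    finally have 1: "(\<Sum>k<Suc n. ln (real k + v)) =
        ln v + (\<Sum>k=1..n. ln (v / real k + 1)) + (\<Sum>k=1..n. ln (real k))"
      by (simp add: sum.distrib)
    have 2: "(\<Sum>k<Suc n. ln (real k + 1)) = (\<Sum>k=1..n. ln (real k)) + ln (real n + 1)"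
      by (simp add: sum.atLeast1_atMost_eq add_ac)
    show ?thesis
      unfolding F_def 1 2 R_def ln_Gamma_series_def by (simp add: algebra_simps)
  qed
  have "(\<lambda>n. complex_of_real (F v (Suc n)) - of_real (F 1 (Suc n))) \<longlonglongrightarrow>
      deriv (hurwitz_num v) 0 - deriv (hurwitz_num 1) 0"
    using deriv_hurwitz_num_0_LIMSEQ[of v] deriv_hurwitz_num_0_LIMSEQ[of 1] v
    by (intro tendsto_diff LIMSEQ_Suc) (auto simp: F_def)
  moreover have "(\<lambda>n. complex_of_real (R n - ln_Gamma_series v n)) \<longlonglongrightarrow> of_real (1 - v - ln_Gamma v)"
    by (intro tendsto_of_real tendsto_diff R ln_Gamma_real_LIMSEQ v)
  ultimately show ?thesis
    using v by (auto simp: eq simp flip: of_real_diff intro: LIMSEQ_unique simp: ln_Gamma_real_pos)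
qed

section \<open>Dirichlet series twisted by roots of unity\<close>

lemma analytic_continuation_halfplane:
  assumes "f holomorphic_on {s. Re s > a}" "g holomorphic_on {s. Re s > a}"
    and "\<And>s. Re s > b \<Longrightarrow> f s = g s" and "Re s > a"
  shows "f s = g s"
proof (rule analytic_continuation_open[of "{s. Re s > max a b}" "{s. Re s > a}" f g])
  show "{s. Re s > max a b} \<noteq> {}"
    by (auto intro!: exI[of _ "of_real (max a b + 1)"])
  show "connected {s. Re s > a}"
    by (intro convex_connected convex_halfspace_Re_gt)
  show "open {s. Re s > max a b}" "open {s. Re s > a}"
    by (rule open_halfspace_Re_gt)+
qed (use assms in auto)

text \<open>Since z^m = 1, the twist depends only on the residue modulo m. Blocks of m consecutive
  terms are summed, and n m + r = m (n + r / m) turns each residue class into a Hurwitz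
  series.\<close>

lemma twisted_sums:
  fixes z :: complex
  assumes m: "m > 0" and z: "z ^ m = 1" and s: "Re s > 1"
  shows "(\<lambda>k. z ^ Suc k * of_nat (Suc k) powr (- s)) sums
     (of_nat m powr (- s) * (\<Sum>r=1..m. z ^ r * (hurwitz_num (real r / real m) s / (s - 1))))"
proof -
  define f where "f k = z ^ Suc k * of_nat (Suc k) powr (- s)" for k
  have "norm z = 1"
    using z m by (metis norm_one norm_power power_eq_1_iff norm_ge_zero less_irrefl)
  have "summable (\<lambda>k. norm (f k))"
  proof -
    have "summable (\<lambda>k. real (Suc k) powr (- Re s))"
      using s by (subst summable_Suc_iff) (simp add: summable_real_powr_iff)
    thus ?thesis
      using norm_of_real_powr[of "real (Suc k)" "- s" for k] \<open>norm z = 1\<close>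
      by (simp add: f_def norm_mult norm_power del: of_nat_Suc)
  qed
  hence "summable f" by (rule summable_norm_cancel)
  hence 1: "(\<lambda>n. sum f {n * m..<n * m + m}) sums suminf f"
    using m by (intro sums_group) auto
  have eq: "sum f {n * m..<n * m + m} = of_nat m powr (- s) *
      (\<Sum>r=1..m. z ^ r * of_real (real n + real r / real m) powr (- s))" for n
  proof -
    \<comment> \<open>The index k of \<open>f\<close> stands for the integer k + 1, so the residues
      are represented by 1, ..., m; the representative m gives the argument 1 in place of 0.\<close>
    have "sum f {n * m..<n * m + m} = (\<Sum>r=1..m. f (n * m + r - 1))"
      by (rule sum.reindex_bij_witness[of _ "\<lambda>r. n * m + r - 1" "\<lambda>k. k + 1 - n * m"]) auto
    also have "\<dots> = (\<Sum>r=1..m. of_nat m powr (- s) *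
        (z ^ r * of_real (real n + real r / real m) powr (- s)))"
    proof (rule sum.cong)
      fix r assume r: "r \<in> {1..m}"
      have "z ^ (n * m + r) = z ^ r"
        using z by (simp add: power_add mult.commute[of n m] power_mult)
      moreover have "(of_nat (n * m + r) :: complex) powr (- s) =
          of_nat m powr (- s) * of_real (real n + real r / real m) powr (- s)"
      proof -
        have "(of_nat (n * m + r) :: complex) = of_real (real m * (real n + real r / real m))"
          using m by (simp add: field_simps)
        also have "\<dots> = of_real (real m) * of_real (real n + real r / real m)"
          by (rule of_real_mult)
        finally show ?thesis
          using m by (subst powr_times_real[symmetric]) (auto simp del: of_real_add)
      qed
      ultimately show "f (n * m + r - 1) = of_nat m powr (- s) *
        (z ^ r * of_real (real n + real r / real m) powr (- s))"
        using r by (simp add: f_def)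
    qed auto
    finally show ?thesis by (simp add: sum_distrib_left)
  qed
  have 2: "(\<lambda>n. sum f {n * m..<n * m + m}) sums (of_nat m powr (- s) *
      (\<Sum>r=1..m. z ^ r * (hurwitz_num (real r / real m) s / (s - 1))))"
    unfolding eq using m s by (intro sums_mult sums_sum hurwitz_sums) auto
  from sums_unique2[OF 1 2] \<open>summable f\<close> show ?thesis
    unfolding f_def [symmetric, abs_def] by (simp add: sums_iff)
qed

text \<open>For Re s > 1 this is the case z = 1 of \<open>twisted_sums\<close>. Both sides are
  holomorphic for Re s > -1, also at s = 1, so it continues.\<close>

lemma hurwitz_num_distribution:
  assumes m: "m > 0" and s: "Re s > -1"
  shows "(\<Sum>r=1..m. hurwitz_num (real r / real m) s) = of_nat m powr s * hurwitz_num 1 s"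
proof (rule analytic_continuation_halfplane[where a = "-1" and b = 1 and s = s and
      f = "\<lambda>s. \<Sum>r=1..m. hurwitz_num (real r / real m) s" and g = "\<lambda>s. of_nat m powr s * hurwitz_num 1 s"])
  show "(\<lambda>s. \<Sum>r=1..m. hurwitz_num (real r / real m) s) holomorphic_on {s. Re s > -1}"
    using m by (intro holomorphic_intros holomorphic_hurwitz_num) auto
  show "(\<lambda>s. of_nat m powr s * hurwitz_num 1 s) holomorphic_on {s. Re s > -1}"
    using m by (intro holomorphic_intros holomorphic_hurwitz_num) (auto simp: complex_eq_iff)
  show "(\<Sum>r=1..m. hurwitz_num (real r / real m) s) = of_nat m powr s * hurwitz_num 1 s"
    if s: "Re s > 1" for s
  proof -
    have s1: "s \<noteq> 1" using s by auto
    have "hurwitz_num 1 s / (s - 1) = of_nat m powr (- s) *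
       (\<Sum>r=1..m. hurwitz_num (real r / real m) s / (s - 1))"
      using twisted_sums[OF m, of 1 s] hurwitz_sums[of 1 s] s
      by (intro sums_unique2[of "\<lambda>n. of_real (real n + 1) powr (- s)"]) (auto simp: add.commute)
    hence "hurwitz_num 1 s = of_nat m powr (- s) * (\<Sum>r=1..m. hurwitz_num (real r / real m) s)"
      using s1 by (simp flip: sum_divide_distrib)
    thus ?thesis using m by (simp add: powr_minus field_simps)
  qed
qed fact

text \<open>The coefficient of z^(k + 2) in (1 - z)^2 times the series of z^n n^(-s). The convention
  \<open>0 powr (- s) = 0\<close> makes k = 0 fit, since that series has no term n = 0.\<close>

definition second_diff_powr :: "nat \<Rightarrow> complex \<Rightarrow> complex" where
  "second_diff_powr k s = of_nat (k + 2) powr (- s) - 2 * of_nat (k + 1) powr (- s) + of_nat k powr (- s)"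

text \<open>With steps t and 2 t in place of 1 and 2, the difference vanishes at t = 0, and its
  derivative is itself a difference of the first derivative of x^(-s) at two points at distance t.
  Two mean value estimates therefore gain two powers of k.\<close>

lemma norm_second_diff_powr_le:
  assumes k: "k > 0" and s: "Re s \<ge> -2"
  shows "norm (second_diff_powr k s) \<le> 2 * norm (s * (s + 1)) * real k powr (- Re s - 2)"
proof -
  define B where "B = norm (s + 1) * real k powr (- Re s - 2)"
  define E where "E t = of_real (real k + 2 * t) powr (- s) - 2 * of_real (real k + t) powr (- s)
     + of_real (real k) powr (- s)" for t
  define E1 where "E1 t = - 2 * s * (of_real (real k + 2 * t) powr (- s - 1)
     - of_real (real k + t) powr (- s - 1))" for t
  have D: "((\<lambda>t. of_real (b + c * t) powr a) has_vector_derivative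
      of_real c * a * of_real (b + c * t) powr (a - 1)) (at t within {0..1})"
    if "t \<in> {0..1}" "c \<ge> 0" "b > 0" for t b c and a :: complex
  proof -
    have "b + c * t > 0" using that by (intro add_pos_nonneg) auto
    have "((\<lambda>t. b + c * t) has_vector_derivative c) (at t within {0..1})"
      by (auto intro!: derivative_eq_intros)
    from vector_diff_chain_within[OF this has_vector_derivative_of_real_powr[OF \<open>b + c * t > 0\<close>, of a]]
    show ?thesis by (simp add: o_def scaleR_conv_of_real mult_ac)
  qed
  have d1: "(E has_vector_derivative E1 t) (at t within {0..1})" if "t \<in> {0..1}" for t
    unfolding E_def E1_def using k that D[of t 1 "real k" "- s"] D[of t 2 "real k" "- s"]
    by (auto intro!: derivative_eq_intros simp: algebra_simps simp del: of_real_add)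
  have b1: "norm (E1 t) \<le> 2 * norm s * B" if t: "t \<in> {0..1}" for t
  proof -
    \<comment> \<open>\<open>g\<close> runs from the point k + t to the point k + 2 t, the two
      arguments that occur in \<open>E1 t\<close>.\<close>
    define g where "g u = of_real (real k + t + t * u) powr (- s - 1)" for u
    define g1 where "g1 u = of_real t * (- s - 1) * of_real (real k + t + t * u) powr (- 2 - s)" for u
    have pos: "real k + t + t * u \<ge> k" if "u \<in> {0..1}" for u using that t by simp
    have "norm (g 1 - g 0) \<le> B"
    proof (rule norm_diff_le_of_vector_derivative)
      show "(g has_vector_derivative g1 u) (at u within {0..1})" if "u \<in> {0..1}" for u
        using D[of u t "real k + t" "- s - 1"] that t k
        by (simp add: g_def [abs_def] g1_def add_pos_nonneg del: of_real_add)
      show "norm (g1 u) \<le> B" if "u \<in> {0..1}" for u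
      proof -
        have "norm (g1 u) = t * norm (s + 1) * (real k + t + t * u) powr (- Re s - 2)"
          using t k pos[OF that] norm_minus_cancel[of "s + 1"]
          by (simp add: g1_def norm_mult norm_of_real_powr minus_diff_commute del: of_real_add norm_minus_cancel)
        also have "\<dots> \<le> 1 * norm (s + 1) * real k powr (- Re s - 2)"
          using t k pos[OF that] s by (intro mult_mono powr_mono2') auto
        finally show ?thesis by (simp add: B_def)
      qed
    qed auto
    hence "2 * norm s * norm (g 1 - g 0) \<le> 2 * norm s * B" by (intro mult_left_mono) auto
    moreover have "E1 t = - 2 * s * (g 1 - g 0)" by (simp add: E1_def g_def add_ac)
    ultimately show ?thesis by (simp add: norm_mult del: minus_diff_eq)
  qed
  have "norm (E 1 - E 0) \<le> 2 * norm s * B"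
    using norm_diff_le_of_vector_derivative[OF d1 b1, of 1] by simp
  moreover have "E 0 = 0" "E 1 = second_diff_powr k s"
    by (simp_all add: E_def second_diff_powr_def add_ac)
  ultimately show ?thesis by (simp add: B_def norm_mult mult_ac)
qed

lemma holomorphic_second_diff_powr [holomorphic_intros]:
  "second_diff_powr k holomorphic_on A"
proof -
  have "(\<lambda>s. complex_of_nat n powr (- s)) holomorphic_on A" for n
    by (cases "n = 0") (auto intro!: holomorphic_intros simp: complex_eq_iff)
  from this[of "k + 2"] this[of "k + 1"] this[of k] show ?thesis
    unfolding second_diff_powr_def [abs_def] by (intro holomorphic_intros) 
qed

lemma summable_norm_second_diff_powr:
  assumes "Re s > -1"
  shows "summable (\<lambda>k. norm (second_diff_powr k s))"
proof (rule summable_comparison_test_ev)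
  show "\<forall>\<^sub>F k in sequentially. norm (norm (second_diff_powr k s))
      \<le> 2 * norm (s * (s + 1)) * real k powr (- Re s - 2)"
    using eventually_gt_at_top[of 0]
    by eventually_elim (use assms norm_second_diff_powr_le[of _ s] in auto)
  show "summable (\<lambda>k. 2 * norm (s * (s + 1)) * real k powr (- Re s - 2))"
    using assms by (intro summable_mult) (simp add: summable_real_powr_iff)
qed

lemma holomorphic_second_diff_series:
  assumes z: "norm z = 1"
  shows "(\<lambda>s. \<Sum>k. z ^ (k + 2) * second_diff_powr k s) holomorphic_on {s. Re s > -1}"
proof (rule holomorphic_uniform_sequence)
  show "(\<lambda>s. \<Sum>k<n. z ^ (k + 2) * second_diff_powr k s) holomorphic_on {s. Re s > -1}" for n
    by (intro holomorphic_intros)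
  show op: "open {s. Re s > -1}" by (simp add: open_halfspace_Re_gt)
  fix s assume "s \<in> {s. Re s > -1}"
  then obtain d where d: "d > 0" "cball s d \<subseteq> {s. Re s > -1}"
    using op open_contains_cball by blast
  let ?K = "cball s d"
  obtain s0 where s0: "s0 \<in> ?K" "\<And>s. s \<in> ?K \<Longrightarrow> Re s0 \<le> Re s"
    using continuous_attains_inf[OF compact_cball, of s d Re] continuous_on_Re[OF continuous_on_id] d
    by auto
  obtain C where C0: "C \<ge> 0" and C: "\<And>s. s \<in> ?K \<Longrightarrow> norm (s * (s + 1)) \<le> C"
    by (rule continuous_on_compact_norm_bound[OF compact_cball, of s d "\<lambda>s. s * (s + 1)"])
      (auto intro!: continuous_intros)
  have "uniform_limit ?K (\<lambda>n s. \<Sum>k<n. z ^ (k + 2) * second_diff_powr k s)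
      (\<lambda>s. \<Sum>k. z ^ (k + 2) * second_diff_powr k s) sequentially"
  proof (rule Weierstrass_m_test_ev)
    show "summable (\<lambda>k. 2 * C * real k powr (- Re s0 - 2))"
      using s0(1) d(2) by (intro summable_mult) (auto simp: summable_real_powr_iff)
    show "\<forall>\<^sub>F k in sequentially. \<forall>s\<in>?K. norm (z ^ (k + 2) * second_diff_powr k s)
        \<le> 2 * C * real k powr (- Re s0 - 2)"
      using eventually_ge_at_top[of 1]
    proof eventually_elim
      case (elim k)
      show ?case
      proof
        fix s assume s: "s \<in> ?K"
        hence "Re s > -1" using d by auto
        have "norm (z ^ (k + 2) * second_diff_powr k s) = norm (second_diff_powr k s)"
          using z by (simp add: norm_mult norm_power)
        also have "\<dots> \<le> 2 * norm (s * (s + 1)) * real k powr (- Re s - 2)"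
          using elim \<open>Re s > -1\<close> by (intro norm_second_diff_powr_le) auto
        also have "\<dots> \<le> 2 * C * real k powr (- Re s0 - 2)"
          using elim C[OF s] s0(2)[OF s] C0 by (intro mult_mono powr_mono) auto
        finally show "norm (z ^ (k + 2) * second_diff_powr k s) \<le> 2 * C * real k powr (- Re s0 - 2)" .
      qed
    qed
  qed
  with d show "\<exists>d>0. cball s d \<subseteq> {s. Re s > -1} \<and>
      uniform_limit (cball s d) (\<lambda>n s. \<Sum>k<n. z ^ (k + 2) * second_diff_powr k s)
      (\<lambda>s. \<Sum>k. z ^ (k + 2) * second_diff_powr k s) sequentially"
    by blast
qed

text \<open>Two summations by parts make the twisted series \<open>\<Sum> z\<^sup>n n\<^sup>-\<^sup>s\<close> converge absolutely
  for \<open>Re s > -1\<close>.\<close>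
lemma twisted_sum_eq_second_diff_series:
  fixes z :: complex
  assumes m: "m > 0" and z: "z ^ m = 1" "z \<noteq> 1" and s: "Re s > -1"
  shows "(1 - z) ^ 2 * (of_nat m powr (- s) * (\<Sum>r=1..m. z ^ r * hurwitz_num (real r / real m) s)) =
     (s - 1) * (z + (\<Sum>k. z ^ (k + 2) * second_diff_powr k s))"
proof (rule analytic_continuation_halfplane[where a = "-1" and b = 1 and s = s and
      f = "\<lambda>s. (1 - z) ^ 2 * (of_nat m powr (- s) * (\<Sum>r=1..m. z ^ r * hurwitz_num (real r / real m) s))"
      and g = "\<lambda>s. (s - 1) * (z + (\<Sum>k. z ^ (k + 2) * second_diff_powr k s))"])
  have nz: "norm z = 1"
    using z m by (metis norm_one norm_power power_eq_1_iff norm_ge_zero less_irrefl)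
  show "(\<lambda>s. (1 - z) ^ 2 * (of_nat m powr (- s) *
      (\<Sum>r=1..m. z ^ r * hurwitz_num (real r / real m) s))) holomorphic_on {s. Re s > -1}"
    using m by (intro holomorphic_intros holomorphic_hurwitz_num) (auto simp: complex_eq_iff)
  show "(\<lambda>s. (s - 1) * (z + (\<Sum>k. z ^ (k + 2) * second_diff_powr k s))) holomorphic_on {s. Re s > -1}"
    by (intro holomorphic_intros holomorphic_second_diff_series nz)
  fix s :: complex assume s: "Re s > 1"
  define S where "S = of_nat m powr (- s) * (\<Sum>r=1..m. z ^ r * (hurwitz_num (real r / real m) s / (s - 1)))"
  define f where "f n = z ^ n * of_nat n powr (- s)" for n
  have f: "(\<lambda>k. f (Suc k)) sums S"
    unfolding f_def S_def using twisted_sums[OF m z(1) s] by simp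
  \<comment> \<open>The term n = 0 vanishes because \<open>0 powr (- s) = 0\<close>, so this shift
    does not change the sum; the next one splits off the term z.\<close>
  have f0: "f sums S" using f sums_Suc[of f S] by (simp add: f_def)
  have f2: "(\<lambda>k. f (Suc (Suc k))) sums (S - z)"
    using f sums_Suc_iff[of "\<lambda>k. f (Suc k)" "S - z"] by (simp add: f_def)
  have "(\<lambda>k. f (Suc (Suc k)) - 2 * z * f (Suc k) + z ^ 2 * f k) sums (S - z - 2 * z * S + z ^ 2 * S)"
    by (intro sums_add sums_diff sums_mult f f0 f2)
  also have "(\<lambda>k. f (Suc (Suc k)) - 2 * z * f (Suc k) + z ^ 2 * f k) =
      (\<lambda>k. z ^ (k + 2) * second_diff_powr k s)"
    by (auto simp: f_def second_diff_powr_def fun_eq_iff algebra_simps power2_eq_square)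
  finally have "(\<Sum>k. z ^ (k + 2) * second_diff_powr k s) = (1 - z) ^ 2 * S - z"
    by (simp add: sums_iff power2_eq_square algebra_simps)
  moreover have "s \<noteq> 1" using s by auto
  moreover from this have "(s - 1) * S = of_nat m powr (- s) * (\<Sum>r=1..m. z ^ r * hurwitz_num (real r / real m) s)"
    by (simp add: S_def sum_distrib_left)
  ultimately show "(1 - z) ^ 2 * (of_nat m powr (- s) *
      (\<Sum>r=1..m. z ^ r * hurwitz_num (real r / real m) s)) =
      (s - 1) * (z + (\<Sum>k. z ^ (k + 2) * second_diff_powr k s))"
    by (simp add: mult.left_commute)
qed fact

subsection \<open>Partial fractions and Mellin integrals\<close>

lemma sin_pi_times_nonzero:
  fixes x :: complex
  assumes "x \<notin> \<int>"
  shows "sin (of_real pi * x) \<noteq> 0"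
proof
  assume "sin (of_real pi * x) = 0"
  then obtain n :: int where "of_real pi * x = of_real (of_int n * pi)"
    unfolding sin_eq_0 by blast
  hence "x = of_int n" by simp
  thus False using assms by simp
qed

text \<open>Differentiating the reflection formula of Gamma gives Digamma(1 - z) - Digamma(z) = pi
  cot(pi z). In the difference of the two Digamma series the terms 1 / (k + 1) and Euler's constant
  cancel.\<close>

lemma pi_cot_sums:
  fixes z :: complex
  assumes "z \<notin> \<int>"
  shows "(\<lambda>k. 1 / (z + of_nat k) - 1 / (1 - z + of_nat k)) sums (of_real pi * cot (of_real pi * z))"
proof -
  have nz: "sin (of_real pi * z) \<noteq> 0"
    using assms by (rule sin_pi_times_nonzero)
  have z': "1 - z \<notin> \<int>" using assms Ints_diff[OF Ints_1, of "1 - z"] by auto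
  have ni: "z \<notin> \<int>\<^sub>\<le>\<^sub>0" "1 - z \<notin> \<int>\<^sub>\<le>\<^sub>0"
    using assms z' nonpos_Ints_Int by blast+
  have "((\<lambda>w. Gamma w * Gamma (1 - w)) has_field_derivative
      Gamma z * Gamma (1 - z) * (Digamma z - Digamma (1 - z))) (at z)"
    using ni by (auto intro!: derivative_eq_intros simp: algebra_simps)
  hence "((\<lambda>w. of_real pi / sin (of_real pi * w)) has_field_derivative
      Gamma z * Gamma (1 - z) * (Digamma z - Digamma (1 - z))) (at z)"
    by (simp add: Gamma_reflection_complex)
  moreover have "((\<lambda>w. of_real pi / sin (of_real pi * w)) has_field_derivative
      Gamma z * Gamma (1 - z) * (- of_real pi * cot (of_real pi * z))) (at z)"
    using nz by (auto intro!: derivative_eq_intros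
        simp: Gamma_reflection_complex cot_def field_simps power2_eq_square)
  ultimately have "Gamma z * Gamma (1 - z) * (Digamma z - Digamma (1 - z)) =
      Gamma z * Gamma (1 - z) * (- of_real pi * cot (of_real pi * z))"
    by (rule DERIV_unique)
  moreover have "Gamma z * Gamma (1 - z) \<noteq> 0" using ni by (simp add: Gamma_eq_zero_iff)
  ultimately have "Digamma z - Digamma (1 - z) = - of_real pi * cot (of_real pi * z)"
    by (simp only: mult_cancel_left) simp
  hence eq: "Digamma (1 - z) - Digamma z = of_real pi * cot (of_real pi * z)"
    by (metis minus_diff_eq minus_minus mult_minus_left)
  have "(\<lambda>k. (inverse (of_nat (Suc k)) - inverse (1 - z + of_nat k)) -
      (inverse (of_nat (Suc k)) - inverse (z + of_nat k))) sums
      ((Digamma (1 - z) + euler_mascheroni) - (Digamma z + euler_mascheroni))"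
    unfolding Digamma_def using ni
    by (intro sums_diff) (auto intro!: summable_sums summable_Digamma simp del: of_nat_Suc)
  thus ?thesis by (simp add: eq inverse_eq_divide)
qed

text \<open>The kernel of the Mellin transform of \<open>\<Sum> e\<^sup>2\<^sup>\<pi>\<^sup>i\<^sup>n\<^sup>v n\<^sup>-\<^sup>s\<close>; its poles lie on the imaginary axis.\<close>
lemma exp_kernel_partial_fractions:
  fixes u v :: real
  assumes v: "0 < v" "v < 1"
  defines "z \<equiv> cis (2 * pi * v)"
  defines "p \<equiv> (\<lambda>a::real. Complex (u / (u ^ 2 + a ^ 2)) (u ^ 2 / (a * (u ^ 2 + a ^ 2))))"
  shows "(\<lambda>k. p (2 * pi * (real k + 1 - v)) + p (- 2 * pi * (real k + v))) sums
     (z * (exp (- of_real u) - 1) / ((1 - z * exp (- of_real u)) * (1 - z)))"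
proof -
  \<comment> \<open>Chosen such that exp(2 pi i w) = z e^(-u). The kernel is then i / (2 pi) times
    the difference of pi cot(pi x) at x = w and at x = v, and the value at v is the subtracted value
    at u = 0.\<close>
  define w where "w = of_real v + \<i> * of_real u / (2 * of_real pi)"
  have nint: "x \<notin> \<int>" if "Re x = v" for x
  proof
    assume "x \<in> \<int>"
    then obtain n where "x = of_int n" by (elim Ints_cases)
    hence "v = of_int n" using that by simp
    thus False using v by auto
  qed
  have v': "complex_of_real v \<notin> \<int>" and w: "w \<notin> \<int>"
    by (rule nint; simp add: w_def)+
  have exp1: "exp (2 * of_real pi * \<i> * x) \<noteq> 1" if "x \<notin> \<int>" for x :: complex
  proof
    assume "exp (2 * of_real pi * \<i> * x) = 1"
    then obtain n where "Im x = 0" "2 * pi * Re x = of_int (2 * n) * pi"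
      by (auto simp: exp_eq_1)
    hence "x = of_int n" by (simp add: complex_eq_iff)
    thus False using that by simp
  qed
  have cot_exp: "of_real pi * cot (of_real pi * x) = of_real pi * \<i> * (1 + 2 / (exp (2 * of_real pi * \<i> * x) - 1))"
    if "x \<notin> \<int>" for x :: complex
  proof -
    have nz: "sin (of_real pi * x) \<noteq> 0"
      using that by (rule sin_pi_times_nonzero)
    define e where "e = exp (\<i> * (of_real pi * x))"
    have e: "e \<noteq> 0" by (simp add: e_def)
    have s: "sin (of_real pi * x) = (e - 1 / e) / (2 * \<i>)" "cos (of_real pi * x) = (e + 1 / e) / 2"
      by (simp_all add: e_def sin_exp_eq cos_exp_eq exp_minus inverse_eq_divide)
    have e2: "exp (2 * of_real pi * \<i> * x) = e * e"
      by (simp add: e_def exp_add [symmetric]) (simp add: algebra_simps)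
    have "e * e \<noteq> 1" using exp1[OF that] by (simp add: e2)
    thus ?thesis
      using e nz unfolding cot_def s e2 by (simp add: divide_simps)
  qed
  have ew: "exp (2 * of_real pi * \<i> * w) = z * exp (- of_real u)"
  proof -
    have "2 * of_real pi * \<i> * w = \<i> * of_real (2 * pi * v) + - of_real u"
      by (simp add: w_def field_simps)
    thus ?thesis by (simp add: exp_diff z_def cis_conv_exp exp_minus divide_inverse)
  qed
  have ev: "exp (2 * of_real pi * \<i> * of_real v) = z"
    by (simp add: z_def cis_conv_exp mult_ac)
  have nz: "z * exp (- of_real u) \<noteq> 1" "z \<noteq> 1"
    using exp1[OF w] exp1[OF v'] by (simp_all add: ew ev)
  have "(\<lambda>k. \<i> / (2 * of_real pi) * ((1 / (w + of_nat k) - 1 / (1 - w + of_nat k))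
      - (1 / (of_real v + of_nat k) - 1 / (1 - of_real v + of_nat k)))) sums
      (\<i> / (2 * of_real pi) * (of_real pi * cot (of_real pi * w) - of_real pi * cot (of_real pi * of_real v)))"
    by (intro sums_mult sums_diff pi_cot_sums v' w)
  also have "\<i> / (2 * of_real pi) * (of_real pi * cot (of_real pi * w) - of_real pi * cot (of_real pi * of_real v))
     = z * (exp (- of_real u) - 1) / ((1 - z * exp (- of_real u)) * (1 - z))"
    using nz unfolding cot_exp[OF w] cot_exp[OF v'] ew ev
    by (simp add: divide_simps) (simp add: algebra_simps)
  also have "(\<lambda>k. \<i> / (2 * of_real pi) * ((1 / (w + of_nat k) - 1 / (1 - w + of_nat k))
      - (1 / (of_real v + of_nat k) - 1 / (1 - of_real v + of_nat k)))) =
      (\<lambda>k. p (2 * pi * (real k + 1 - v)) + p (- 2 * pi * (real k + v)))"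
  proof
    fix k
    define c where "c b = of_real b + \<i> * of_real u / (2 * of_real pi)" for b :: real
    \<comment> \<open>With a = -2 pi b, one term of the cotangent series becomes u / (a (a - i u)),
      which is \<open>p a\<close> split into real and imaginary part. The shifts k + v and -(k + 1 -
      v) produce the two families of poles.\<close>
    have 1: "\<i> / (2 * of_real pi) * (1 / c b - 1 / of_real b) = p (- 2 * pi * b)" if "b \<noteq> 0" for b :: real
    proof -
      define a where "a = - 2 * pi * b"
      have a: "a \<noteq> 0" "complex_of_real b = - of_real a / (2 * of_real pi)" using that by (simp_all add: a_def)
      have nz: "complex_of_real a - \<i> * of_real u \<noteq> 0" "u ^ 2 + a ^ 2 \<noteq> 0"
        using a by (auto simp: complex_eq_iff sum_power2_eq_zero_iff)
      have cb: "c b = - (of_real a - \<i> * of_real u) / (2 * of_real pi)"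
        by (simp add: c_def a diff_divide_distrib)
      have "\<i> / (2 * of_real pi) * (1 / c b - 1 / of_real b) =
          of_real u / (of_real a * (of_real a - \<i> * of_real u))"
        unfolding cb a(2) using nz a by (simp add: divide_simps) (simp add: algebra_simps)
      also have "\<dots> = p a"
      proof -
        have "p a * (of_real a * (of_real a - \<i> * of_real u)) = of_real u"
          using nz a by (simp add: p_def complex_eq_iff power2_eq_square divide_simps)
            (simp add: algebra_simps)
        thus ?thesis using nz a by (simp add: field_simps)
      qed
      finally show ?thesis by (simp add: a_def)
    qed
    define b where "b = - (real k + 1 - v)"
    have eqs: "of_real v + of_nat k = (of_real (real k + v) :: complex)"
         "1 - of_real v + of_nat k = - (of_real b :: complex)"
         "w + of_nat k = c (real k + v)" "1 - w + of_nat k = - c b"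
      by (simp_all add: w_def c_def b_def)
    have "\<i> / (2 * of_real pi) * ((1 / (w + of_nat k) - 1 / (1 - w + of_nat k))
      - (1 / (of_real v + of_nat k) - 1 / (1 - of_real v + of_nat k))) =
      \<i> / (2 * of_real pi) * (1 / c (real k + v) - 1 / of_real (real k + v)) +
      \<i> / (2 * of_real pi) * (1 / c b - 1 / of_real b)"
      unfolding eqs by (simp add: algebra_simps)
    also have "\<dots> = p (2 * pi * (real k + 1 - v)) + p (- 2 * pi * (real k + v))"
    proof (subst (1 2) 1)
      show "real k + v \<noteq> 0" "b \<noteq> 0" using v by (auto simp: b_def)
    qed (simp add: b_def algebra_simps)
    finally show "\<i> / (2 * of_real pi) * ((1 / (w + of_nat k) - 1 / (1 - w + of_nat k))
      - (1 / (of_real v + of_nat k) - 1 / (1 - of_real v + of_nat k))) =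
      p (2 * pi * (real k + 1 - v)) + p (- 2 * pi * (real k + v))" .
  qed
  finally show ?thesis .
qed

section \<open>Mellin integrals of the two expansions\<close>

lemma Beta_complement:
  fixes a :: real
  assumes "0 < a" "a < 1"
  shows "Beta a (1 - a) = pi / sin (pi * a)"
proof -
  have "complex_of_real (Gamma a * Gamma (1 - a)) = of_real (pi / sin (pi * a))"
    using Gamma_reflection_complex[of "of_real a"] 
    by (simp add: Gamma_complex_of_real [symmetric] sin_of_real [symmetric])
  hence "Gamma a * Gamma (1 - a) = pi / sin (pi * a)" by (simp only: of_real_eq_iff)
  thus ?thesis by (simp add: Beta_def)
qed

text \<open>The known Gamma and Beta integrals are gauge integrals, whereas sums and integrals are
  interchanged for Lebesgue integrals. For nonnegative functions the first kind gives the
  second.\<close>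

lemma set_integrable_lborel_of_has_integral_nonneg:
  fixes f :: "real \<Rightarrow> real"
  assumes "(f has_integral I) A" "\<And>x. x \<in> A \<Longrightarrow> f x \<ge> 0" "A \<in> sets borel" "f \<in> borel_measurable borel"
  shows "set_integrable lborel A f" "(LINT x:A|lborel. f x) = I"
proof -
  have "f absolutely_integrable_on A"
    using assms by (intro nonnegative_absolutely_integrable_1) auto
  thus int: "set_integrable lborel A f"
    using assms(3,4) unfolding set_integrable_def
    by (subst (asm) integrable_completion) auto
  show "(LINT x:A|lborel. f x) = I"
    using set_borel_integral_eq_integral(2)[OF int] assms(1) by (simp add: integral_unique)
qed

text \<open>The substitution t = u^2 / (u^2 + a^2) maps the half-line onto (0, 1) and leads to the
  Beta integral with parameters b = (q + 1) / 2 and 1 - b, which the reflection formula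
  evaluates.\<close>

lemma integral_powr_over_sum_squares:
  fixes a q :: real
  assumes a: "a > 0" and q: "-1 < q" "q < 1"
  defines "f \<equiv> (\<lambda>u. u powr q / (u ^ 2 + a ^ 2))"
  shows "set_integrable lborel {0<..} f"
    and "(LINT u:{0<..}|lborel. f u) = a powr (q - 1) * (pi / (2 * cos (pi * q / 2)))"
proof -
  define b where "b = (q + 1) / 2"
  have b: "0 < b" "b < 1" using q by (auto simp: b_def)
  define h where "h t = t powr (b - 1) * (1 - t) powr ((1 - b) - 1)" for t :: real
  define g where "g u = u ^ 2 / (u ^ 2 + a ^ 2)" for u :: real
  define g' where "g' u = 2 * u * a ^ 2 / (u ^ 2 + a ^ 2) ^ 2" for u :: real
  have pos: "u ^ 2 + a ^ 2 > 0" for u using a by (simp add: add_nonneg_pos)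
  have h: "(h has_integral Beta b (1 - b)) {0<..<1}"
    unfolding h_def using has_integral_Beta_real[of b "1 - b"] b by (simp add: has_integral_Icc_iff_Ioo)
  have ha: "h absolutely_integrable_on {0<..<1}"
    using h by (intro nonnegative_absolutely_integrable_1) (auto simp: h_def)
  have im: "g ` {0<..} = {0<..<1}"
  proof safe
    fix u :: real assume "u > 0"
    thus "g u \<in> {0<..<1}" using pos[of u] a by (auto simp: g_def field_simps)
  next
    fix t :: real assume t: "t \<in> {0<..<1}"
    define u where "u = a * sqrt (t / (1 - t))"
    have u2: "u ^ 2 = a ^ 2 * (t / (1 - t))" using t by (simp add: u_def power_mult_distrib)
    have "g u = t" using t a unfolding g_def u2 by (simp add: field_simps)
    moreover have "u > 0" using t a by (simp add: u_def)
    ultimately show "t \<in> g ` {0<..}" by (metis greaterThan_iff imageI)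
  qed
  have inj: "inj_on g {0<..}"
  proof (rule inj_onI)
    fix x y :: real assume xy: "x \<in> {0<..}" "y \<in> {0<..}" "g x = g y"
    hence "x ^ 2 * (y ^ 2 + a ^ 2) = y ^ 2 * (x ^ 2 + a ^ 2)"
      using pos[of x] pos[of y] by (simp add: g_def frac_eq_eq)
    hence "x ^ 2 * a ^ 2 = y ^ 2 * a ^ 2" by (simp add: algebra_simps)
    thus "x = y" using xy a by (simp add: power2_eq_iff)
  qed
  have der: "(g has_field_derivative g' u) (at u within {0<..})" for u
    using pos[of u] unfolding g_def g'_def
    by (auto intro!: derivative_eq_intros simp: power2_eq_square field_simps)
  have eq: "\<bar>g' u\<bar> * h (g u) = 2 * a powr (1 - q) * f u" if "u \<in> {0<..}" for u
  proof -
    have u: "u > 0" using that by simp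
    define c where "c = u ^ 2 + a ^ 2"
    have c: "c > 0" using pos by (simp add: c_def)
    have "1 - g u = a ^ 2 / c" using c by (simp add: g_def diff_divide_eq_iff flip: c_def) (simp add: c_def)
    hence "h (g u) = (u ^ 2 / c) powr (b - 1) * (a ^ 2 / c) powr (- b)"
      by (simp add: h_def g_def c_def)
    also have "(u ^ 2 / c) powr (b - 1) = u powr (q - 1) * c powr (1 - b)"
    proof -
      have "(u ^ 2) powr (b - 1) = u powr (q - 1)"
        using u powr_powr[of u 2 "b - 1"] by (simp add: b_def right_diff_distrib diff_divide_distrib flip: powr_numeral)
      moreover have "c powr (1 - b) = 1 / c powr (b - 1)"
        using powr_minus_divide[of c "b - 1"] by simp
      ultimately show ?thesis using c by (simp add: powr_divide)
    qed
    also have "(a ^ 2 / c) powr (- b) = a powr (- q - 1) * c powr b"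
    proof -
      have "2 * - b = - q - 1" by (simp add: b_def field_simps)
      hence "(a ^ 2) powr (- b) = a powr (- q - 1)"
        using a powr_powr[of a 2 "- b"] by (simp flip: powr_numeral)
      moreover have "c powr b = 1 / c powr (- b)"
        using powr_minus_divide[of c "- b"] by simp
      ultimately show ?thesis using c by (simp add: powr_divide)
    qed
    also have "u powr (q - 1) * c powr (1 - b) * (a powr (- q - 1) * c powr b) =
        u powr (q - 1) * a powr (- q - 1) * (c powr (1 - b) * c powr b)"
      by simp
    also have "c powr (1 - b) * c powr b = c" using c by (simp flip: powr_add)
    finally have hg: "h (g u) = u powr (q - 1) * a powr (- q - 1) * c" .
    have "\<bar>g' u\<bar> * h (g u) = 2 * (u * u powr (q - 1)) * (a ^ 2 * a powr (- q - 1)) / c"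
    proof -
      have "\<bar>g' u\<bar> = 2 * u * a ^ 2 / c ^ 2" using u by (simp add: g'_def c_def)
      thus ?thesis using c by (simp add: hg power2_eq_square[of c])
    qed
    also have "u * u powr (q - 1) = u powr q" using u by (simp add: powr_mult_base)
    also have "a ^ 2 * a powr (- q - 1) = a powr (1 - q)"
      using a powr_add[of a 2 "- q - 1"] by simp
    finally show ?thesis by (simp add: f_def c_def)
  qed
  have cv: "(\<lambda>u. \<bar>g' u\<bar> * h (g u)) absolutely_integrable_on {0<..} \<and>
      integral {0<..} (\<lambda>u. \<bar>g' u\<bar> * h (g u)) = Beta b (1 - b)"
  proof (rule iffD2[OF has_absolute_integral_change_of_variables_1'[OF _ der inj]])
    show "h absolutely_integrable_on g ` {0<..} \<and> integral (g ` {0<..}) h = Beta b (1 - b)"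
      unfolding im using ha h by (auto intro: integral_unique)
  qed auto
  have "(\<lambda>u. 2 * a powr (1 - q) * f u) absolutely_integrable_on {0<..}"
    by (rule iffD1[OF set_integrable_cong[OF refl refl eq] conjunct1[OF cv]])
  hence fa: "f absolutely_integrable_on {0<..}"
    using a by (simp add: set_integrable_mult_right_iff)
  have fi: "(f has_integral integral {0<..} f) {0<..}"
    using fa by (intro integrable_integral set_lebesgue_integral_eq_integral(1))
  have fm: "f \<in> borel_measurable borel" unfolding f_def by measurable
  note * = set_integrable_lborel_of_has_integral_nonneg[OF fi _ _ fm]
  show int: "set_integrable lborel {0<..} f"
    by (rule *) (auto simp: f_def)
  have "Beta b (1 - b) = integral {0<..} (\<lambda>u. \<bar>g' u\<bar> * h (g u))" using cv by simp
  also have "\<dots> = integral {0<..} (\<lambda>u. 2 * a powr (1 - q) * f u)"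
    by (intro integral_cong eq)
  also have "\<dots> = 2 * a powr (1 - q) * integral {0<..} f" by simp
  finally have "integral {0<..} f = a powr (q - 1) * (Beta b (1 - b) / 2)"
    using a powr_minus[of a "q - 1"] by (simp add: field_simps)
  also have "Beta b (1 - b) = pi / cos (pi * q / 2)"
    unfolding Beta_complement[OF b] by (simp add: b_def sin_cos_eq field_simps)
  finally have "integral {0<..} f = a powr (q - 1) * (pi / (2 * cos (pi * q / 2)))"
    by simp
  moreover have "(LINT u:{0<..}|lborel. f u) = integral {0<..} f"
    by (rule *) (auto simp: f_def)
  ultimately show "(LINT u:{0<..}|lborel. f u) = a powr (q - 1) * (pi / (2 * cos (pi * q / 2)))"
    by simp
qed

text \<open>The factor 1 - e^(-c u) is at most c u and at most 1. Both bounds are absorbed by a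
  multiple of (u + u^2) / (u^2 + 1), so that the majorant consists of the integrals just computed,
  with q = s and q = s + 1.\<close>

lemma integrable_powr_one_minus_exp:
  fixes c s :: real
  assumes s: "-1 < s" "s < 0" and c: "c \<ge> 0"
  shows "set_integrable lborel {0<..} (\<lambda>u. u powr (s - 1) * (1 - exp (- c * u)))"
proof (rule set_integrable_bound)
  show "set_integrable lborel {0<..} (\<lambda>u. 2 * (1 + c) *
      (u powr s / (u ^ 2 + 1 ^ 2) + u powr (s + 1) / (u ^ 2 + 1 ^ 2)))"
    using s by (intro set_integrable_mult_right set_integral_add integral_powr_over_sum_squares) auto
  show "set_borel_measurable lborel {0<..} (\<lambda>u. u powr (s - 1) * (1 - exp (- c * u)))"
    by (simp add: set_borel_measurable_def)
  have "norm (u powr (s - 1) * (1 - exp (- c * u))) \<le>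
      norm (2 * (1 + c) * (u powr s / (u ^ 2 + 1 ^ 2) + u powr (s + 1) / (u ^ 2 + 1 ^ 2)))" if u: "u > 0" for u
  proof -
    have pos: "u ^ 2 + 1 > 0" by (simp add: add_nonneg_pos)
    have "1 - exp (- c * u) \<le> 2 * (1 + c) * (u + u ^ 2) / (u ^ 2 + 1)"
    proof (cases "u \<le> 1")
      case True
      have *: "1 - exp (- c * u) \<le> c * u" using exp_ge_add_one_self[of "- c * u"] by simp
      have "c * u * (u ^ 2 + 1) \<le> c * u * 2"
        using u c True by (intro mult_left_mono) (auto simp: power_le_one)
      also have "c * u * 2 \<le> 2 * (1 + c) * (u + u ^ 2)"
      proof -
        define X where "X = u + u ^ 2 + c * u ^ 2"
        have eq: "2 * (1 + c) * (u + u ^ 2) = c * u * 2 + 2 * X"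
          by (simp add: X_def algebra_simps)
        have "X \<ge> 0" unfolding X_def using u c by (intro add_nonneg_nonneg) auto
        thus ?thesis unfolding eq by simp
      qed
      finally have "c * u * (u ^ 2 + 1) \<le> 2 * (1 + c) * (u + u ^ 2)" .
      hence "c * u \<le> 2 * (1 + c) * (u + u ^ 2) / (u ^ 2 + 1)" using pos by (simp add: pos_le_divide_eq)
      with * show ?thesis by linarith
    next
      case False
      have "1 * (u ^ 2 + 1) \<le> 2 * 1 * (u + u ^ 2)" using False u
          by (simp add: power2_eq_square) (smt (verit) mult_nonneg_nonneg)
      also have "\<dots> \<le> 2 * (1 + c) * (u + u ^ 2)" using c u by (intro mult_right_mono) auto
      finally have "1 * (u ^ 2 + 1) \<le> 2 * (1 + c) * (u + u ^ 2)" .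
      hence "1 \<le> 2 * (1 + c) * (u + u ^ 2) / (u ^ 2 + 1)" using pos by (simp add: pos_le_divide_eq)
      moreover have "1 - exp (- c * u) \<le> 1" by simp
      ultimately show ?thesis by linarith
    qed
    hence "u powr (s - 1) * (1 - exp (- c * u)) \<le> u powr (s - 1) * (2 * (1 + c) * (u + u ^ 2) / (u ^ 2 + 1))"
      by (intro mult_left_mono) auto
    also have "\<dots> = 2 * (1 + c) * (u * u powr (s - 1) + u * (u * u powr (s - 1))) / (u ^ 2 + 1)"
      by (simp add: algebra_simps power2_eq_square)
    also have "u * u powr (s - 1) = u powr s" using u by (simp add: powr_mult_base)
    also have "u * u powr s = u powr (s + 1)" using u by (simp add: powr_mult_base add.commute)
    finally show ?thesis
      using u c by (simp add: add_divide_distrib distrib_left)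
  qed
  thus "AE u in lborel. u \<in> {0<..} \<longrightarrow> norm (u powr (s - 1) * (1 - exp (- c * u))) \<le>
      norm (2 * (1 + c) * (u powr s / (u ^ 2 + 1 ^ 2) + u powr (s + 1) / (u ^ 2 + 1 ^ 2)))"
    by simp
qed

text \<open>Integration by parts: the derivative of u^s (1 - e^(-u)) is s times this integrand plus
  the integrand of Gamma(s + 1), and for -1 < s < 0 both boundary values vanish.\<close>

lemma integral_powr_one_minus_exp_1:
  fixes s :: real
  assumes s: "-1 < s" "s < 0"
  shows "(LINT u:{0<..}|lborel. u powr (s - 1) * (1 - exp (- u))) = - Gamma s"
proof -
  let ?f = "\<lambda>u. u powr (s - 1) * (1 - exp (- u))"
  let ?g = "\<lambda>u::real. u powr s / exp u"
  \<comment> \<open>The library integral is over the closed half-line; the point 0 is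
    negligible.\<close>
  have "(?g has_integral Gamma (s + 1)) {0<..}"
  proof (rule iffD1[OF has_integral_spike_set_eq[of "{0..}"]])
    show "(?g has_integral Gamma (s + 1)) {0..}"
      using Gamma_integral_real[of "s + 1"] s by simp
    show "negligible {x \<in> {0..} - {0<..}. ?g x \<noteq> 0}" "negligible {x \<in> {0<..} - {0..}. ?g x \<noteq> 0}"
      by (rule negligible_subset[OF negligible_sing[of 0]], force)+
  qed
  hence g: "set_integrable lborel {0<..} ?g" "(LINT u:{0<..}|lborel. ?g u) = Gamma (s + 1)"
    by (rule set_integrable_lborel_of_has_integral_nonneg; simp)+
  have f: "set_integrable lborel {0<..} ?f"
    using integrable_powr_one_minus_exp[OF s, of 1] by simp
  have "(LBINT u=ereal 0..\<infinity>. s * ?f u + ?g u) = 0 - 0"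
  proof (rule interval_integral_FTC_integrable[where F = "\<lambda>u. u powr s * (1 - exp (- u))"])
    fix u assume "ereal 0 < ereal u" "ereal u < \<infinity>"
    hence u: "u > 0" by simp
    show "((\<lambda>u. u powr s * (1 - exp (- u))) has_vector_derivative s * ?f u + ?g u) (at u)"
      unfolding has_real_derivative_iff_has_vector_derivative [symmetric]
      using u by (auto intro!: derivative_eq_intros simp: powr_diff exp_minus field_simps)
    show "isCont (\<lambda>u. s * ?f u + ?g u) u" using u by (auto intro!: continuous_intros)
  next
    show "set_integrable lborel (einterval (ereal 0) \<infinity>) (\<lambda>u. s * ?f u + ?g u)"
      using f g by (auto intro!: set_integral_add set_integrable_mult_right simp: einterval_eq)
    have "((\<lambda>u. u powr s * (1 - exp (- u))) \<longlongrightarrow> 0) (at_right 0)"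
      using s by real_asymp
    thus "(((\<lambda>u. u powr s * (1 - exp (- u))) \<circ> real_of_ereal) \<longlongrightarrow> 0) (at_right (ereal 0))"
      by (simp add: ereal_tendsto_simps)
    have "((\<lambda>u. u powr s * (1 - exp (- u))) \<longlongrightarrow> 0) at_top"
      using s by real_asymp
    thus "(((\<lambda>u. u powr s * (1 - exp (- u))) \<circ> real_of_ereal) \<longlongrightarrow> 0) (at_left \<infinity>)"
      by (simp add: ereal_tendsto_simps)
  qed simp
  hence "s * (LINT u:{0<..}|lborel. ?f u) + Gamma (s + 1) = 0"
    using f g by (simp add: interval_integral_to_infinity_eq set_integral_add)
  also have "Gamma (s + 1) = s * Gamma s"
    using s by (intro Gamma_plus1) (auto elim!: nonpos_Ints_cases)
  finally have "s * ((LINT u:{0<..}|lborel. ?f u) + Gamma s) = 0" by (simp add: algebra_simps)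
  thus ?thesis using s by simp
qed

text \<open>For c > 0 this follows by scaling u. The case c = 0 holds by
  \<open>0 powr (- s) = 0\<close> and serves the second difference at k = 0.\<close>

lemma integral_powr_one_minus_exp:
  fixes c s :: real
  assumes s: "-1 < s" "s < 0" and c: "c \<ge> 0"
  shows "(LINT u:{0<..}|lborel. u powr (s - 1) * (1 - exp (- c * u))) = - Gamma s * c powr (- s)"
proof (cases "c = 0")
  case False
  with c have c: "c > 0" by simp
  let ?f = "\<lambda>u. indicator {0<..} u *\<^sub>R (u powr (s - 1) * (1 - exp (- u)))"
  have "- Gamma s = (\<integral>u. ?f u \<partial>lborel)"
    using integral_powr_one_minus_exp_1[OF s] by (simp add: set_lebesgue_integral_def)
  also have "\<dots> = \<bar>c\<bar> *\<^sub>R (\<integral>u. ?f (0 + c * u) \<partial>lborel)"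
    using c by (intro lborel_integral_real_affine) auto
  also have "(\<lambda>u. ?f (0 + c * u)) = (\<lambda>u. c powr (s - 1) *
      (indicator {0<..} u *\<^sub>R (u powr (s - 1) * (1 - exp (- c * u)))))"
    using c by (auto simp: fun_eq_iff indicator_def powr_mult zero_less_mult_iff)
  also have "\<bar>c\<bar> *\<^sub>R (\<integral>u. c powr (s - 1) *
      (indicator {0<..} u *\<^sub>R (u powr (s - 1) * (1 - exp (- c * u)))) \<partial>lborel) =
      (c * c powr (s - 1)) * (LINT u:{0<..}|lborel. u powr (s - 1) * (1 - exp (- c * u)))"
    using c by (simp add: set_lebesgue_integral_def)
  also have "c * c powr (s - 1) = c powr s" using c by (simp add: powr_mult_base)
  finally show ?thesis using c by (simp add: powr_minus field_simps)
qed simp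

subsection \<open>Jonquiere's formula\<close>

lemma set_integrable_complex_of_real:
  "set_integrable M A (\<lambda>x. complex_of_real (f x)) \<longleftrightarrow> set_integrable M A f"
  unfolding set_integrable_def complex_of_real_integrable_eq [symmetric] by (simp add: scaleR_conv_of_real)

lemma set_sums_integral:
  fixes f :: "nat \<Rightarrow> real \<Rightarrow> complex"
  assumes int: "\<And>k. set_integrable M A (f k)"
    and sm: "\<And>x. x \<in> A \<Longrightarrow> summable (\<lambda>k. norm (f k x))"
    and si: "summable (\<lambda>k. LINT x:A|M. norm (f k x))"
  shows "set_integrable M A (\<lambda>x. \<Sum>k. f k x)"
    and "(\<lambda>k. LINT x:A|M. f k x) sums (LINT x:A|M. (\<Sum>k. f k x))"
proof -
  let ?g = "\<lambda>k x. indicator A x *\<^sub>R f k x"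
  have eq: "(\<Sum>k. ?g k x) = indicator A x *\<^sub>R (\<Sum>k. f k x)" for x
    by (cases "x \<in> A") auto
  have 1: "integrable M (?g k)" for k using int[of k] by (simp add: set_integrable_def)
  have 2: "AE x in M. summable (\<lambda>k. norm (?g k x))"
    using sm by (intro AE_I2) (auto simp: indicator_def)
  have 3: "summable (\<lambda>k. \<integral>x. norm (?g k x) \<partial>M)"
    using si by (simp add: set_lebesgue_integral_def)
  show "set_integrable M A (\<lambda>x. \<Sum>k. f k x)"
    using integrable_suminf[OF 1 2 3] by (simp add: set_integrable_def eq)
  show "(\<lambda>k. LINT x:A|M. f k x) sums (LINT x:A|M. (\<Sum>k. f k x))"
    using sums_integral[OF 1 2 3] by (simp add: set_lebesgue_integral_def eq)
qed

text \<open>This is u / (a (a - i u)), one term of the partial fractions. It is given by real and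
  imaginary part because each of them leads to a real Mellin integral.\<close>

definition kernel_pole :: "real \<Rightarrow> real \<Rightarrow> complex" where
  "kernel_pole a u = Complex (u / (u ^ 2 + a ^ 2)) (u ^ 2 / (a * (u ^ 2 + a ^ 2)))"

lemma kernel_pole_minus: "kernel_pole (- a) u = cnj (kernel_pole a u)"
  by (simp add: kernel_pole_def complex_eq_iff)

lemma norm_kernel_pole_le:
  assumes "u > 0" "a > 0"
  shows "norm (kernel_pole a u) \<le> u / (u ^ 2 + a ^ 2) + u ^ 2 / (a * (u ^ 2 + a ^ 2))"
proof -
  have "norm (kernel_pole a u) \<le> \<bar>Re (kernel_pole a u)\<bar> + \<bar>Im (kernel_pole a u)\<bar>"
    by (rule cmod_le)
  thus ?thesis using assms by (simp add: kernel_pole_def)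
qed

text \<open>Real and imaginary part are the integrals with q = s and q = s + 1. Both scale like a^(s
  - 1), so J does not depend on a. The bound on the integral of the norm serves the interchange of
  sum and integral.\<close>

lemma mellin_kernel_pole:
  fixes a s :: real
  assumes s: "-1 < s" "s < 0" and a: "a > 0"
  defines "J \<equiv> Complex (pi / (2 * cos (pi * s / 2))) (pi / (2 * cos (pi * (s + 1) / 2)))"
  shows "set_integrable lborel {0<..} (\<lambda>u. of_real (u powr (s - 1)) * kernel_pole a u)"
    and "(LINT u:{0<..}|lborel. of_real (u powr (s - 1)) * kernel_pole a u) = of_real (a powr (s - 1)) * J"
    and "(LINT u:{0<..}|lborel. norm (of_real (u powr (s - 1)) * kernel_pole a u)) \<le> a powr (s - 1) * (Re J + Im J)"
proof -
  let ?f = "\<lambda>u. u powr s / (u ^ 2 + a ^ 2)" and ?g = "\<lambda>u. u powr (s + 1) / (u ^ 2 + a ^ 2)"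
  have f: "set_integrable lborel {0<..} ?f" "(LINT u:{0<..}|lborel. ?f u) = a powr (s - 1) * Re J"
    unfolding J_def using integral_powr_over_sum_squares[of a s] a s by simp_all
  have g: "set_integrable lborel {0<..} ?g" "(LINT u:{0<..}|lborel. ?g u) = a powr s * Im J"
    unfolding J_def using integral_powr_over_sum_squares[of a "s + 1"] a s by simp_all
  have e: "u powr (s - 1) * (u / (u ^ 2 + a ^ 2)) = ?f u"
          "u powr (s - 1) * (u ^ 2 / (a * (u ^ 2 + a ^ 2))) = ?g u / a" if "u > 0" for u
  proof -
    have 1: "u * u powr (s - 1) = u powr s" using that by (simp add: powr_mult_base)
    have 2: "u * u powr s = u powr (s + 1)" using that by (simp add: powr_mult_base add.commute)
    show "u powr (s - 1) * (u / (u ^ 2 + a ^ 2)) = ?f u" by (simp add: mult.commute flip: 1)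
    show "u powr (s - 1) * (u ^ 2 / (a * (u ^ 2 + a ^ 2))) = ?g u / a"
      by (simp add: power2_eq_square mult_ac flip: 1 2)
  qed
  have eq: "of_real (u powr (s - 1)) * kernel_pole a u = of_real (?f u) + \<i> * of_real (?g u / a)"
    if "u \<in> {0<..}" for u
    using that e[of u] by (simp add: kernel_pole_def complex_eq_iff del: times_divide_eq_right)
  have int: "set_integrable lborel {0<..} (\<lambda>u. complex_of_real (?f u))"
    "set_integrable lborel {0<..} (\<lambda>u. \<i> * complex_of_real (?g u / a))"
    unfolding set_integrable_complex_of_real
    by (rule f, intro set_integrable_mult_right)
       (simp only: set_integrable_complex_of_real, intro set_integrable_divide g)
  show 1: "set_integrable lborel {0<..} (\<lambda>u. of_real (u powr (s - 1)) * kernel_pole a u)"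
    using set_integral_add(1)[OF int] eq by (subst set_integrable_cong[OF refl refl eq]) 
  have "(LINT u:{0<..}|lborel. of_real (u powr (s - 1)) * kernel_pole a u) =
     (LINT u:{0<..}|lborel. of_real (?f u) + \<i> * of_real (?g u / a))"
    using eq by (intro set_lebesgue_integral_cong) auto
  also have "\<dots> = (LINT u:{0<..}|lborel. complex_of_real (?f u)) + \<i> * (LINT u:{0<..}|lborel. complex_of_real (?g u / a))"
    by (subst set_integral_add(2)[OF int]) (simp del: of_real_divide)
  also have "\<dots> = of_real (a powr (s - 1) * Re J) + \<i> * of_real (a powr s * Im J / a)"
    by (simp only: set_integral_complex_of_real f(2) g(2) set_integral_divide_zero)
  also have "a powr s * Im J / a = a powr (s - 1) * Im J" using a by (simp add: powr_diff)
  also have "of_real (a powr (s - 1) * Re J) + \<i> * of_real (a powr (s - 1) * Im J) = of_real (a powr (s - 1)) * J"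
    by (simp add: complex_eq_iff)
  finally show "(LINT u:{0<..}|lborel. of_real (u powr (s - 1)) * kernel_pole a u) = of_real (a powr (s - 1)) * J" .
  have "(LINT u:{0<..}|lborel. norm (of_real (u powr (s - 1)) * kernel_pole a u)) \<le>
      (LINT u:{0<..}|lborel. ?f u + ?g u / a)"
  proof (rule set_integral_mono)
    show "set_integrable lborel {0<..} (\<lambda>u. norm (of_real (u powr (s - 1)) * kernel_pole a u))"
      using 1 by (rule set_integrable_norm)
    show "set_integrable lborel {0<..} (\<lambda>u. ?f u + ?g u / a)"
      by (intro set_integral_add(1) f set_integrable_divide g)
    show "norm (of_real (u powr (s - 1)) * kernel_pole a u) \<le> ?f u + ?g u / a" if "u \<in> {0<..}" for u
      using mult_left_mono[OF norm_kernel_pole_le[of u a], of "u powr (s - 1)"] that a e[of u]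
      by (simp add: norm_mult distrib_left del: times_divide_eq_right)
  qed
  also have "\<dots> = a powr (s - 1) * Re J + a powr s * Im J / a"
    by (subst set_integral_add(2)[OF f(1) set_integrable_divide[OF g(1)]])
      (simp only: f(2) g(2) set_integral_divide_zero)
  also have "\<dots> = a powr (s - 1) * (Re J + Im J)" using a by (simp add: powr_diff distrib_left)
  finally show "(LINT u:{0<..}|lborel. norm (of_real (u powr (s - 1)) * kernel_pole a u)) \<le> a powr (s - 1) * (Re J + Im J)" .
qed

lemma summable_shifted_powr:
  fixes b e :: real
  assumes "b > 0" "e < -1"
  shows "summable (\<lambda>k. (real k + b) powr e)"
proof (rule summable_comparison_test_ev)
  show "\<forall>\<^sub>F k in sequentially. norm ((real k + b) powr e) \<le> real k powr e"
    using eventually_gt_at_top[of 0]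
    by eventually_elim (use assms in \<open>auto intro!: powr_mono2'\<close>)
  show "summable (\<lambda>k. real k powr e)" using assms by (simp add: summable_real_powr_iff)
qed

text \<open>Termwise integration is justified because the integrals of the norms are bounded by a
  multiple of (k + b)^(s - 1), which is summable as s < 0; pointwise the terms are of order (k +
  b)^(-2).\<close>

lemma mellin_kernel_pole_sum:
  fixes b s :: real
  assumes s: "-1 < s" "s < 0" and b: "b > 0"
  defines "J \<equiv> Complex (pi / (2 * cos (pi * s / 2))) (pi / (2 * cos (pi * (s + 1) / 2)))"
  defines "P \<equiv> (\<lambda>u. \<Sum>k. of_real (u powr (s - 1)) * kernel_pole (2 * pi * (real k + b)) u)"
  shows "\<And>u. u > 0 \<Longrightarrow> summable (\<lambda>k. kernel_pole (2 * pi * (real k + b)) u)"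
    and "set_integrable lborel {0<..} P"
    and "(\<lambda>k. of_real ((2 * pi * (real k + b)) powr (s - 1)) * J) sums (LINT u:{0<..}|lborel. P u)"
proof -
  define a where "a k = 2 * pi * (real k + b)" for k
  have a: "a k > 0" for k using b by (simp add: a_def add_nonneg_pos)
  have sm: "summable (\<lambda>k. norm (kernel_pole (a k) u))" if u: "u > 0" for u
  proof (rule summable_comparison_test_ev)
    show "\<forall>\<^sub>F k in sequentially. norm (norm (kernel_pole (a k) u)) \<le>
        (u / (2 * pi) ^ 2 + u ^ 2 / (a 0 * (2 * pi) ^ 2)) * (real k + b) powr (-2)"
    proof (intro always_eventually allI)
      fix k
      have "norm (kernel_pole (a k) u) \<le> u / (u ^ 2 + a k ^ 2) + u ^ 2 / (a k * (u ^ 2 + a k ^ 2))"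
        by (intro norm_kernel_pole_le u a)
      also have "\<dots> \<le> u / a k ^ 2 + u ^ 2 / (a 0 * a k ^ 2)"
        using u a[of k] a[of 0] 
        by (intro add_mono divide_left_mono mult_mono mult_pos_pos add_nonneg_pos) (auto simp: a_def)
      also have "\<dots> = (u / (2 * pi) ^ 2 + u ^ 2 / (a 0 * (2 * pi) ^ 2)) * (real k + b) powr (-2)"
        using b by (simp add: a_def powr_minus power_mult_distrib divide_simps distrib_right)
      finally show "norm (norm (kernel_pole (a k) u)) \<le>
        (u / (2 * pi) ^ 2 + u ^ 2 / (a 0 * (2 * pi) ^ 2)) * (real k + b) powr (-2)" by simp
    qed
    show "summable (\<lambda>k. (u / (2 * pi) ^ 2 + u ^ 2 / (a 0 * (2 * pi) ^ 2)) * (real k + b) powr (-2))"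
      by (intro summable_mult summable_shifted_powr b) auto
  qed
  show "summable (\<lambda>k. kernel_pole (2 * pi * (real k + b)) u)" if "u > 0" for u
    using summable_norm_cancel[OF sm[OF that]] by (simp add: a_def)
  have A: "set_integrable lborel {0<..} (\<lambda>u. of_real (u powr (s - 1)) * kernel_pole (a k) u)" for k
    by (rule mellin_kernel_pole) (use s a in auto)
  have B: "summable (\<lambda>k. norm (of_real (u powr (s - 1)) * kernel_pole (a k) u))" if "u \<in> {0<..}" for u
    using summable_mult[OF sm[of u], of "u powr (s - 1)"] that by (simp add: norm_mult)
  have C: "summable (\<lambda>k. LINT u:{0<..}|lborel. norm (of_real (u powr (s - 1)) * kernel_pole (a k) u))"
  proof (rule summable_comparison_test_ev)
    show "\<forall>\<^sub>F k in sequentially. norm (LINT u:{0<..}|lborel. norm (of_real (u powr (s - 1)) * kernel_pole (a k) u))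
        \<le> ((2 * pi) powr (s - 1) * (Re J + Im J)) * (real k + b) powr (s - 1)"
    proof (intro always_eventually allI)
      fix k
      have "(LINT u:{0<..}|lborel. norm (of_real (u powr (s - 1)) * kernel_pole (a k) u)) \<ge> 0"
        by (simp add: set_lebesgue_integral_def)
      moreover have "a k powr (s - 1) = (2 * pi) powr (s - 1) * (real k + b) powr (s - 1)"
        using b by (simp add: a_def powr_mult)
      ultimately show "norm (LINT u:{0<..}|lborel. norm (of_real (u powr (s - 1)) * kernel_pole (a k) u))
        \<le> ((2 * pi) powr (s - 1) * (Re J + Im J)) * (real k + b) powr (s - 1)"
        using mellin_kernel_pole(3)[OF s a[of k]] by (simp add: J_def mult_ac)
    qed
    show "summable (\<lambda>k. ((2 * pi) powr (s - 1) * (Re J + Im J)) * (real k + b) powr (s - 1))"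
      using s by (intro summable_mult summable_shifted_powr b) auto
  qed
  show "set_integrable lborel {0<..} P"
    using set_sums_integral(1)[OF A B C] by (simp add: P_def a_def)
  show "(\<lambda>k. of_real ((2 * pi * (real k + b)) powr (s - 1)) * J) sums (LINT u:{0<..}|lborel. P u)"
    using set_sums_integral(2)[OF A B C] mellin_kernel_pole(2)[OF s a]
    by (simp add: P_def a_def J_def)
qed


lemma second_diff_powr_of_real:
  "second_diff_powr k (of_real s) =
     of_real (real (k + 2) powr (- s) - 2 * real (k + 1) powr (- s) + real k powr (- s))"
proof -
  have "complex_of_nat n powr (- of_real s) = of_real (real n powr (- s))" for n
    using powr_of_real[of "real n" "- s"] by simp
  thus ?thesis by (simp add: second_diff_powr_def del: of_nat_add of_nat_Suc)
qed

text \<open>Expanding the square gives a combination of 1 - e^(-c u) for c = k, k + 1, k + 2 with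
  weights -1, 2, -1. The weights add up to 0, so the constants 1 cancel.\<close>

lemma mellin_second_diff:
  fixes s :: real
  assumes s: "-1 < s" "s < 0"
  defines "h \<equiv> (\<lambda>k u. u powr (s - 1) * ((1 - exp (- u)) ^ 2 * exp (- u) ^ k))"
  shows "set_integrable lborel {0<..} (h k)"
    and "of_real (LINT u:{0<..}|lborel. h k u) = Gamma (of_real s) * second_diff_powr k (of_real s)"
proof -
  define g where "g c u = u powr (s - 1) * (1 - exp (- c * u))" for c u :: real
  have g: "set_integrable lborel {0<..} (g c)" "(LINT u:{0<..}|lborel. g c u) = - Gamma s * c powr (- s)"
    if "c \<ge> 0" for c
    using integrable_powr_one_minus_exp[OF s that] integral_powr_one_minus_exp[OF s that]
    by (simp_all add: g_def [abs_def])
  have e: "exp (- (real n * u)) = exp (- u) ^ n" for n u by (simp flip: exp_of_nat_mult)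
  have eq: "h k u = 2 * g (real (k + 1)) u - g (real k) u - g (real (k + 2)) u" for u
    unfolding h_def g_def mult_minus_left e
    by (simp add: power_add power2_eq_square algebra_simps)
  have i: "set_integrable lborel {0<..} (\<lambda>u. 2 * g (real (k + 1)) u)"
    by (intro set_integrable_mult_right g) auto
  note i' = set_integral_diff[OF i g(1)[of "real k"]]
  note i'' = set_integral_diff[OF i'(1) g(1)[of "real (k + 2)"]]
  have hk: "h k = (\<lambda>u. 2 * g (real (k + 1)) u - g (real k) u - g (real (k + 2)) u)"
    by (rule ext) (rule eq)
  show "set_integrable lborel {0<..} (h k)"
    unfolding hk by (rule i''(1)) auto
  have "(LINT u:{0<..}|lborel. h k u) = 2 * (LINT u:{0<..}|lborel. g (real (k + 1)) u)
      - (LINT u:{0<..}|lborel. g (real k) u) - (LINT u:{0<..}|lborel. g (real (k + 2)) u)"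
    unfolding hk by (subst i''(2), simp, simp, subst i'(2), simp_all)
  also have "\<dots> = Gamma s * (real (k + 2) powr (- s) - 2 * real (k + 1) powr (- s) + real k powr (- s))"
    by (subst (1 2 3) g(2)) (simp_all add: right_diff_distrib distrib_left del: of_nat_add of_nat_Suc)
  finally have "(LINT u:{0<..}|lborel. h k u) =
      Gamma s * (real (k + 2) powr (- s) - 2 * real (k + 1) powr (- s) + real k powr (- s))" .
  thus "of_real (LINT u:{0<..}|lborel. h k u) = Gamma (of_real s) * second_diff_powr k (of_real s)"
    by (simp add: second_diff_powr_of_real Gamma_complex_of_real del: of_nat_add of_nat_Suc)
qed

text \<open>Multiplied by (1 - z)^2, the kernel becomes z^2 (1 - x)^2 / (1 - z x) - z (1 - x) with x
  = e^(-u). The first part is a geometric series whose terms integrate to second differences; the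
  second part yields the initial term z.\<close>

lemma mellin_second_diff_sum:
  fixes s :: real and z :: complex
  assumes s: "-1 < s" "s < 0" and z: "norm z = 1" "z \<noteq> 1"
  defines "F \<equiv> (\<lambda>u::real. of_real (u powr (s - 1)) * (z * (exp (- of_real u) - 1) / ((1 - z * exp (- of_real u)) * (1 - z))))"
  shows "(LINT u:{0<..}|lborel. F u) * (1 - z) ^ 2 =
     Gamma (of_real s) * (z + (\<Sum>k. z ^ (k + 2) * second_diff_powr k (of_real s)))"
proof -
  define h where "h k u = u powr (s - 1) * ((1 - exp (- u)) ^ 2 * exp (- u) ^ k)" for k u
  have h: "set_integrable lborel {0<..} (h k)"
    "of_real (LINT u:{0<..}|lborel. h k u) = Gamma (of_real s) * second_diff_powr k (of_real s)" for k
    using mellin_second_diff[OF s, of k] by (simp_all add: h_def [abs_def])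
  define f where "f k u = z ^ (k + 2) * of_real (h k u)" for k u
  have f: "set_integrable lborel {0<..} (f k)" for k
    unfolding f_def using h by (intro set_integrable_mult_right) (simp add: set_integrable_complex_of_real)
  have nf: "norm (f k u) = h k u" for k u
  proof -
    have "h k u \<ge> 0" by (simp add: h_def)
    thus ?thesis using z by (simp add: f_def norm_mult norm_power)
  qed
  have w: "norm (z * exp (- of_real u)) < 1" if "u > 0" for u :: real
    using z that by (simp add: norm_mult)
  have sums: "(\<lambda>k. f k u) sums (of_real (u powr (s - 1) * (1 - exp (- u)) ^ 2) * (z ^ 2 / (1 - z * exp (- of_real u))))"
    if "u > 0" for u
  proof -
    have "(\<lambda>k. of_real (u powr (s - 1) * (1 - exp (- u)) ^ 2) * (z ^ 2 * (z * exp (- of_real u)) ^ k)) sums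
      (of_real (u powr (s - 1) * (1 - exp (- u)) ^ 2) * (z ^ 2 * (1 / (1 - z * exp (- of_real u)))))"
      by (intro sums_mult geometric_sums w that)
    thus ?thesis
      by (simp add: f_def h_def power2_eq_square[of z] power_mult_distrib mult_ac flip: exp_of_real)
  qed
  have A: "summable (\<lambda>k. norm (f k u))" if "u \<in> {0<..}" for u
  proof -
    have "summable (\<lambda>k. u powr (s - 1) * (1 - exp (- u)) ^ 2 * exp (- u) ^ k)"
      using that by (intro summable_mult summable_geometric) auto
    thus ?thesis by (simp add: nf h_def mult_ac)
  qed
  \<comment> \<open>As \<open>norm (f k u) = h k u\<close>, the integral of the norm is the absolute
    value of the known integral of \<open>h k\<close>, and summability reduces to that of the second
    differences.\<close>
  have B: "summable (\<lambda>k. LINT u:{0<..}|lborel. norm (f k u))"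
  proof -
    have "(LINT u:{0<..}|lborel. h k u) \<ge> 0" for k
      unfolding set_lebesgue_integral_def by (intro integral_nonneg_AE) (auto simp: h_def)
    hence "(LINT u:{0<..}|lborel. h k u) = norm (Gamma (of_real s) * second_diff_powr k (of_real s))" for k
      unfolding h(2)[symmetric] by simp
    thus ?thesis
      unfolding nf norm_mult using s
      by (simp only: summable_mult summable_norm_second_diff_powr Re_complex_of_real)
  qed
  define g where "g u = u powr (s - 1) * (1 - exp (- u))" for u
  have g: "set_integrable lborel {0<..} g" "(LINT u:{0<..}|lborel. g u) = - Gamma s"
    using integrable_powr_one_minus_exp[OF s, of 1] integral_powr_one_minus_exp[OF s, of 1]
    by (simp_all add: g_def [abs_def])
  have g': "set_integrable lborel {0<..} (\<lambda>u. z * of_real (g u))"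
    using g by (intro set_integrable_mult_right) (simp add: set_integrable_complex_of_real)
  have eq: "F u * (1 - z) ^ 2 = (\<Sum>k. f k u) - z * of_real (g u)" if "u \<in> {0<..}" for u
  proof -
    define x where "x = complex_of_real (exp (- u))"
    define c where "c = complex_of_real (u powr (s - 1))"
    have x: "exp (- complex_of_real u) = x" by (simp add: x_def flip: exp_of_real)
    have nz: "1 - z * x \<noteq> 0" using w[of u] that by (auto simp: x)
    have "(\<Sum>k. f k u) = of_real (u powr (s - 1) * (1 - exp (- u)) ^ 2) * (z ^ 2 / (1 - z * x))"
      using sums[of u] that by (simp add: sums_iff x)
    hence fk: "(\<Sum>k. f k u) = c * ((1 - x) ^ 2 * (z ^ 2 / (1 - z * x)))"
      by (simp add: c_def x_def)
    have gu: "of_real (g u) = c * (1 - x)" by (simp add: g_def c_def x_def)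
    have "F u * (1 - z) ^ 2 = c * (z * (x - 1) / ((1 - z * x) * (1 - z)) * (1 - z) ^ 2)"
      by (simp only: F_def x c_def mult.assoc)
    also have "z * (x - 1) / ((1 - z * x) * (1 - z)) * (1 - z) ^ 2 =
       (1 - x) ^ 2 * (z ^ 2 / (1 - z * x)) - z * (1 - x)"
      using nz z by (simp add: divide_simps) (simp add: algebra_simps power2_eq_square power4_eq_xxxx)
    also have "c * ((1 - x) ^ 2 * (z ^ 2 / (1 - z * x)) - z * (1 - x)) =
        (\<Sum>k. f k u) - z * of_real (g u)"
      unfolding fk gu by (simp only: right_diff_distrib mult_ac)
    finally show ?thesis .
  qed
  have e1: "(LINT u:{0<..}|lborel. F u) * (1 - z) ^ 2 = (LINT u:{0<..}|lborel. F u * (1 - z) ^ 2)"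
    by simp
  have e2: "(LINT u:{0<..}|lborel. F u * (1 - z) ^ 2) = (LINT u:{0<..}|lborel. (\<Sum>k. f k u) - z * of_real (g u))"
    using eq by (intro set_lebesgue_integral_cong) auto
  have e3: "(LINT u:{0<..}|lborel. (\<Sum>k. f k u) - z * of_real (g u)) = (LINT u:{0<..}|lborel. (\<Sum>k. f k u)) - z * of_real (LINT u:{0<..}|lborel. g u)"
  proof -
    have "(LINT u:{0<..}|lborel. z * complex_of_real (g u)) = z * (LINT u:{0<..}|lborel. complex_of_real (g u))"
      by (rule set_integral_mult_right)
    also have "(LINT u:{0<..}|lborel. complex_of_real (g u)) = of_real (LINT u:{0<..}|lborel. g u)"
      by (rule set_integral_complex_of_real)
    finally have e: "(LINT u:{0<..}|lborel. z * complex_of_real (g u)) = z * of_real (LINT u:{0<..}|lborel. g u)" .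
    show ?thesis
      using set_integral_diff(2)[OF set_sums_integral(1)[OF f A B] g'] unfolding e .
  qed
  have e4: "(LINT u:{0<..}|lborel. (\<Sum>k. f k u)) =
      Gamma (of_real s) * (\<Sum>k. z ^ (k + 2) * second_diff_powr k (of_real s))"
  proof -
    have "summable (\<lambda>k. norm (second_diff_powr k (of_real s)))"
      using s by (intro summable_norm_second_diff_powr) simp
    moreover have "norm (z ^ (k + 2) * second_diff_powr k (of_real s)) = norm (second_diff_powr k (of_real s))" for k
      using z by (simp add: norm_mult norm_power)
    ultimately have "summable (\<lambda>k. z ^ (k + 2) * second_diff_powr k (of_real s))"
      by (simp add: summable_norm_cancel)
    hence "(\<lambda>k. Gamma (of_real s) * (z ^ (k + 2) * second_diff_powr k (of_real s))) sums
        (Gamma (of_real s) * (\<Sum>k. z ^ (k + 2) * second_diff_powr k (of_real s)))"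
      by (intro sums_mult summable_sums)
    moreover have "(LINT u:{0<..}|lborel. f k u) =
        Gamma (of_real s) * (z ^ (k + 2) * second_diff_powr k (of_real s))" for k
    proof -
      have "(LINT u:{0<..}|lborel. f k u) = z ^ (k + 2) * (LINT u:{0<..}|lborel. complex_of_real (h k u))"
        unfolding f_def by (rule set_integral_mult_right)
      also have "(LINT u:{0<..}|lborel. complex_of_real (h k u)) = of_real (LINT u:{0<..}|lborel. h k u)"
        by (rule set_integral_complex_of_real)
      finally show ?thesis by (simp only: h(2) mult.left_commute)
    qed
    ultimately have "(\<lambda>k. LINT u:{0<..}|lborel. f k u) sums
        (Gamma (of_real s) * (\<Sum>k. z ^ (k + 2) * second_diff_powr k (of_real s)))"
      by (simp only:)
    with set_sums_integral(2)[OF f A B] show ?thesis by (rule sums_unique2)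
  qed
  have e5: "Gamma (of_real s) * (\<Sum>k. z ^ (k + 2) * second_diff_powr k (of_real s)) -
      z * of_real (LINT u:{0<..}|lborel. g u) =
      Gamma (of_real s) * (z + (\<Sum>k. z ^ (k + 2) * second_diff_powr k (of_real s)))"
  proof -
    have "complex_of_real (LINT u:{0<..}|lborel. g u) = - Gamma (of_real s)"
      by (simp only: g(2) of_real_minus Gamma_complex_of_real)
    moreover have "G * S - z * (- G) = G * (z + S)" for G S :: complex
      by (simp add: algebra_simps)
    ultimately show ?thesis by (simp only:)
  qed
  show ?thesis by (simp only: e1 e2 e3 e4 e5)
qed

lemma hurwitz_sums_of_real:
  assumes "v > 0" "s < 0"
  shows "(\<lambda>k. complex_of_real ((real k + v) powr (s - 1))) sums (hurwitz_num v (1 - of_real s) / - of_real s)"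
proof -
  have "complex_of_real ((real k + v) powr (s - 1)) = of_real (real k + v) powr - (1 - of_real s)" for k
    using powr_of_real[of "real k + v" "s - 1"] assms by simp
  thus ?thesis using hurwitz_sums[of v "1 - of_real s"] assms by simp
qed

text \<open>Both sides are the Mellin transform of the kernel, expanded in powers of \<open>e\<^sup>-\<^sup>u\<close> on the left
  and in partial fractions on the right.\<close>
lemma jonquiere_formula_real:
  fixes s :: real and v :: real
  assumes s: "-1 < s" "s < 0" and v: "0 < v" "v < 1"
  defines "z \<equiv> cis (2 * pi * v)"
  defines "J \<equiv> Complex (pi / (2 * cos (pi * s / 2))) (pi / (2 * cos (pi * (s + 1) / 2)))"
  shows "Gamma (of_real s) * (z + (\<Sum>k. z ^ (k + 2) * second_diff_powr k (of_real s))) =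
    (1 - z) ^ 2 * of_real ((2 * pi) powr (s - 1)) *
      (J * (hurwitz_num (1 - v) (1 - of_real s) / - of_real s) + cnj J * (hurwitz_num v (1 - of_real s) / - of_real s))"
proof -
  define P where "P b u = (\<Sum>k. complex_of_real (u powr (s - 1)) * kernel_pole (2 * pi * (real k + b)) u)" for b u
  have nz: "norm z = 1" by (simp add: z_def)
  have z1: "z \<noteq> 1"
  proof
    assume "z = 1"
    hence "cos (2 * pi * v) = 1" by (simp add: z_def complex_eq_iff)
    then obtain n :: int where "2 * pi * v = of_int n * (2 * pi)" by (auto simp: cos_one_2pi_int)
    hence "v = of_int n" by simp
    thus False using v by auto
  qed
  have P: "(LINT u:{0<..}|lborel. P b u) = of_real ((2 * pi) powr (s - 1)) * J * (hurwitz_num b (1 - of_real s) / - of_real s)"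
    "set_integrable lborel {0<..} (P b)" if b: "b > 0" for b
  proof -
    have "(\<lambda>k. of_real ((2 * pi) powr (s - 1)) * J * of_real ((real k + b) powr (s - 1))) sums
        (of_real ((2 * pi) powr (s - 1)) * J * (hurwitz_num b (1 - of_real s) / - of_real s))"
      by (intro sums_mult hurwitz_sums_of_real b s)
    also have "(\<lambda>k. of_real ((2 * pi) powr (s - 1)) * J * of_real ((real k + b) powr (s - 1))) =
        (\<lambda>k. of_real ((2 * pi * (real k + b)) powr (s - 1)) * J)"
      using b by (simp add: powr_mult fun_eq_iff)
    finally have "(\<lambda>k. of_real ((2 * pi * (real k + b)) powr (s - 1)) * J) sums
        (of_real ((2 * pi) powr (s - 1)) * J * (hurwitz_num b (1 - of_real s) / - of_real s))" .
    moreover have "(\<lambda>k. of_real ((2 * pi * (real k + b)) powr (s - 1)) * J) sums (LINT u:{0<..}|lborel. P b u)"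
      using mellin_kernel_pole_sum(3)[OF s b] unfolding P_def J_def .
    ultimately show "(LINT u:{0<..}|lborel. P b u) = of_real ((2 * pi) powr (s - 1)) * J * (hurwitz_num b (1 - of_real s) / - of_real s)"
      by (rule sums_unique2 [symmetric])
    show "set_integrable lborel {0<..} (P b)"
      using mellin_kernel_pole_sum(2)[OF s b] by (simp add: P_def [abs_def])
  qed
  \<comment> \<open>The poles with negative a contribute the complex conjugate of
    \<open>P v\<close>. That only J gets conjugated in the result requires the Hurwitz values to be
    real.\<close>
  have hs: "cnj (hurwitz_num b (1 - of_real s) / - of_real s) = hurwitz_num b (1 - of_real s) / - of_real s"
    if "b > 0" for b
  proof -
    have "(\<lambda>k. complex_of_real ((real k + b) powr (s - 1))) sums cnj (hurwitz_num b (1 - of_real s) / - of_real s)"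
      using sums_cnj[THEN iffD2, OF hurwitz_sums_of_real[OF that s(2)]] by simp
    thus ?thesis using hurwitz_sums_of_real[OF that s(2)] sums_unique2 by blast
  qed
  \<comment> \<open>The partial fractions pair both families of poles in one series; it is separated
    here into two convergent ones.\<close>
  have K: "of_real (u powr (s - 1)) * (z * (exp (- of_real u) - 1) / ((1 - z * exp (- of_real u)) * (1 - z)))
      = P (1 - v) u + cnj (P v u)" if u: "u \<in> {0<..}" for u
  proof -
    have S: "summable (\<lambda>k. kernel_pole (2 * pi * (real k + b)) u)" if "b > 0" for b
      using mellin_kernel_pole_sum(1)[OF s that] u by simp
    have Q: "(\<lambda>k. of_real (u powr (s - 1)) * kernel_pole (2 * pi * (real k + b)) u) sums P b u" if "b > 0" for b
      unfolding P_def by (intro summable_sums summable_mult S that)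
    have "(\<lambda>k. of_real (u powr (s - 1)) * kernel_pole (2 * pi * (real k + (1 - v))) u +
        cnj (of_real (u powr (s - 1)) * kernel_pole (2 * pi * (real k + v)) u)) sums (P (1 - v) u + cnj (P v u))"
      using v by (intro sums_add Q sums_cnj[THEN iffD2]) auto
    moreover have "(\<lambda>k. of_real (u powr (s - 1)) * (kernel_pole (2 * pi * (real k + 1 - v)) u +
        kernel_pole (- 2 * pi * (real k + v)) u)) sums
        (of_real (u powr (s - 1)) * (z * (exp (- of_real u) - 1) / ((1 - z * exp (- of_real u)) * (1 - z))))"
      using exp_kernel_partial_fractions[OF v, of u] unfolding kernel_pole_def z_def
      by (intro sums_mult)
    moreover have "(\<lambda>k. of_real (u powr (s - 1)) * (kernel_pole (2 * pi * (real k + 1 - v)) u +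
        kernel_pole (- 2 * pi * (real k + v)) u)) =
      (\<lambda>k. of_real (u powr (s - 1)) * kernel_pole (2 * pi * (real k + (1 - v))) u +
        cnj (of_real (u powr (s - 1)) * kernel_pole (2 * pi * (real k + v)) u))"
    proof
      fix k
      have "kernel_pole (- 2 * pi * (real k + v)) u = cnj (kernel_pole (2 * pi * (real k + v)) u)"
        using kernel_pole_minus[of "2 * pi * (real k + v)" u] by simp
      thus "of_real (u powr (s - 1)) * (kernel_pole (2 * pi * (real k + 1 - v)) u +
        kernel_pole (- 2 * pi * (real k + v)) u) =
        of_real (u powr (s - 1)) * kernel_pole (2 * pi * (real k + (1 - v))) u +
        cnj (of_real (u powr (s - 1)) * kernel_pole (2 * pi * (real k + v)) u)"
        by (simp only: distrib_left complex_cnj_mult complex_cnj_complex_of_real add_diff_eq)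
    qed
    ultimately show ?thesis
      by (metis (no_types, lifting) sums_unique2)
  qed
  have "Gamma (of_real s) * (z + (\<Sum>k. z ^ (k + 2) * second_diff_powr k (of_real s))) =
      (1 - z) ^ 2 * (LINT u:{0<..}|lborel. of_real (u powr (s - 1)) *
        (z * (exp (- of_real u) - 1) / ((1 - z * exp (- of_real u)) * (1 - z))))"
    using mellin_second_diff_sum[OF s nz z1] by (simp add: mult.commute)
  also have "(LINT u:{0<..}|lborel. of_real (u powr (s - 1)) *
        (z * (exp (- of_real u) - 1) / ((1 - z * exp (- of_real u)) * (1 - z)))) =
      (LINT u:{0<..}|lborel. P (1 - v) u + cnj (P v u))"
    using K by (intro set_lebesgue_integral_cong) auto
  also have "\<dots> = (LINT u:{0<..}|lborel. P (1 - v) u) + (LINT u:{0<..}|lborel. cnj (P v u))"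
  proof (rule set_integral_add(2))
    show "set_integrable lborel {0<..} (P (1 - v))" using v by (intro P) auto
    show "set_integrable lborel {0<..} (\<lambda>u. cnj (P v u))"
      using P(2)[of v] v integrable_cnj unfolding set_integrable_def by (simp flip: complex_cnj_scaleR)
  qed
  also have "(LINT u:{0<..}|lborel. cnj (P v u)) = cnj (LINT u:{0<..}|lborel. P v u)"
    unfolding set_lebesgue_integral_def by (simp flip: complex_cnj_scaleR)
  also have "\<dots> = of_real ((2 * pi) powr (s - 1)) * cnj J * (hurwitz_num v (1 - of_real s) / - of_real s)"
    by (simp only: complex_cnj_mult P(1)[OF v(1)] hs[OF v(1)] complex_cnj_complex_of_real)
  finally show ?thesis using v by (simp add: P(1) algebra_simps)
qed

subsection \<open>The functional equation at rational arguments\<close>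

text \<open>The functional equation is stated for \<open>hurwitz_num\<close> instead of \<open>\<zeta>\<close>, at \<open>s = -e\<close>;
  hence the additional factor \<open>1 + e = 1 - s\<close>.\<close>
definition fe_factor :: "complex \<Rightarrow> complex" where
  "fe_factor e = (1 + e) * Gamma (1 + e) * of_real (2 * pi) powr (- 1 - e)"

text \<open>Jonquiere's formula at s = -e is multiplied by Gamma(1 + e). On the left, reflection
  turns Gamma(-e) Gamma(1 + e) into -pi / sin(pi e), and the same denominator is contained in J, so
  that only sine and cosine of pi e / 2 survive. The factor (1 - z)^2 cancels because z is not
  1.\<close>

lemma twisted_functional_equation_real:
  fixes e :: real and m j :: nat
  assumes e: "0 < e" "e < 1" and j: "0 < j" "j < m"
  defines "z \<equiv> cis (2 * pi * (real j / real m))"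
  shows "of_real e * of_nat m powr of_real e * (\<Sum>r=1..m. z ^ r * hurwitz_num (real r / real m) (- of_real e)) =
    fe_factor (of_real e) *
      ((sin (of_real (pi * e / 2)) + \<i> * cos (of_real (pi * e / 2))) * hurwitz_num (1 - real j / real m) (1 + of_real e)
     + (sin (of_real (pi * e / 2)) - \<i> * cos (of_real (pi * e / 2))) * hurwitz_num (real j / real m) (1 + of_real e))"
proof -
  define v where "v = real j / real m"
  have v: "0 < v" "v < 1" using j by (auto simp: v_def)
  have m: "m > 0" using j by auto
  have zm: "z ^ m = 1"
  proof -
    have "z ^ m = cis (2 * pi * real j)" using m by (simp add: z_def Complex.DeMoivre)
    also have "\<dots> = 1" by (rule cis_multiple_2pi) auto
    finally show ?thesis .
  qed
  have z1: "z \<noteq> 1"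
  proof
    assume "z = 1"
    hence "cos (2 * pi * v) = 1" by (simp add: z_def v_def complex_eq_iff)
    then obtain n :: int where "2 * pi * v = of_int n * (2 * pi)" by (auto simp: cos_one_2pi_int)
    hence "v = of_int n" by simp
    thus False using v by auto
  qed
  define c sn where "c = cos (pi * e / 2)" and "sn = sin (pi * e / 2)"
  have "0 < pi * e / 2" "pi * e / 2 < pi / 2" using e by auto
  hence c0: "c > 0" and s0: "sn > 0"
    unfolding c_def sn_def by (intro cos_gt_zero sin_gt_zero; linarith)+
  define J where "J = Complex (pi / (2 * c)) (pi / (2 * sn))"
  \<comment> \<open>At s = -e the second cosine in J has the argument pi / 2 - pi e / 2 and is
    therefore a sine.\<close>
  have Jeq: "Complex (pi / (2 * cos (pi * - e / 2))) (pi / (2 * cos (pi * (- e + 1) / 2))) = J"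
    by (simp add: J_def c_def sn_def sin_cos_eq diff_divide_distrib algebra_simps)
  define S where "S = z + (\<Sum>k. z ^ (k + 2) * second_diff_powr k (of_real (- e)))"
  define T where "T = (\<Sum>r=1..m. z ^ r * hurwitz_num (real r / real m) (of_real (- e)))"
  define A where "A = hurwitz_num (1 - v) (1 + of_real e)"
  define B where "B = hurwitz_num v (1 + of_real e)"
  have 1: "(1 - z) ^ 2 * (of_nat m powr of_real e * T) = - (1 + of_real e) * S"
    using twisted_sum_eq_second_diff_series[OF m zm z1, of "of_real (- e)"] e
    by (simp add: T_def S_def)
  have 2: "Gamma (of_real (- e)) * S = (1 - z) ^ 2 * of_real ((2 * pi) powr (- e - 1)) *
      (J * (A / of_real e) + cnj J * (B / of_real e))"
    using jonquiere_formula_real[of "- e" v] e v unfolding Jeq z_def [folded v_def, symmetric]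
    by (simp add: S_def A_def B_def)
  have G: "Gamma (complex_of_real (- e)) * Gamma (1 + of_real e) = - of_real (pi / (2 * sn * c))"
  proof -
    have "Gamma (complex_of_real (- e)) * Gamma (1 + of_real e) = of_real pi / sin (of_real pi * of_real (- e))"
      using Gamma_reflection_complex[of "of_real (- e)"] by simp
    also have "sin (of_real pi * of_real (- e)) = complex_of_real (- (2 * sn * c))"
      using sin_double[of "pi * e / 2"] by (simp add: sn_def c_def sin_of_real flip: of_real_mult)
    finally show ?thesis by simp
  qed
  have "(1 - z) ^ 2 * (Gamma (of_real (- e)) * (of_nat m powr of_real e * T)) =
      - (1 + of_real e) * (Gamma (of_real (- e)) * S)"
    by (subst mult.left_commute, subst 1) (simp only: mult.left_commute)
  also have "\<dots> = (1 - z) ^ 2 * (- (1 + of_real e) * of_real ((2 * pi) powr (- e - 1)) *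
      (J * (A / of_real e) + cnj J * (B / of_real e)))"
    by (subst 2) (simp only: mult_ac)
  finally have g: "Gamma (of_real (- e)) * (of_nat m powr of_real e * T) =
      - (1 + of_real e) * of_real ((2 * pi) powr (- e - 1)) * (J * (A / of_real e) + cnj J * (B / of_real e))"
    using z1 by simp
  have "(Gamma (of_real (- e)) * Gamma (1 + of_real e)) * (of_nat m powr of_real e * T) =
      Gamma (1 + of_real e) * (Gamma (of_real (- e)) * (of_nat m powr of_real e * T))"
    by (simp only: mult_ac)
  also have "\<dots> = - ((1 + of_real e) * Gamma (1 + of_real e) * of_real ((2 * pi) powr (- e - 1))) *
      (J * (A / of_real e) + cnj J * (B / of_real e))"
    unfolding g by (simp only: mult_ac mult_minus_left mult_minus_right)
  also have "(1 + of_real e) * Gamma (1 + of_real e) * of_real ((2 * pi) powr (- e - 1)) = fe_factor (of_real e)"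
  proof -
    have "- 1 - complex_of_real e = of_real (- e - 1)" by simp
    thus ?thesis using powr_of_real[of "2 * pi" "- e - 1"] by (simp only: fe_factor_def) simp
  qed
  finally have eq: "of_real (pi / (2 * sn * c)) * (of_nat m powr of_real e * T) =
      fe_factor (of_real e) * (J * (A / of_real e) + cnj J * (B / of_real e))"
    unfolding G by simp
  have J: "J = of_real (pi / (2 * sn * c)) * (of_real sn + \<i> * of_real c)"
    "cnj J = of_real (pi / (2 * sn * c)) * (of_real sn - \<i> * of_real c)"
    using c0 s0 by (auto simp: J_def complex_eq_iff)
  have "F * (K * X * a + K * Y * b) = K * (F * (X * a + Y * b))" for F K X Y a b :: complex
    by (simp add: algebra_simps)
  with eq J have "of_real (pi / (2 * sn * c)) * (of_nat m powr of_real e * T) =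
     of_real (pi / (2 * sn * c)) * (fe_factor (of_real e) *
       ((of_real sn + \<i> * of_real c) * (A / of_real e) + (of_real sn - \<i> * of_real c) * (B / of_real e)))"
    by (simp only:)
  moreover have "complex_of_real (pi / (2 * sn * c)) \<noteq> 0" using c0 s0 by simp
  ultimately have eq': "of_nat m powr of_real e * T = fe_factor (of_real e) *
       ((of_real sn + \<i> * of_real c) * (A / of_real e) + (of_real sn - \<i> * of_real c) * (B / of_real e))"
    by (simp only: mult_cancel_left) simp
  have "k * (F * (p * (a / k) + q * (b / k))) = F * (p * a + q * b)" if "k \<noteq> 0" for k F p q a b :: complex
    using that by (simp add: field_simps)
  moreover have "complex_of_real e \<noteq> 0" using e by simp
  ultimately have "of_real e * of_nat m powr of_real e * T = fe_factor (of_real e) *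
       ((of_real sn + \<i> * of_real c) * A + (of_real sn - \<i> * of_real c) * B)"
    using eq' by (simp only: mult.assoc)
  thus ?thesis
    by (simp only: T_def A_def B_def v_def c_def sn_def sin_of_real cos_of_real of_real_minus)
qed

text \<open>The twist z = 1 is out of reach of the preceding lemma. It is derived from z = -1: the
  distribution relation for m = 2 expresses the values at 1/2 by those at 1 on both sides of the
  equation, and the common factor 2 * 2^e - 1 is not 0.\<close>

lemma zeta_functional_equation_real:
  fixes e :: real
  assumes e: "0 < e" "e < 1"
  shows "of_real e * hurwitz_num 1 (- of_real e) =
    fe_factor (of_real e) * (2 * sin (of_real (pi * e / 2)) * hurwitz_num 1 (1 + of_real e))"
proof -
  define s where "s = sin (complex_of_real (pi * e / 2))"
  define c where "c = cos (complex_of_real (pi * e / 2))"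
  define E where "E = complex_of_real (2 powr e)"
  have E: "2 powr complex_of_real e = E" "2 powr (1 + complex_of_real e) = 2 * E" "2 powr (- complex_of_real e) = 1 / E"
    using powr_of_real[of 2 e] powr_of_real[of 2 "- e"]
    by (simp_all add: E_def powr_add powr_minus field_simps)
  have "2 powr e > 1 powr e" using e by (intro powr_less_mono2) auto
  hence E1: "2 powr e > 1" by simp
  have E0: "E \<noteq> 0" "2 * E - 1 \<noteq> 0"
  proof -
    show "E \<noteq> 0" by (simp add: E_def)
    have "2 * E - 1 = of_real (2 * 2 powr e - 1)" by (simp add: E_def)
    also have "\<dots> \<noteq> 0" using E1 by (subst of_real_eq_0_iff) linarith
    finally show "2 * E - 1 \<noteq> 0" .
  qed
  have set2: "{Suc 0..2} = {1, 2}" by auto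
  have 1: "hurwitz_num (1/2) (- of_real e) + hurwitz_num 1 (- of_real e) = hurwitz_num 1 (- of_real e) / E"
    using hurwitz_num_distribution[of 2 "- of_real e"] e by (simp add: set2 E)
  have 2: "hurwitz_num (1/2) (1 + of_real e) = (2 * E - 1) * hurwitz_num 1 (1 + of_real e)"
    using hurwitz_num_distribution[of 2 "1 + of_real e"] e by (simp add: set2 E algebra_simps)
  have "cis pi = - 1" by (simp add: complex_eq_iff)
  hence "of_real e * E * (hurwitz_num 1 (- of_real e) - hurwitz_num (1/2) (- of_real e)) =
      fe_factor (of_real e) * ((s + \<i> * c) * hurwitz_num (1/2) (1 + of_real e) + (s - \<i> * c) * hurwitz_num (1/2) (1 + of_real e))"
    using twisted_functional_equation_real[OF e, of 1 2] unfolding s_def c_def by (simp add: set2 E)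
  also have "hurwitz_num 1 (- of_real e) - hurwitz_num (1/2) (- of_real e) = (2 * E - 1) / E * hurwitz_num 1 (- of_real e)"
    using 1 E0 by (simp add: field_simps)
  also have "(s + \<i> * c) * hurwitz_num (1/2) (1 + of_real e) + (s - \<i> * c) * hurwitz_num (1/2) (1 + of_real e) =
      (2 * E - 1) * (2 * s * hurwitz_num 1 (1 + of_real e))"
    unfolding 2 by (simp add: algebra_simps)
  also have "of_real e * E * ((2 * E - 1) / E * hurwitz_num 1 (- of_real e)) =
      (2 * E - 1) * (of_real e * hurwitz_num 1 (- of_real e))"
    using E0 by simp
  finally have "(2 * E - 1) * (of_real e * hurwitz_num 1 (- of_real e)) =
      (2 * E - 1) * (fe_factor (of_real e) * (2 * s * hurwitz_num 1 (1 + of_real e)))"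
    by (simp only: mult.left_commute)
  thus ?thesis using E0 by (simp add: s_def)
qed

section \<open>Fourier inversion over the m-th roots of unity\<close>

lemma sum_cis_orthogonality:
  fixes m r l :: nat
  assumes m: "m > 0" and r: "r \<in> {1..m}" and l: "l \<in> {1..m}"
  shows "(\<Sum>j=1..m. cis (2 * pi * (real j / real m)) ^ r * cis (- 2 * pi * (real j / real m)) ^ l) =
     (if r = l then of_nat m else 0)"
proof -
  define w where "w = cis (2 * pi * (real r - real l) / real m)"
  have eq: "cis (2 * pi * (real j / real m)) ^ r * cis (- 2 * pi * (real j / real m)) ^ l = w ^ j" for j
    by (simp add: w_def Complex.DeMoivre cis_mult) (simp add: algebra_simps diff_divide_distrib)
  show ?thesis
  proof (cases "r = l")
    case True
    hence "w = 1" by (simp add: w_def)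
    thus ?thesis using True unfolding eq by simp
  next
    case False
    have "w \<noteq> 1"
    proof
      assume "w = 1"
      hence "cos (2 * pi * (real r - real l) / real m) = 1" by (simp add: w_def complex_eq_iff)
      then obtain n :: int where "2 * pi * (real r - real l) / real m = of_int n * (2 * pi)"
        by (auto simp: cos_one_2pi_int)
      hence "2 * pi * ((real r - real l) / real m) = 2 * pi * of_int n"
        by (simp only: times_divide_eq_right mult.commute)
      hence "(real r - real l) / real m = of_int n"
        by (subst (asm) mult_left_cancel) simp_all
      hence "real r - real l = of_int n * real m" using m by (simp add: field_simps)
      hence *: "int r - int l = n * int m"
        by (metis (mono_tags, lifting) of_int_diff of_int_eq_iff of_int_mult of_int_of_nat_eq)
      \<comment> \<open>Two indices in 1, ..., m differ by less than m, so congruence forces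
        equality.\<close>
      have "\<bar>int r - int l\<bar> < int m" using r l by auto
      hence "\<bar>n\<bar> * int m < 1 * int m" unfolding * by (simp add: abs_mult)
      hence "\<bar>n\<bar> < 1" by (simp only: mult_less_cancel_right)
      hence "n = 0" by linarith
      thus False using * False by simp
    qed
    moreover have "w ^ m = 1"
    proof -
      have "w ^ m = cis (real m * (2 * pi * (real r - real l) / real m))"
        by (simp only: w_def Complex.DeMoivre)
      also have "real m * (2 * pi * (real r - real l) / real m) = 2 * pi * of_int (int r - int l)"
        using m by simp
      also have "cis (2 * pi * of_int (int r - int l)) = 1" by (rule cis_multiple_2pi) auto
      finally show ?thesis .
    qed
    moreover have "(\<Sum>j=1..m. w ^ j) = w * (\<Sum>j<m. w ^ j)"
      by (simp add: sum.atLeast1_atMost_eq sum_distrib_left)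
    ultimately show ?thesis using False unfolding eq by (simp add: geometric_sum)
  qed
qed

text \<open>The twisted equations for j = 1, ..., m form a finite Fourier transform in the residue
  r. Multiplication by the conjugate characters and summation over j isolates the residue l.\<close>

lemma hurwitz_functional_equation_real:
  fixes e :: real and m l :: nat
  assumes e: "0 < e" "e < 1" and l: "l \<in> {1..m}"
  shows "of_real e * of_nat m powr (1 + of_real e) * hurwitz_num (real l / real m) (- of_real e) =
    fe_factor (of_real e) * (\<Sum>r=1..m. 2 * sin (of_real (pi * e / 2) - of_real (2 * pi * real r * real l / real m))
      * hurwitz_num (real r / real m) (1 + of_real e))"
proof -
  have m: "m > 0" using l by auto
  define s where "s = sin (complex_of_real (pi * e / 2))"
  define c where "c = cos (complex_of_real (pi * e / 2))"
  define z where "z j = cis (2 * pi * (real j / real m))" for j :: nat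
  define zi where "zi j = cis (- 2 * pi * (real j / real m))" for j :: nat
  define U where "U r = hurwitz_num (real r / real m) (- of_real e)" for r
  define V where "V r = hurwitz_num (real r / real m) (1 + of_real e)" for r
  \<comment> \<open>The value at 1 - j / m. At j = m the argument 0 is replaced by 1, in accordance
    with residues running from 1 to m.\<close>
  define V' where "V' j = (if j = m then V m else V (m - j))" for j
  have key: "of_real e * of_nat m powr of_real e * (\<Sum>r=1..m. z j ^ r * U r) =
      fe_factor (of_real e) * ((s + \<i> * c) * V' j + (s - \<i> * c) * V j)" if "j \<in> {1..m}" for j
  proof (cases "j = m")
    case True
    have "of_real e * of_nat m powr of_real e * (\<Sum>r=1..m. z j ^ r * U r) =
        of_real e * (of_nat m powr of_real e * of_nat m powr (- of_real e)) * hurwitz_num 1 (- of_real e)"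
      using True m e hurwitz_num_distribution[of m "- of_real e"] by (simp add: z_def U_def)
    also have "of_nat m powr of_real e * of_nat m powr (- complex_of_real e) = 1"
      using m by (simp flip: powr_add)
    also have "of_real e * 1 * hurwitz_num 1 (- of_real e) =
        fe_factor (of_real e) * (2 * s * hurwitz_num 1 (1 + of_real e))"
      using zeta_functional_equation_real[OF e] by (simp add: s_def)
    finally show ?thesis using True m by (simp add: V'_def V_def algebra_simps)
  next
    case False
    hence j: "0 < j" "j < m" using that by auto
    have "1 - real j / real m = real (m - j) / real m" using j by (simp add: field_simps)
    thus ?thesis
      using twisted_functional_equation_real[OF e j] j unfolding s_def c_def z_def U_def V'_def V_def
      by simp
  qed
  \<comment> \<open>Replacing j by m - j conjugates the character, and \<open>V'\<close> turns back
    into \<open>V\<close>.\<close>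
  have reindex: "(\<Sum>j=1..m. zi j ^ l * V' j) = (\<Sum>r=1..m. z r ^ l * V r)"
  proof (rule sum.reindex_bij_witness[of _ "\<lambda>r. if r = m then m else m - r" "\<lambda>j. if j = m then m else m - j"])
    fix j assume j: "j \<in> {1..m}"
    have "z (m - j) = zi j"
    proof -
      have "2 * pi * (real (m - j) / real m) = 2 * pi + (- 2 * pi * (real j / real m))"
        using j m by (simp add: field_simps of_nat_diff)
      hence "z (m - j) = cis (2 * pi) * zi j" unfolding z_def zi_def by (simp only: cis_mult)
      thus ?thesis by (simp add: cis_2pi)
    qed
    moreover have "z m = zi m" using m by (simp add: z_def zi_def complex_eq_iff)
    ultimately show "z (if j = m then m else m - j) ^ l * V (if j = m then m else m - j) = zi j ^ l * V' j"
      by (auto simp: V'_def)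
  qed (use m in \<open>auto split: if_splits\<close>)
  have "of_real e * of_nat m powr of_real e * (of_nat m * U l) =
      of_real e * of_nat m powr of_real e * (\<Sum>j=1..m. zi j ^ l * (\<Sum>r=1..m. z j ^ r * U r))"
  proof -
    have "(\<Sum>j=1..m. zi j ^ l * (\<Sum>r=1..m. z j ^ r * U r)) = (\<Sum>j=1..m. \<Sum>r=1..m. (z j ^ r * zi j ^ l) * U r)"
      by (simp add: sum_distrib_left mult_ac)
    also have "\<dots> = (\<Sum>r=1..m. (\<Sum>j=1..m. z j ^ r * zi j ^ l) * U r)"
      by (subst sum.swap) (simp add: sum_distrib_right)
    also have "\<dots> = (\<Sum>r=1..m. (if r = l then of_nat m else 0) * U r)"
      using sum_cis_orthogonality[OF m _ l] by (intro sum.cong) (auto simp: z_def zi_def)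
    also have "\<dots> = (\<Sum>r=1..m. if r = l then of_nat m * U r else 0)"
      by (intro sum.cong) auto
    also have "\<dots> = of_nat m * U l" using l by simp
    finally show ?thesis by simp
  qed
  also have "\<dots> = (\<Sum>j=1..m. zi j ^ l * (of_real e * of_nat m powr of_real e * (\<Sum>r=1..m. z j ^ r * U r)))"
    unfolding sum_distrib_left by (intro sum.cong refl) (simp add: mult_ac)
  also have "\<dots> = (\<Sum>j=1..m. zi j ^ l * (fe_factor (of_real e) * ((s + \<i> * c) * V' j + (s - \<i> * c) * V j)))"
    by (intro sum.cong refl) (simp only: key)
  also have "\<dots> = (\<Sum>j=1..m. fe_factor (of_real e) * (s + \<i> * c) * (zi j ^ l * V' j) +
      fe_factor (of_real e) * (s - \<i> * c) * (zi j ^ l * V j))"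
    by (intro sum.cong refl) (simp add: algebra_simps)
  also have "\<dots> = fe_factor (of_real e) * ((s + \<i> * c) * (\<Sum>j=1..m. zi j ^ l * V' j) +
      (s - \<i> * c) * (\<Sum>j=1..m. zi j ^ l * V j))"
    unfolding sum.distrib sum_distrib_left [symmetric] by (simp only: mult.assoc flip: distrib_left)
  also have "\<dots> = fe_factor (of_real e) * (\<Sum>r=1..m. ((s + \<i> * c) * z r ^ l + (s - \<i> * c) * zi r ^ l) * V r)"
    unfolding reindex by (simp add: sum_distrib_left sum.distrib distrib_right mult.assoc)
  also have "(\<Sum>r=1..m. ((s + \<i> * c) * z r ^ l + (s - \<i> * c) * zi r ^ l) * V r) =
      (\<Sum>r=1..m. 2 * sin (of_real (pi * e / 2) - of_real (2 * pi * real r * real l / real m)) * V r)"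
  proof (intro sum.cong refl arg_cong2[where f = "(*)"])
    fix r
    define t where "t = 2 * pi * real r * real l / real m"
    have "z r ^ l = cis t" "zi r ^ l = cis (- t)"
      by (simp_all add: z_def zi_def Complex.DeMoivre t_def mult_ac)
    hence zz: "z r ^ l = cos (of_real t) + \<i> * sin (of_real t)" "zi r ^ l = cos (of_real t) - \<i> * sin (of_real t)"
      by (simp_all add: complex_eq_iff cos_of_real sin_of_real)
    show "(s + \<i> * c) * z r ^ l + (s - \<i> * c) * zi r ^ l =
        2 * sin (of_real (pi * e / 2) - of_real (2 * pi * real r * real l / real m))"
      unfolding t_def [symmetric] zz by (simp add: sin_diff s_def c_def algebra_simps)
  qed
  also have "of_real e * of_nat m powr of_real e * (of_nat m * U l) =
      of_real e * of_nat m powr (1 + of_real e) * U l"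
    using m by (simp add: powr_add)
  finally show ?thesis by (simp only: U_def V_def)
qed

lemma one_plus_not_nonpos_Ints:
  fixes e :: complex
  assumes "Re e > -1"
  shows "1 + e \<notin> \<int>\<^sub>\<le>\<^sub>0"
proof
  assume "1 + e \<in> \<int>\<^sub>\<le>\<^sub>0"
  then obtain n where "1 + e = - of_nat n" by (elim nonpos_Ints_cases')
  hence "Re (1 + e) \<le> 0" by simp
  thus False using assms by simp
qed

text \<open>The identity theorem extends the equation from the interval (0, 1) to the strip, which
  contains the point e = 0 where Taylor coefficients are compared.\<close>

theorem hurwitz_functional_equation:
  fixes e :: complex and m l :: nat
  assumes e: "-1 < Re e" "Re e < 1" and l: "l \<in> {1..m}"
  shows "e * of_nat m powr (1 + e) * hurwitz_num (real l / real m) (- e) =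
    fe_factor e * (\<Sum>r=1..m. 2 * sin (of_real pi * e / 2 - of_real (2 * pi * real r * real l / real m))
      * hurwitz_num (real r / real m) (1 + e))"
proof -
  define S where "S = {e. -1 < Re e} \<inter> {e. Re e < 1}"
  define f where "f e = e * of_nat m powr (1 + e) * hurwitz_num (real l / real m) (- e)" for e
  define g where "g e = fe_factor e * (\<Sum>r=1..m. 2 * sin (of_real pi * e / 2 - of_real (2 * pi * real r * real l / real m))
      * hurwitz_num (real r / real m) (1 + e))" for e
  have m: "m > 0" using l by auto
  have S: "open S" "connected S"
    unfolding S_def by (auto intro!: open_Int open_halfspace_Re_gt open_halfspace_Re_lt
        convex_connected convex_Int convex_halfspace_Re_gt convex_halfspace_Re_lt)
  have "f holomorphic_on S"
    unfolding f_def using m l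
    by (intro holomorphic_intros holomorphic_hurwitz_num_compose) (auto simp: S_def)
  moreover have "g holomorphic_on S"
  proof -
    have "1 + e \<notin> \<int>\<^sub>\<le>\<^sub>0" if "e \<in> S" for e
      using that by (intro one_plus_not_nonpos_Ints) (simp add: S_def)
    thus ?thesis
      unfolding g_def fe_factor_def using m
      by (intro holomorphic_intros holomorphic_hurwitz_num_compose) (auto simp: S_def)
  qed
  ultimately have fg: "(\<lambda>e. f e - g e) holomorphic_on S" by (intro holomorphic_intros)
  have "f e - g e = 0"
  proof (rule analytic_continuation[OF fg S])
    show "of_real ` {0<..<1} \<subseteq> S" by (auto simp: S_def)
    show "(1/2 :: complex) \<in> S" by (simp add: S_def)
    show "(1/2 :: complex) islimpt of_real ` {0<..<1}"
    proof (subst islimpt_approachable, intro allI impI)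
      fix d :: real assume "d > 0"
      define x where "x = 1 / 2 + min (d / 2) (1 / 4)"
      have "dist (complex_of_real x) (of_real (1/2)) = \<bar>x - 1 / 2\<bar>"
        by (simp only: dist_of_real dist_real_def)
      with \<open>d > 0\<close> have "complex_of_real x \<noteq> 1 / 2 \<and> dist (complex_of_real x) (1 / 2) < d"
        by (auto simp: x_def min_def split: if_splits)
      moreover have "x \<in> {0<..<1}" using \<open>d > 0\<close> by (auto simp: x_def min_def)
      ultimately show "\<exists>x'\<in>complex_of_real ` {0<..<1}. x' \<noteq> 1 / 2 \<and> dist x' (1 / 2) < d"
        by blast
    qed
    show "e \<in> S" using e by (simp add: S_def)
    fix x :: complex assume "x \<in> of_real ` {0<..<1}"
    thus "f x - g x = 0"
      using hurwitz_functional_equation_real[OF _ _ l] by (auto simp: f_def g_def)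
  qed
  thus ?thesis by (simp add: f_def g_def)
qed

subsection \<open>Continuation to the plane\<close>

text \<open>Uniqueness for the definite description of \<open>hurwitz_zeta\<close>. The difference,
  with its removable singularities removed, vanishes identically, so f and g agree in a punctured
  neighbourhood of every point. In normal form such a neighbourhood determines the value: 0 at a
  pole, the limit elsewhere.\<close>

lemma nicely_meromorphic_on_UNIV_eqI:
  fixes f g :: "complex \<Rightarrow> complex"
  assumes f: "f nicely_meromorphic_on UNIV" and g: "g nicely_meromorphic_on UNIV"
    and U: "open U" "U \<noteq> {}" "\<And>s. s \<in> U \<Longrightarrow> f s = g s"
  shows "f = g"
proof
  define h where "h = (\<lambda>s. f s - g s)"
  have fm: "f meromorphic_on UNIV" and gm: "g meromorphic_on UNIV"
    using f g by (auto simp: nicely_meromorphic_on_def)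
  have hm: "h meromorphic_on UNIV"
    unfolding h_def by (intro meromorphic_intros fm gm)
  have hn: "remove_sings h nicely_meromorphic_on UNIV"
    by (rule remove_sings_nicely_meromorphic[OF hm])
  have iso: "eventually (\<lambda>w. remove_sings h w = h w) (at z)" for z
    using hm by (intro eventually_remove_sings_eq_at meromorphic_on_isolated_singularity)
      (auto intro: meromorphic_on_subset)
  obtain u where u: "u \<in> U" using U by auto
  have "eventually (\<lambda>w. h w = 0) (at u)"
    using eventually_at_in_open'[OF U(1) u] by eventually_elim (auto simp: h_def U)
  hence "eventually (\<lambda>w. remove_sings h w = 0) (at u)"
    using iso[of u] by eventually_elim auto
  hence "frequently (\<lambda>w. remove_sings h w = 0) (at u)"
    by (intro eventually_frequently) auto
  hence h0: "remove_sings h w = 0" for w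
    using hn by (rule frequently_eq_meromorphic_imp_constant) auto
  fix z
  have ev: "eventually (\<lambda>w. f w = g w) (at z)"
    using iso[of z] by eventually_elim (simp add: h0 fun_cong[OF h_def])
  have pole: "is_pole f z \<longleftrightarrow> is_pole g z" by (intro is_pole_cong ev refl)
  have fz: "is_pole f z \<and> f z = 0 \<or> f \<midarrow>z\<rightarrow> f z" and gz: "is_pole g z \<and> g z = 0 \<or> g \<midarrow>z\<rightarrow> g z"
    using f g by (auto simp: nicely_meromorphic_on_def)
  show "f z = g z"
  proof (cases "is_pole f z")
    case True
    have "\<not> f \<midarrow>z\<rightarrow> f z" "\<not> g \<midarrow>z\<rightarrow> g z"
      using True pole not_tendsto_and_filterlim_at_infinity[of "at z"] by (auto simp: is_pole_def)
    thus ?thesis using fz gz by simp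
  next
    case False
    hence "f \<midarrow>z\<rightarrow> f z" "g \<midarrow>z\<rightarrow> g z" using fz gz pole by auto
    moreover have "(f \<midarrow>z\<rightarrow> g z) \<longleftrightarrow> (g \<midarrow>z\<rightarrow> g z)" by (intro tendsto_cong ev)
    ultimately show ?thesis using LIM_unique by blast
  qed
qed

text \<open>The definite description denotes the intended function only once a meromorphic function
  on the whole plane is exhibited, although only Re s > -1 matters afterwards. It is glued from
  \<open>hurwitz_num\<close> and the functional equation, which agree for -1 < Re s < 0.\<close>

lemma hurwitz_zeta_eq:
  fixes m l :: nat
  assumes l: "l \<in> {1..m}" and s: "Re s > -1" "s \<noteq> 1"
  shows "hurwitz_zeta (real l / real m) s = hurwitz_num (real l / real m) s / (s - 1)"
proof -
  define v where "v = real l / real m"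
  have v: "v > 0" and m: "m > 0" using l by (auto simp: v_def)
  \<comment> \<open>The functional equation at e = -s, solved for zeta(s, l/m). For Re s < 0 neither
    Gamma(1 - s) nor the denominator s causes a singularity.\<close>
  define R where "R s = Gamma (1 - s) * of_real (2 * pi) powr (s - 1) *
    (\<Sum>r=1..m. 2 * sin (of_real pi * (- s) / 2 - of_real (2 * pi * real r * real l / real m))
      * hurwitz_num (real r / real m) (1 - s)) / (s * of_nat m powr (1 - s))" for s
  \<comment> \<open>The value 0 at the pole s = 1 is prescribed by the normal form.\<close>
  define Z where "Z s = (if Re s > -1 then if s = 1 then 0 else hurwitz_num v s / (s - 1) else R s)" for s
  have num: "(\<lambda>s. hurwitz_num (real r / real m) (1 - s)) holomorphic_on {s. Re s < 0}" if "r \<in> {1..m}" for r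
    using that by (intro holomorphic_hurwitz_num_compose holomorphic_intros) auto
  have "1 - s \<notin> \<int>\<^sub>\<le>\<^sub>0" if "Re s < 0" for s :: complex
    using one_plus_not_nonpos_Ints[of "- s"] that by simp
  hence R_hol: "R holomorphic_on {s. Re s < 0}"
    unfolding R_def using m by (intro holomorphic_intros num) auto
  have R_eq: "R s = hurwitz_num v s / (s - 1)" if s: "-1 < Re s" "Re s < 0" for s
  proof -
    have nz: "s \<noteq> 0" "s \<noteq> 1" "of_nat m powr (1 - s) \<noteq> 0" using s m by auto
    define S where "S = (\<Sum>r=1..m. 2 * sin (of_real pi * (- s) / 2 - of_real (2 * pi * real r * real l / real m))
      * hurwitz_num (real r / real m) (1 - s))"
    have "- s * of_nat m powr (1 - s) * hurwitz_num v s = fe_factor (- s) * S"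
      using hurwitz_functional_equation[of "- s" l m] s l by (simp add: v_def S_def)
    also have "fe_factor (- s) = - (s - 1) * (Gamma (1 - s) * of_real (2 * pi) powr (s - 1))"
      by (simp add: fe_factor_def)
    also have "- (s - 1) * (Gamma (1 - s) * of_real (2 * pi) powr (s - 1)) * S =
        - (s - 1) * (R s * (s * of_nat m powr (1 - s)))"
      using nz unfolding R_def S_def by simp
    finally have eq: "- s * of_nat m powr (1 - s) * hurwitz_num v s =
        - (s - 1) * (R s * (s * of_nat m powr (1 - s)))" .
    have "y = (s - 1) * r" if "- s * p * y = - (s - 1) * (r * (s * p))" "p \<noteq> 0" for p y r
    proof -
      have "(s * p) * (y - (s - 1) * r) = 0" using that by (simp add: algebra_simps)
      thus ?thesis using that nz by simp
    qed
    from this[OF eq nz(3)] have "hurwitz_num v s = (s - 1) * R s" .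
    thus ?thesis using nz by simp
  qed
  have hp: "open {s. -1 < Re s}" "open {s. Re s < 0}"
    by (auto intro: open_halfspace_Re_gt open_halfspace_Re_lt)
  have Z_hol: "Z holomorphic_on UNIV - {1}"
  proof -
    have "(\<lambda>s. hurwitz_num v s / (s - 1)) holomorphic_on {s. -1 < Re s} - {1}"
      using holomorphic_hurwitz_num[OF v]
      by (auto intro!: holomorphic_intros intro: holomorphic_on_subset)
    hence "Z holomorphic_on {s. -1 < Re s} - {1}"
      by (rule holomorphic_transform) (auto simp: Z_def)
    moreover have "Z holomorphic_on {s. Re s < 0}"
      using R_hol by (rule holomorphic_transform) (auto simp: Z_def R_eq)
    ultimately have "Z holomorphic_on ({s. -1 < Re s} - {1}) \<union> {s. Re s < 0}"
      using hp by (intro holomorphic_on_Un open_delete) auto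
    moreover have "({s. -1 < Re s} - {1}) \<union> {s. Re s < 0} = UNIV - {1}" by auto
    ultimately show ?thesis by simp
  qed
  have pole: "is_pole Z 1"
  proof -
    have "is_pole (\<lambda>s. hurwitz_num v s / (s - 1) ^ 1) 1"
      by (rule is_pole_basic[OF holomorphic_hurwitz_num[OF v] hp(1)]) (simp_all add: hurwitz_num_1 v)
    moreover have "eventually (\<lambda>s. s \<in> {s. -1 < Re s} - {1}) (at 1)"
      using hp by (intro eventually_at_in_open) auto
    hence "eventually (\<lambda>s. hurwitz_num v s / (s - 1) ^ 1 = Z s) (at 1)"
      by eventually_elim (auto simp: Z_def)
    ultimately show ?thesis by (rule is_pole_transform) (rule refl)
  qed
  have Z_nice: "Z nicely_meromorphic_on UNIV"
  proof (rule nicely_meromorphic_onI_open)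
    show "Z analytic_on UNIV - {1}"
      using Z_hol by (simp add: analytic_on_open open_delete)
    show "is_pole Z x \<and> Z x = 0" if "x \<in> {1}" for x
      using that pole by (simp add: Z_def)
    show "isolated_singularity_at Z x" for x
    proof (cases "x = 1")
      case True
      thus ?thesis using isolated_singularity_at_holomorphic[of Z UNIV 1] Z_hol by simp
    next
      case False
      hence "Z analytic_on {x}"
        using Z_hol by (intro holomorphic_on_imp_analytic_at[of _ "UNIV - {1}"]) auto
      thus ?thesis by (rule isolated_singularity_at_analytic)
    qed
  qed auto
  have Z_sums: "(\<lambda>n. of_real (real n + v) powr (- s)) sums Z s" if "Re s > 1" for s
    using hurwitz_sums[OF v that] that by (auto simp: Z_def)
  have "hurwitz_zeta v = Z"
    unfolding hurwitz_zeta_def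
  proof (rule the_equality)
    show "Z nicely_meromorphic_on UNIV \<and> (\<forall>s. 1 < Re s \<longrightarrow> (\<lambda>n. of_real (real n + v) powr - s) sums Z s)"
      using Z_nice Z_sums by blast
    fix f assume f: "f nicely_meromorphic_on UNIV \<and>
      (\<forall>s. 1 < Re s \<longrightarrow> (\<lambda>n. of_real (real n + v) powr - s) sums f s)"
    show "f = Z"
    proof (rule nicely_meromorphic_on_UNIV_eqI[where U = "{s. Re s > 1}"])
      show "{s. Re s > 1} \<noteq> {}" by (auto intro: exI[of _ 2])
      show "f s = Z s" if "s \<in> {s. Re s > 1}" for s
        using f Z_sums that sums_unique2 by blast
    qed (use f Z_nice in \<open>auto intro: open_halfspace_Re_gt\<close>)
  qed
  thus ?thesis using s by (simp add: Z_def v_def)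
qed

section \<open>Expansions at s = 1 and s = 0\<close>

definition num_fps :: "real \<Rightarrow> complex fps" where
  "num_fps v = fps_expansion (\<lambda>e. hurwitz_num v (1 + e)) 0"

text \<open>The expansion of zeta(-e, v), while \<open>num_fps v\<close> expands e zeta(1 + e, v);
  these are the two sides of the functional equation.\<close>

definition zeta_fps :: "real \<Rightarrow> complex fps" where
  "zeta_fps v = fps_expansion (\<lambda>e. hurwitz_num v (- e) / (- 1 - e)) 0"

lemma has_fps_expansion_num_fps:
  assumes v: "v > 0"
  shows "(\<lambda>e. hurwitz_num v (1 + e)) has_fps_expansion num_fps v"
  unfolding num_fps_def
proof (rule has_fps_expansion_fps_expansion)
  show "open {e. Re e > -2}" by (rule open_halfspace_Re_gt)
  show "(\<lambda>e. hurwitz_num v (1 + e)) holomorphic_on {e. Re e > -2}"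
    using v by (intro holomorphic_hurwitz_num_compose holomorphic_intros) auto
qed auto

lemma has_fps_expansion_zeta_fps:
  assumes v: "v > 0"
  shows "(\<lambda>e. hurwitz_num v (- e) / (- 1 - e)) has_fps_expansion zeta_fps v"
  unfolding zeta_fps_def
proof (rule has_fps_expansion_fps_expansion)
  show "open (ball 0 1 :: complex set)" by simp
  have "- 1 - e \<noteq> 0" if "norm e < 1" for e :: complex
  proof
    assume "- 1 - e = 0"
    hence "e = - 1" by (simp add: algebra_simps)
    thus False using that by simp
  qed
  moreover have "Re (- e) > -1" if "norm e < 1" for e :: complex
    using that abs_Re_le_cmod[of e] by simp
  ultimately show "(\<lambda>e. hurwitz_num v (- e) / (- 1 - e)) holomorphic_on ball 0 1"
    using v by (intro holomorphic_intros holomorphic_hurwitz_num_compose) auto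
qed auto

lemma num_fps_nth_0: "v > 0 \<Longrightarrow> fps_nth (num_fps v) 0 = 1"
  using has_fps_expansion_imp_0_eq_fps_nth_0[OF has_fps_expansion_num_fps[of v]] by (simp add: hurwitz_num_1)

text \<open>Division by e shifts the coefficients by one: the constant term becomes the residue, and
  gamma_n is found at n + 1.\<close>

lemma stieltjes_eq_num_fps:
  assumes l: "l \<in> {1..m}"
  shows "stieltjes n (real l / real m) = (-1) ^ n * fact n * fps_nth (num_fps (real l / real m)) (Suc n)"
proof -
  define v where "v = real l / real m"
  have v: "v > 0" using l by (auto simp: v_def)
  have "(\<lambda>e. hurwitz_num v (1 + e) / e) has_laurent_expansion fps_to_fls (num_fps v) / fls_X"
    by (intro laurent_expansion_intros has_laurent_expansion_fps has_fps_expansion_num_fps v)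
  moreover have "eventually (\<lambda>e. hurwitz_num v (1 + e) / e = hurwitz_zeta v (1 + e)) (at 0)"
  proof -
    have "eventually (\<lambda>e. e \<in> {e. Re e > -2} - {0}) (at (0 :: complex))"
      by (intro eventually_at_in_open open_halfspace_Re_gt) auto
    thus ?thesis
      by eventually_elim (use hurwitz_zeta_eq[OF l] in \<open>auto simp: v_def\<close>)
  qed
  ultimately have "(\<lambda>e. hurwitz_zeta v (1 + e)) has_laurent_expansion fps_to_fls (num_fps v) / fls_X"
    using has_laurent_expansion_cong[of "\<lambda>e. hurwitz_num v (1 + e) / e" "\<lambda>e. hurwitz_zeta v (1 + e)"
        "fps_to_fls (num_fps v) / fls_X" "fps_to_fls (num_fps v) / fls_X"] by simp
  hence "laurent_expansion (hurwitz_zeta v) 1 = fps_to_fls (num_fps v) / fls_X"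
    by (rule laurent_expansion_eqI)
  moreover have "fps_to_fls (num_fps v) / fls_X = fls_shift 1 (fps_to_fls (num_fps v))"
    by (simp add: fls_divide_X)
  moreover have "nat (int n + 1) = Suc n" by simp
  ultimately show ?thesis
    unfolding stieltjes_def v_def [symmetric] by (simp add: fls_shift_nth)
qed

text \<open>The reflection s = -e leaves the second derivative at 0 unchanged.\<close>

lemma zeta_fps_nth_2:
  assumes l: "l \<in> {1..m}"
  shows "fps_nth (zeta_fps (real l / real m)) 2 = hurwitz_zeta_dd0 (real l / real m) / 2"
proof -
  define v where "v = real l / real m"
  have v: "v > 0" using l by (auto simp: v_def)
  have eq: "hurwitz_zeta v s = hurwitz_num v s / (s - 1)" if "s \<in> ball 0 1" for s
  proof -
    have "s \<noteq> 1" using that by auto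
    moreover have "Re s > -1" using that abs_Re_le_cmod[of s] by auto
    ultimately show ?thesis using hurwitz_zeta_eq[OF l] by (simp add: v_def)
  qed
  have "(deriv ^^ 2) (\<lambda>e. hurwitz_num v (- e) / (- 1 - e)) 0 = (deriv ^^ 2) (\<lambda>e. hurwitz_zeta v (- 1 * e)) 0"
  proof (rule higher_deriv_cong_ev)
    have "eventually (\<lambda>e. e \<in> ball 0 1) (nhds (0 :: complex))"
      by (intro eventually_nhds_in_open) auto
    thus "eventually (\<lambda>e. hurwitz_num v (- e) / (- 1 - e) = hurwitz_zeta v (- 1 * e)) (nhds 0)"
      by eventually_elim (subst eq, auto)
  qed auto
  also have "\<dots> = (- 1) ^ 2 * (deriv ^^ 2) (hurwitz_zeta v) (- 1 * 0)"
  proof (rule higher_deriv_compose_linear[of _ "ball 0 1" "ball 0 1"])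
    have "s \<noteq> 1 \<and> Re s > -1" if "norm s < 1" for s
      using that abs_Re_le_cmod[of s] by auto
    hence "(\<lambda>s. hurwitz_num v s / (s - 1)) holomorphic_on ball 0 1"
      by (intro holomorphic_intros holomorphic_on_subset[OF holomorphic_hurwitz_num[OF v]]) auto
    thus "hurwitz_zeta v holomorphic_on ball 0 1"
      by (rule holomorphic_transform) (simp add: eq)
  qed auto
  finally show ?thesis
    unfolding v_def [symmetric] by (simp add: zeta_fps_def fps_expansion_def hurwitz_zeta_dd0_def)
qed

lemma zeta_fps_nth_0:
  assumes "v > 0"
  shows "fps_nth (zeta_fps v) 0 = 1 / 2 - of_real v"
  using has_fps_expansion_imp_0_eq_fps_nth_0[OF has_fps_expansion_zeta_fps[OF assms]] assms
  by (simp add: hurwitz_num_0)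

lemma zeta_fps_nth_1_aux:
  assumes v: "v > 0"
  shows "fps_nth (zeta_fps v) 1 = deriv (hurwitz_num v) 0 + of_real v - 1 / 2"
proof -
  have "(hurwitz_num v has_field_derivative deriv (hurwitz_num v) 0) (at (- 0))"
    using holomorphic_derivI[OF holomorphic_hurwitz_num[OF v] open_halfspace_Re_gt, of 0] by simp
  from DERIV_chain2[of "hurwitz_num v" _ uminus 0, OF this DERIV_minus[OF DERIV_ident]]
  have "((\<lambda>e. hurwitz_num v (- e)) has_field_derivative - deriv (hurwitz_num v) 0) (at 0)"
    by simp
  hence "((\<lambda>e. hurwitz_num v (- e) / (- 1 - e)) has_field_derivative
      deriv (hurwitz_num v) 0 + of_real v - 1 / 2) (at 0)"
    by (auto intro!: derivative_eq_intros simp: hurwitz_num_0 v)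
  thus ?thesis by (simp add: zeta_fps_def fps_expansion_def DERIV_imp_deriv)
qed

text \<open>Lerch's formula, with the sign reversed since s = -e. The missing constant comes from
  the distribution relation for m = 2: its derivative at 0 gives ln 2 / 2 as the derivative of
  \<open>hurwitz_num (1/2)\<close>, and Gamma(1/2) is the square root of pi.\<close>

lemma zeta_fps_nth_1:
  assumes v: "v > 0"
  shows "fps_nth (zeta_fps v) 1 = of_real (ln (2 * pi) / 2 - ln (Gamma v))"
proof -
  define K where "K = deriv (hurwitz_num 1) 0"
  have d: "deriv (hurwitz_num v) 0 = K + of_real (1 - v - ln (Gamma v))" if "v > 0" for v
    using deriv_hurwitz_num_0_diff[OF that] by (simp add: K_def algebra_simps)
  have D: "(hurwitz_num v has_field_derivative deriv (hurwitz_num v) 0) (at 0)" if "v > 0" for v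
    using holomorphic_derivI[OF holomorphic_hurwitz_num[OF that] open_halfspace_Re_gt, of 0] by simp
  have set2: "{Suc 0..2} = {1, 2}" by auto
  have "((\<lambda>s. hurwitz_num (1/2) s + hurwitz_num 1 s) has_field_derivative
      deriv (hurwitz_num (1/2)) 0 + deriv (hurwitz_num 1) 0) (at 0)"
    by (intro DERIV_add D) auto
  moreover have "((\<lambda>s. hurwitz_num (1/2) s + hurwitz_num 1 s) has_field_derivative
      of_real (ln 2) / 2 + deriv (hurwitz_num 1) 0) (at 0)"
  proof (rule has_field_derivative_transform_within_open[of "\<lambda>s. 2 powr s * hurwitz_num 1 s" _ _ "{s. Re s > -1}"])
    show "((\<lambda>s. 2 powr s * hurwitz_num 1 s) has_field_derivative of_real (ln 2) / 2 + deriv (hurwitz_num 1) 0) (at 0)"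
      by (auto intro!: derivative_eq_intros D simp: hurwitz_num_0 Ln_of_real[of 2, simplified])
    show "2 powr s * hurwitz_num 1 s = hurwitz_num (1/2) s + hurwitz_num 1 s" if "s \<in> {s. Re s > -1}" for s
      using hurwitz_num_distribution[of 2 s] that by (simp add: set2)
  qed (auto intro: open_halfspace_Re_gt)
  ultimately have "deriv (hurwitz_num (1/2)) 0 = of_real (ln 2) / 2"
    using DERIV_unique by fastforce
  moreover have "ln (Gamma (1/2 :: real)) = ln pi / 2"
    by (simp add: Gamma_one_half_real ln_sqrt)
  ultimately have "K = of_real (ln 2 / 2 + ln pi / 2 - 1 / 2)"
    using d[of "1/2"] by (simp add: field_simps)
  hence K: "K + 1 / 2 = of_real (ln (2 * pi) / 2)"
    by (simp add: ln_mult add_divide_distrib)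
  have "fps_nth (zeta_fps v) 1 = (K + 1 / 2) - of_real (ln (Gamma v))"
    unfolding zeta_fps_nth_1_aux[OF v] d[OF v] by (simp add: field_simps)
  thus ?thesis unfolding K by simp
qed

subsection \<open>Taylor coefficients\<close>

definition gamma_fps :: "nat \<Rightarrow> complex fps" where
  "gamma_fps m = fps_expansion (\<lambda>e. Gamma (1 + e) * of_real (2 * pi) powr (- 1 - e) * of_nat m powr (- e)) 0"

lemma has_fps_expansion_gamma_fps:
  assumes m: "m > 0"
  shows "(\<lambda>e. Gamma (1 + e) * of_real (2 * pi) powr (- 1 - e) * of_nat m powr (- e)) has_fps_expansion gamma_fps m"
  unfolding gamma_fps_def
proof (rule has_fps_expansion_fps_expansion)
  show "open {e. Re e > -1}" by (rule open_halfspace_Re_gt)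
  show "(\<lambda>e. Gamma (1 + e) * of_real (2 * pi) powr (- 1 - e) * of_nat m powr (- e)) holomorphic_on {e. Re e > -1}"
    using m one_plus_not_nonpos_Ints by (intro holomorphic_intros) auto
qed auto

text \<open>The logarithmic derivative at 0 collects Gamma'(1) = -gamma and the two powers; this is
  the origin of the quantity gamma + ln(2 pi m) in the theorem. No higher coefficient enters
  later.\<close>

lemma gamma_fps_nth:
  assumes m: "m > 0"
  shows "fps_nth (gamma_fps m) 0 = of_real (1 / (2 * pi))"
    and "fps_nth (gamma_fps m) 1 = - of_real ((euler_mascheroni + ln (2 * pi * real m)) / (2 * pi))"
proof -
  have p: "complex_of_real (2 * pi) powr (- 1) = of_real (1 / (2 * pi))"
    using powr_of_real[of "2 * pi" "- 1"] by (simp add: powr_minus_divide)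
  show "fps_nth (gamma_fps m) 0 = of_real (1 / (2 * pi))"
    using m p by (simp add: gamma_fps_def fps_expansion_def)
  have 1: "((\<lambda>e. Gamma (1 + e)) has_field_derivative - euler_mascheroni) (at (0::complex))"
    by (auto intro!: derivative_eq_intros simp: Digamma_1)
  have 2: "((\<lambda>e. complex_of_real (2 * pi) powr (- 1 - e)) has_field_derivative
      - of_real (ln (2 * pi)) * of_real (2 * pi) powr (- 1 - 0)) (at 0)"
    by (rule has_field_derivative_powr_minus) simp
  have 3: "((\<lambda>e. complex_of_real (real m) powr (0 - e)) has_field_derivative
      - of_real (ln (real m)) * of_real (real m) powr (0 - 0)) (at 0)"
    using m by (intro has_field_derivative_powr_minus) simp
  have "((\<lambda>e::complex. Gamma (1 + e) * of_real (2 * pi) powr (- 1 - e) * of_real (real m) powr (0 - e)) has_field_derivative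
    - of_real ((euler_mascheroni + ln (2 * pi * real m)) / (2 * pi))) (at 0)"
    by (rule DERIV_cong[OF DERIV_mult[OF DERIV_mult[OF 1 2] 3]])
      (use m p in \<open>simp add: ln_mult field_simps\<close>)
  thus "fps_nth (gamma_fps m) 1 = - of_real ((euler_mascheroni + ln (2 * pi * real m)) / (2 * pi))"
    by (simp add: gamma_fps_def fps_expansion_def DERIV_imp_deriv)
qed

lemma fps_nth_mult_upto_3:
  fixes a b :: "'a :: comm_ring_1 fps"
  shows "fps_nth (a * b) (Suc 0) = fps_nth a 0 * fps_nth b (Suc 0) + fps_nth a (Suc 0) * fps_nth b 0"
    and "fps_nth (a * b) 2 = fps_nth a 0 * fps_nth b 2 + fps_nth a (Suc 0) * fps_nth b (Suc 0) + fps_nth a 2 * fps_nth b 0"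
    and "fps_nth (a * b) 3 = fps_nth a 0 * fps_nth b 3 + fps_nth a (Suc 0) * fps_nth b 2
       + fps_nth a 2 * fps_nth b (Suc 0) + fps_nth a 3 * fps_nth b 0"
  by (simp_all add: fps_mult_nth eval_nat_numeral)

lemma has_fps_expansion_transform:
  assumes "f has_fps_expansion F" "eventually (\<lambda>e. f e = g e) (nhds 0)"
  shows "g has_fps_expansion F"
  using has_fps_expansion_cong[of f g F F] assms by simp

text \<open>The functional equation divided by (1 + e) m^e, which puts zeta(-e, l/m) on the left.
  The factor e there matches the factor e contained in \<open>hurwitz_num\<close> at 1 + e.\<close>

lemma functional_equation_Taylor:
  assumes e: "norm e < 1" and l: "l \<in> {1..m}"
  shows "- of_nat m * (e * (hurwitz_num (real l / real m) (- e) / (- 1 - e))) =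
    Gamma (1 + e) * of_real (2 * pi) powr (- 1 - e) * of_nat m powr (- e) *
    (\<Sum>r=1..m. 2 * sin (of_real (pi / 2) * e - of_real (2 * pi * real r * real l / real m))
      * hurwitz_num (real r / real m) (1 + e))"
proof -
  have m: "m > 0" using l by auto
  define S where "S = (\<Sum>r=1..m. 2 * sin (of_real (pi / 2) * e - of_real (2 * pi * real r * real l / real m))
      * hurwitz_num (real r / real m) (1 + e))"
  define W where "W = hurwitz_num (real l / real m) (- e)"
  define p where "p = complex_of_nat m powr e"
  have nz: "1 + e \<noteq> 0" "p \<noteq> 0" "complex_of_nat m \<noteq> 0"
    using e m by (auto simp: p_def add_eq_0_iff)
  have "e * of_nat m powr (1 + e) * W = fe_factor e * S"
    unfolding W_def S_def using hurwitz_functional_equation[of e l m] l e abs_Re_le_cmod[of e] by simp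
  hence "e * (of_nat m * p) * W = (1 + e) * (Gamma (1 + e) * of_real (2 * pi) powr (- 1 - e)) * S"
    using m by (simp add: powr_add p_def fe_factor_def)
  hence "e * of_nat m * W / (1 + e) = Gamma (1 + e) * of_real (2 * pi) powr (- 1 - e) * (1 / p) * S"
    using nz by (simp add: field_simps)
  moreover have "of_nat m powr (- e) = 1 / p" by (simp add: p_def powr_minus_divide)
  moreover have "- of_nat m * (e * (W / (- 1 - e))) = e * of_nat m * W / (1 + e)"
  proof -
    have "- 1 - e = - (1 + e)" by simp
    thus ?thesis by (simp only: divide_minus_right) simp
  qed
  ultimately show ?thesis unfolding S_def W_def by simp
qed

lemma has_fps_expansion_num_sum:
  "(\<lambda>e. \<Sum>r=1..m. c r * hurwitz_num (real r / real m) (1 + e)) has_fps_expansion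
     (\<Sum>r=1..m. fps_const (c r) * num_fps (real r / real m))"
  by (intro fps_expansion_intros has_fps_expansion_num_fps) auto

lemma zeta_functional_equation_fps:
  "- fps_X * zeta_fps 1 = gamma_fps 1 * (fps_sin (of_real (pi / 2)) * (fps_const 2 * num_fps 1))"
proof (rule fps_expansion_unique_complex)
  show "(\<lambda>e. - e * (hurwitz_num 1 (- e) / (- 1 - e))) has_fps_expansion - fps_X * zeta_fps 1"
    by (intro fps_expansion_intros has_fps_expansion_zeta_fps) auto
  have "(\<lambda>e. Gamma (1 + e) * of_real (2 * pi) powr (- 1 - e) * of_nat 1 powr (- e) *
      (sin (of_real (pi / 2) * e) * (2 * hurwitz_num 1 (1 + e)))) has_fps_expansion
      gamma_fps 1 * (fps_sin (of_real (pi / 2)) * (fps_const 2 * num_fps 1))"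
    by (intro fps_expansion_intros has_fps_expansion_num_fps has_fps_expansion_gamma_fps) auto
  moreover have "eventually (\<lambda>e. e \<in> ball 0 1) (nhds (0 :: complex))"
    by (intro eventually_nhds_in_open) auto
  hence "eventually (\<lambda>e. Gamma (1 + e) * of_real (2 * pi) powr (- 1 - e) * of_nat 1 powr (- e) *
      (sin (of_real (pi / 2) * e) * (2 * hurwitz_num 1 (1 + e))) =
      - e * (hurwitz_num 1 (- e) / (- 1 - e))) (nhds 0)"
  proof eventually_elim
    case (elim e)
    have "sin (of_real (pi / 2) * e - of_real (2 * pi)) = sin (of_real (pi / 2) * e)"
      by (simp only: sin_diff sin_of_real cos_of_real) simp
    thus ?case using functional_equation_Taylor[of e 1 1] elim by simp
  qed
  ultimately show "(\<lambda>e. - e * (hurwitz_num 1 (- e) / (- 1 - e))) has_fps_expansion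
      gamma_fps 1 * (fps_sin (of_real (pi / 2)) * (fps_const 2 * num_fps 1))"
    by (rule has_fps_expansion_transform)
qed

text \<open>Passing from l to m - l reverses the sign of the angles modulo 2 pi. Sum and difference
  of the two equations therefore separate the cosine transform, with factor sin(pi e / 2), from the
  sine transform, with factor cos(pi e / 2).\<close>

lemma symmetric_functional_equation_fps:
  assumes l: "l \<in> {1..<m}"
  defines "t \<equiv> (\<lambda>r. 2 * pi * real r * real l / real m)"
  shows "fps_const (- of_nat m) * (fps_X * (zeta_fps (real l / real m) + zeta_fps (1 - real l / real m))) =
      gamma_fps m * (fps_sin (of_real (pi / 2)) * (\<Sum>r=1..m. fps_const (4 * of_real (cos (t r))) * num_fps (real r / real m)))"
    and "fps_const (- of_nat m) * (fps_X * (zeta_fps (real l / real m) - zeta_fps (1 - real l / real m))) =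
      gamma_fps m * (fps_cos (of_real (pi / 2)) * (\<Sum>r=1..m. fps_const (- 4 * of_real (sin (t r))) * num_fps (real r / real m)))"
proof -
  define v where "v = real l / real m"
  have m: "m > 0" and v: "0 < v" "v < 1" using l by (auto simp: v_def)
  have v': "real (m - l) / real m = 1 - v" using l m by (simp add: v_def field_simps)
  define G where "G e = Gamma (1 + e) * of_real (2 * pi) powr (- 1 - e) * of_nat m powr (- e)" for e :: complex
  define Z where "Z v e = hurwitz_num v (- e) / (- 1 - e)" for v e
  define W where "W r e = hurwitz_num (real r / real m) (1 + e)" for r e
  have G: "G has_fps_expansion gamma_fps m"
    unfolding G_def using m by (rule has_fps_expansion_gamma_fps)
  have Z: "Z w has_fps_expansion zeta_fps w" if "w > 0" for w
    unfolding Z_def using that by (rule has_fps_expansion_zeta_fps)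
  have ev: "eventually (\<lambda>e. e \<in> ball 0 1) (nhds (0 :: complex))"
    by (intro eventually_nhds_in_open) auto
  have sin_reflect: "sin (x - of_real (2 * pi * real r * real (m - l) / real m)) = sin (x + of_real (t r))"
    for x :: complex and r
  proof -
    have "2 * pi * real r * real (m - l) / real m = real r * (2 * pi) - t r"
      using l m by (simp add: t_def of_nat_diff field_simps)
    hence eq: "x - of_real (2 * pi * real r * real (m - l) / real m) =
        (x + of_real (t r)) - complex_of_real (real r * (2 * pi))"
      by (simp only: of_real_diff) simp
    have "cos (2 * pi * real r) = 1" "sin (2 * pi * real r) = 0"
      using cos_int_2pin[of "int r"] sin_int_2pin[of "int r"] by simp_all
    hence "cos (complex_of_real (real r * (2 * pi))) = 1" "sin (complex_of_real (real r * (2 * pi))) = 0"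
      unfolding cos_of_real sin_of_real by (simp_all add: mult.commute)
    thus ?thesis
      unfolding eq sin_diff[of "x + of_real (t r)"] by (simp only:) simp
  qed
  have E1: "- of_nat m * (e * Z v e) = G e * (\<Sum>r=1..m. 2 * sin (of_real (pi / 2) * e - of_real (t r)) * W r e)"
    if "norm e < 1" for e
    using functional_equation_Taylor[OF that, of l m] l by (simp only: G_def Z_def W_def v_def t_def) simp
  have E2: "- of_nat m * (e * Z (1 - v) e) = G e * (\<Sum>r=1..m. 2 * sin (of_real (pi / 2) * e + of_real (t r)) * W r e)"
    if "norm e < 1" for e
  proof -
    have "m - l \<in> {1..m}" using l by auto
    from functional_equation_Taylor[OF that this] show ?thesis
      unfolding sin_reflect v' by (simp only: G_def Z_def W_def)
  qed
  show "fps_const (- of_nat m) * (fps_X * (zeta_fps (real l / real m) + zeta_fps (1 - real l / real m))) =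
      gamma_fps m * (fps_sin (of_real (pi / 2)) * (\<Sum>r=1..m. fps_const (4 * of_real (cos (t r))) * num_fps (real r / real m)))"
    (is "?A = ?B")
  proof (rule fps_expansion_unique_complex)
    show "(\<lambda>e. - of_nat m * (e * (Z v e + Z (1 - v) e))) has_fps_expansion ?A"
      unfolding v_def [symmetric] using v by (intro fps_expansion_intros Z) auto
    have "(\<lambda>e. G e * (sin (of_real (pi / 2) * e) * (\<Sum>r=1..m. 4 * of_real (cos (t r)) * W r e))) has_fps_expansion ?B"
      unfolding W_def by (intro fps_expansion_intros G has_fps_expansion_num_sum)
    moreover have "eventually (\<lambda>e. G e * (sin (of_real (pi / 2) * e) * (\<Sum>r=1..m. 4 * of_real (cos (t r)) * W r e)) =
        - of_nat m * (e * (Z v e + Z (1 - v) e))) (nhds 0)"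
      using ev
    proof eventually_elim
      case (elim e)
      have "- of_nat m * (e * (Z v e + Z (1 - v) e)) = - of_nat m * (e * Z v e) + - of_nat m * (e * Z (1 - v) e)"
        by (simp add: algebra_simps)
      also have "\<dots> = G e * (\<Sum>r=1..m. 2 * sin (of_real (pi / 2) * e - of_real (t r)) * W r e +
          2 * sin (of_real (pi / 2) * e + of_real (t r)) * W r e)"
        using elim by (simp only: E1 E2 mem_ball dist_0_norm sum.distrib distrib_left)
      also have "(\<Sum>r=1..m. 2 * sin (of_real (pi / 2) * e - of_real (t r)) * W r e +
          2 * sin (of_real (pi / 2) * e + of_real (t r)) * W r e) =
          sin (of_real (pi / 2) * e) * (\<Sum>r=1..m. 4 * of_real (cos (t r)) * W r e)"
        unfolding sum_distrib_left
        by (intro sum.cong refl) (simp add: sin_diff sin_add cos_of_real sin_of_real algebra_simps)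
      finally show ?case by (rule sym)
    qed
    ultimately show "(\<lambda>e. - of_nat m * (e * (Z v e + Z (1 - v) e))) has_fps_expansion ?B"
      by (rule has_fps_expansion_transform)
  qed
  show "fps_const (- of_nat m) * (fps_X * (zeta_fps (real l / real m) - zeta_fps (1 - real l / real m))) =
      gamma_fps m * (fps_cos (of_real (pi / 2)) * (\<Sum>r=1..m. fps_const (- 4 * of_real (sin (t r))) * num_fps (real r / real m)))"
    (is "?A = ?B")
  proof (rule fps_expansion_unique_complex)
    show "(\<lambda>e. - of_nat m * (e * (Z v e - Z (1 - v) e))) has_fps_expansion ?A"
      unfolding v_def [symmetric] using v by (intro fps_expansion_intros Z) auto
    have "(\<lambda>e. G e * (cos (of_real (pi / 2) * e) * (\<Sum>r=1..m. - 4 * of_real (sin (t r)) * W r e))) has_fps_expansion ?B"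
      unfolding W_def by (intro fps_expansion_intros G has_fps_expansion_num_sum)
    moreover have "eventually (\<lambda>e. G e * (cos (of_real (pi / 2) * e) * (\<Sum>r=1..m. - 4 * of_real (sin (t r)) * W r e)) =
        - of_nat m * (e * (Z v e - Z (1 - v) e))) (nhds 0)"
      using ev
    proof eventually_elim
      case (elim e)
      have "- of_nat m * (e * (Z v e - Z (1 - v) e)) = - of_nat m * (e * Z v e) - - of_nat m * (e * Z (1 - v) e)"
        by (simp add: algebra_simps)
      also have "\<dots> = G e * (\<Sum>r=1..m. 2 * sin (of_real (pi / 2) * e - of_real (t r)) * W r e -
          2 * sin (of_real (pi / 2) * e + of_real (t r)) * W r e)"
        using elim by (simp only: E1 E2 mem_ball dist_0_norm sum_subtractf right_diff_distrib)
      also have "(\<Sum>r=1..m. 2 * sin (of_real (pi / 2) * e - of_real (t r)) * W r e -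
          2 * sin (of_real (pi / 2) * e + of_real (t r)) * W r e) =
          cos (of_real (pi / 2) * e) * (\<Sum>r=1..m. - 4 * of_real (sin (t r)) * W r e)"
        unfolding sum_distrib_left
        by (intro sum.cong refl) (simp add: sin_diff sin_add cos_of_real sin_of_real algebra_simps)
      finally show ?case by (rule sym)
    qed
    ultimately show "(\<lambda>e. - of_nat m * (e * (Z v e - Z (1 - v) e))) has_fps_expansion ?B"
      by (rule has_fps_expansion_transform)
  qed
qed


lemma fps_sin_cos_nth_upto_3:
  fixes c :: complex
  shows "fps_nth (fps_sin c) 0 = 0" "fps_nth (fps_sin c) (Suc 0) = c" "fps_nth (fps_sin c) 2 = 0"
    and "fps_nth (fps_cos c) 0 = 1" "fps_nth (fps_cos c) (Suc 0) = 0"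
  by (simp_all add: fps_sin_def fps_cos_def)

lemma ln_Gamma_reflection:
  fixes v :: real
  assumes "0 < v" "v < 1"
  shows "ln (Gamma v) + ln (Gamma (1 - v)) = ln pi - ln (sin (pi * v))"
proof -
  have "complex_of_real (Gamma v * Gamma (1 - v)) = of_real (pi / sin (pi * v))"
    using Gamma_reflection_complex[of "of_real v"]
    by (simp add: Gamma_complex_of_real [symmetric] sin_of_real [symmetric])
  hence "Gamma v * Gamma (1 - v) = pi / sin (pi * v)" by (simp only: of_real_eq_iff)
  moreover have "sin (pi * v) > 0" using assms by (intro sin_gt_zero) auto
  moreover have "Gamma v > 0" "Gamma (1 - v) > 0" using assms by (auto intro: Gamma_real_pos)
  ultimately show ?thesis
    using ln_mult_pos[of "Gamma v" "Gamma (1 - v)"] ln_divide_pos[of pi "sin (pi * v)"] by simp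
qed

lemma num_fps_nth_stieltjes:
  assumes "r \<in> {1..m}"
  shows "fps_nth (num_fps (real r / real m)) 0 = 1"
    and "fps_nth (num_fps (real r / real m)) (Suc 0) = stieltjes 0 (real r / real m)"
    and "fps_nth (num_fps (real r / real m)) 2 = - stieltjes 1 (real r / real m)"
  using stieltjes_eq_num_fps[OF assms, of 0] stieltjes_eq_num_fps[OF assms, of 1] assms
  by (auto simp: num_fps_nth_0 numeral_2_eq_2)

text \<open>Coefficients are compared successively. In the sum equation e, e^2 and e^3 determine the
  cosine transforms of 1, gamma_0 and gamma_1; in the difference equation 1, e and e^2 do this for
  the sine transforms. The gamma_0 transforms return multiplied by gamma + ln(2 pi m). Reflection of
  Gamma turns the first derivatives in the sum into ln sin.\<close>

lemma
  assumes l: "l \<in> {1..<m}"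
  defines "v \<equiv> real l / real m" and "t \<equiv> (\<lambda>r. 2 * pi * real r * real l / real m)"
  shows stieltjes_cos_sum: "(\<Sum>r=1..m. of_real (cos (t r)) * stieltjes 1 (real r / real m)) =
      of_nat m / 2 * (hurwitz_zeta_dd0 v + hurwitz_zeta_dd0 (1 - v)) +
      of_nat m * of_real (euler_mascheroni + ln (2 * pi * real m)) * of_real (ln 2 + ln (sin (pi * v)))"
    and stieltjes_sin_sum: "(\<Sum>r=1..m. of_real (sin (t r)) * stieltjes 1 (real r / real m)) =
      of_real (pi * real m / 2 * (ln (Gamma v) - ln (Gamma (1 - v))
        - (euler_mascheroni + ln (2 * pi * real m)) * (1 - 2 * v)))"
proof -
  have m: "m > 0" and v: "0 < v" "v < 1" using l by (auto simp: v_def)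
  have l1: "l \<in> {1..m}" and l2: "m - l \<in> {1..m}" using l by auto
  have v': "real (m - l) / real m = 1 - v" using l m by (simp add: v_def field_simps)
  define A where "A = complex_of_real (euler_mascheroni + ln (2 * pi * real m))"
  define p where "p = complex_of_real pi"
  have p0: "p \<noteq> 0" by (simp add: p_def)
  have M: "complex_of_nat m \<noteq> 0" using m by simp
  have h: "fps_nth (gamma_fps m) 0 = 1 / (2 * p)" "fps_nth (gamma_fps m) (Suc 0) = - A / (2 * p)"
    using gamma_fps_nth[OF m] by (simp_all add: p_def A_def del: of_real_add)
  have z0: "fps_nth (zeta_fps v) 0 = 1 / 2 - of_real v" "fps_nth (zeta_fps (1 - v)) 0 = of_real v - 1 / 2"
    using zeta_fps_nth_0[of v] zeta_fps_nth_0[of "1 - v"] v by simp_all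
  have z1: "fps_nth (zeta_fps v) (Suc 0) = of_real (ln (2 * pi) / 2 - ln (Gamma v))"
    "fps_nth (zeta_fps (1 - v)) (Suc 0) = of_real (ln (2 * pi) / 2 - ln (Gamma (1 - v)))"
    using zeta_fps_nth_1[of v] zeta_fps_nth_1[of "1 - v"] v by simp_all
  have z2: "fps_nth (zeta_fps v) 2 = hurwitz_zeta_dd0 v / 2"
    "fps_nth (zeta_fps (1 - v)) 2 = hurwitz_zeta_dd0 (1 - v) / 2"
    using zeta_fps_nth_2[OF l1] zeta_fps_nth_2[OF l2] unfolding v' v_def [symmetric] by simp_all
  define Q where "Q = (\<Sum>r=1..m. fps_const (4 * of_real (cos (t r))) * num_fps (real r / real m))"
  define P where "P = (\<Sum>r=1..m. fps_const (- 4 * of_real (sin (t r))) * num_fps (real r / real m))"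
  have Q: "fps_nth Q 2 = - 4 * (\<Sum>r=1..m. of_real (cos (t r)) * stieltjes 1 (real r / real m))"
    unfolding Q_def fps_sum_nth sum_distrib_left
    by (intro sum.cong refl) (simp add: num_fps_nth_stieltjes)
  have P: "fps_nth P 2 = 4 * (\<Sum>r=1..m. of_real (sin (t r)) * stieltjes 1 (real r / real m))"
    unfolding P_def fps_sum_nth sum_distrib_left
    by (intro sum.cong refl) (simp add: num_fps_nth_stieltjes)
  have hp: "complex_of_real (pi / 2) = p / 2" by (simp add: p_def)
  have lin: "fps_nth (fps_const c * (fps_X * F)) (Suc 0) = c * fps_nth F 0"
    "fps_nth (fps_const c * (fps_X * F)) 2 = c * fps_nth F (Suc 0)"
    "fps_nth (fps_const c * (fps_X * F)) 3 = c * fps_nth F 2" for c and F :: "complex fps"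
    by (simp_all add: fps_X_mult_nth eval_nat_numeral)
  \<comment> \<open>Once the constant term of \<open>Q\<close> is known to be 0, the second
    coefficient of \<open>gamma_fps\<close> and the cubic term of the sine drop out.\<close>
  have sinQ: "fps_nth (gamma_fps m * (fps_sin (p / 2) * Q)) (Suc 0) = fps_nth Q 0 / 4"
    "fps_nth Q 0 = 0 \<Longrightarrow> fps_nth (gamma_fps m * (fps_sin (p / 2) * Q)) 2 = fps_nth Q (Suc 0) / 4"
    "fps_nth Q 0 = 0 \<Longrightarrow> fps_nth (gamma_fps m * (fps_sin (p / 2) * Q)) 3 =
       (fps_nth Q 2 - A * fps_nth Q (Suc 0)) / 4"
    using p0 by (simp_all add: fps_nth_mult_upto_3 fps_sin_cos_nth_upto_3 h divide_simps)
  have cosP: "fps_nth (gamma_fps m * (fps_cos (p / 2) * P)) 0 = fps_nth P 0 / (2 * p)"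
    "fps_nth P 0 = 0 \<Longrightarrow> fps_nth (gamma_fps m * (fps_cos (p / 2) * P)) (Suc 0) = fps_nth P (Suc 0) / (2 * p)"
    "fps_nth P 0 = 0 \<Longrightarrow> fps_nth (gamma_fps m * (fps_cos (p / 2) * P)) 2 =
       (fps_nth P 2 - A * fps_nth P (Suc 0)) / (2 * p)"
    using p0 by (simp_all add: fps_nth_mult_upto_3 fps_sin_cos_nth_upto_3 h divide_simps)
  have S: "fps_const (- of_nat m) * (fps_X * (zeta_fps v + zeta_fps (1 - v))) =
      gamma_fps m * (fps_sin (p / 2) * Q)"
    unfolding Q_def t_def v_def hp [symmetric] by (rule symmetric_functional_equation_fps(1)[OF l])
  have Q0: "fps_nth Q 0 = 0"
    using arg_cong[OF S, of "\<lambda>F. fps_nth F (Suc 0)"] unfolding lin sinQ by (simp add: z0)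
  have "ln (2 * pi) - (ln (Gamma v) + ln (Gamma (1 - v))) = ln 2 + ln (sin (pi * v))"
    using ln_Gamma_reflection[OF v] by (simp add: ln_mult)
  moreover have "fps_nth (zeta_fps v + zeta_fps (1 - v)) (Suc 0) =
      of_real (ln (2 * pi) - (ln (Gamma v) + ln (Gamma (1 - v))))"
    by (simp add: z1)
  ultimately have Q1: "fps_nth Q (Suc 0) = - 4 * of_nat m * of_real (ln 2 + ln (sin (pi * v)))"
    using arg_cong[OF S, of "\<lambda>F. fps_nth F 2"] unfolding lin sinQ(2)[OF Q0] by (simp add: mult_ac)
  have "- of_nat m * (hurwitz_zeta_dd0 v / 2 + hurwitz_zeta_dd0 (1 - v) / 2) =
      (fps_nth Q 2 - A * fps_nth Q (Suc 0)) / 4"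
    using arg_cong[OF S, of "\<lambda>F. fps_nth F 3"] unfolding lin sinQ(3)[OF Q0] by (simp add: z2)
  hence eq: "- of_nat m * (hurwitz_zeta_dd0 v / 2 + hurwitz_zeta_dd0 (1 - v) / 2) =
      (- 4 * (\<Sum>r=1..m. of_real (cos (t r)) * stieltjes 1 (real r / real m))
       - A * (- 4 * of_nat m * of_real (ln 2 + ln (sin (pi * v))))) / 4"
    unfolding Q Q1 .
  have "T = M / 2 * (x + y) + M * A * c" if "- M * (x / 2 + y / 2) = (- 4 * T - A * (- 4 * M * c)) / 4"
    for T M x y A c :: complex
  proof -
    have "T - (M / 2 * (x + y) + M * A * c) = - M * (x / 2 + y / 2) - (- 4 * T - A * (- 4 * M * c)) / 4"
      by (simp add: field_simps)
    thus ?thesis unfolding that by simp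
  qed
  from this[OF eq] show "(\<Sum>r=1..m. of_real (cos (t r)) * stieltjes 1 (real r / real m)) =
      of_nat m / 2 * (hurwitz_zeta_dd0 v + hurwitz_zeta_dd0 (1 - v)) +
      of_nat m * of_real (euler_mascheroni + ln (2 * pi * real m)) * of_real (ln 2 + ln (sin (pi * v)))"
    unfolding A_def .
  have D: "fps_const (- of_nat m) * (fps_X * (zeta_fps v - zeta_fps (1 - v))) =
      gamma_fps m * (fps_cos (p / 2) * P)"
    unfolding P_def t_def v_def hp [symmetric] by (rule symmetric_functional_equation_fps(2)[OF l])
  have P0: "fps_nth P 0 = 0"
    using arg_cong[OF D, of "\<lambda>F. fps_nth F 0"] p0 unfolding cosP by simp
  have P1: "fps_nth P (Suc 0) = - 2 * p * of_nat m * (1 - 2 * of_real v)"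
  proof -
    have "fps_nth (zeta_fps v - zeta_fps (1 - v)) 0 = 1 - 2 * of_real v" by (simp add: z0)
    hence "- of_nat m * (1 - 2 * of_real v) = fps_nth P (Suc 0) / (2 * p)"
      using arg_cong[OF D, of "\<lambda>F. fps_nth F (Suc 0)"] unfolding lin cosP(2)[OF P0] by (simp only:)
    hence "fps_nth P (Suc 0) = - of_nat m * (1 - 2 * of_real v) * (2 * p)"
      using p0 by (simp add: eq_divide_eq)
    thus ?thesis by simp
  qed
  have "- of_nat m * of_real (ln (Gamma (1 - v)) - ln (Gamma v)) =
      (fps_nth P 2 - A * fps_nth P (Suc 0)) / (2 * p)"
    using arg_cong[OF D, of "\<lambda>F. fps_nth F 2"] unfolding lin cosP(3)[OF P0] by (simp add: z1)
  hence eq': "fps_nth P 2 = 2 * p * of_nat m * (of_real (ln (Gamma v) - ln (Gamma (1 - v))) - A * (1 - 2 * of_real v))"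
    using p0 unfolding P1 by (simp add: field_simps)
  have "T = p * M / 2 * X" if "4 * T = 2 * p * M * X" for T M X
  proof -
    have "T = 4 * T / 4" by simp
    also have "\<dots> = p * M / 2 * X" unfolding that by simp
    finally show ?thesis .
  qed
  from this[OF eq'[unfolded P]] show "(\<Sum>r=1..m. of_real (sin (t r)) * stieltjes 1 (real r / real m)) =
      of_real (pi * real m / 2 * (ln (Gamma v) - ln (Gamma (1 - v))
        - (euler_mascheroni + ln (2 * pi * real m)) * (1 - 2 * v)))"
    by (simp add: p_def A_def)
qed

text \<open>Here gamma_0 comes from a Laurent expansion, and its identity with Euler's constant
  needs proof. In the functional equation of zeta, the coefficient of e^2 relates gamma_0 to
  zeta'(0), known by Lerch's formula, and to Gamma'(1), which is minus Euler's constant.\<close>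

lemma stieltjes_0_1: "stieltjes 0 1 = of_real euler_mascheroni"
proof -
  have n: "fps_nth (num_fps 1) 0 = 1" "fps_nth (num_fps 1) (Suc 0) = stieltjes 0 1"
    using num_fps_nth_stieltjes[of 1 1] by simp_all
  define p where "p = complex_of_real pi"
  have p0: "p \<noteq> 0" by (simp add: p_def)
  have h: "fps_nth (gamma_fps (Suc 0)) 0 = 1 / (2 * p)"
    "fps_nth (gamma_fps (Suc 0)) (Suc 0) = - of_real (euler_mascheroni + ln (2 * pi)) / (2 * p)"
    using gamma_fps_nth[of 1] by (simp_all add: p_def del: of_real_add)
  have hp: "complex_of_real (pi / 2) = p / 2" by (simp add: p_def)
  have "fps_nth (- fps_X * zeta_fps 1) 2 = fps_nth (gamma_fps 1 * (fps_sin (p / 2) * (fps_const 2 * num_fps 1))) 2"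
    using zeta_functional_equation_fps unfolding hp by (rule arg_cong)
  moreover have "fps_nth (- fps_X * zeta_fps 1) 2 = - of_real (ln (2 * pi) / 2)"
    using zeta_fps_nth_1[of 1] by (simp add: fps_X_mult_nth eval_nat_numeral)
  moreover have "fps_nth (gamma_fps 1 * (fps_sin (p / 2) * (fps_const 2 * num_fps 1))) 2 =
      (stieltjes 0 1 - of_real (euler_mascheroni + ln (2 * pi))) / 2"
    using p0 by (simp add: fps_nth_mult_upto_3 fps_sin_cos_nth_upto_3 h n divide_simps)
  ultimately have "- of_real (ln (2 * pi) / 2) = (stieltjes 0 1 - of_real (euler_mascheroni + ln (2 * pi))) / 2"
    by simp
  thus ?thesis by (simp add: field_simps)
qed

section \<open>Distribution relations and closed sums\<close>

lemma num_fps_distribution: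
  assumes m: "m > 0"
  shows "(\<Sum>r=1..m. num_fps (real r / real m)) =
     fps_const (of_nat m) * (fps_exp (of_real (ln (real m))) * num_fps 1)"
proof (rule fps_expansion_unique_complex)
  show "(\<lambda>e. \<Sum>r=1..m. hurwitz_num (real r / real m) (1 + e)) has_fps_expansion (\<Sum>r=1..m. num_fps (real r / real m))"
    by (intro fps_expansion_intros has_fps_expansion_num_fps) auto
  have "(\<lambda>e. of_nat m * (exp (of_real (ln (real m)) * e) * hurwitz_num 1 (1 + e))) has_fps_expansion
      fps_const (of_nat m) * (fps_exp (of_real (ln (real m))) * num_fps 1)"
    by (intro fps_expansion_intros has_fps_expansion_num_fps) auto
  moreover have "eventually (\<lambda>e. e \<in> {e. Re e > -2}) (nhds (0 :: complex))"
    by (intro eventually_nhds_in_open open_halfspace_Re_gt) auto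
  hence "eventually (\<lambda>e. of_nat m * (exp (of_real (ln (real m)) * e) * hurwitz_num 1 (1 + e)) =
      (\<Sum>r=1..m. hurwitz_num (real r / real m) (1 + e))) (nhds 0)"
  proof eventually_elim
    case (elim e)
    have "exp (complex_of_real (ln (real m))) = of_nat m"
      using m by (metis exp_ln exp_of_real of_nat_0_less_iff of_real_of_nat_eq)
    hence "of_nat m powr (1 + e) = of_nat m * exp (of_real (ln (real m)) * e)"
      using m Ln_of_real[of "real m"] by (subst powr_add) (simp add: powr_def mult.commute)
    thus ?case using hurwitz_num_distribution[OF m, of "1 + e"] elim by (simp add: mult.assoc)
  qed
  ultimately show "(\<lambda>e. \<Sum>r=1..m. hurwitz_num (real r / real m) (1 + e)) has_fps_expansion
      fps_const (of_nat m) * (fps_exp (of_real (ln (real m))) * num_fps 1)"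
    by (rule has_fps_expansion_transform)
qed

lemma zeta_fps_distribution:
  assumes m: "m > 0"
  shows "(\<Sum>r=1..m. zeta_fps (real r / real m)) = fps_exp (- of_real (ln (real m))) * zeta_fps 1"
proof (rule fps_expansion_unique_complex)
  show "(\<lambda>e. \<Sum>r=1..m. hurwitz_num (real r / real m) (- e) / (- 1 - e)) has_fps_expansion (\<Sum>r=1..m. zeta_fps (real r / real m))"
    by (intro fps_expansion_intros has_fps_expansion_zeta_fps) auto
  have "(\<lambda>e. exp (- of_real (ln (real m)) * e) * (hurwitz_num 1 (- e) / (- 1 - e))) has_fps_expansion
      fps_exp (- of_real (ln (real m))) * zeta_fps 1"
    by (intro fps_expansion_intros has_fps_expansion_zeta_fps) auto
  moreover have "eventually (\<lambda>e. e \<in> {e. Re e < 1}) (nhds (0 :: complex))"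
    by (intro eventually_nhds_in_open open_halfspace_Re_lt) auto
  hence "eventually (\<lambda>e. exp (- of_real (ln (real m)) * e) * (hurwitz_num 1 (- e) / (- 1 - e)) =
      (\<Sum>r=1..m. hurwitz_num (real r / real m) (- e) / (- 1 - e))) (nhds 0)"
  proof eventually_elim
    case (elim e)
    have "of_nat m powr (- e) = exp (- of_real (ln (real m)) * e)"
      using m Ln_of_real[of "real m"] by (simp add: powr_def mult.commute)
    thus ?case using hurwitz_num_distribution[OF m, of "- e"] elim
      by (simp flip: sum_divide_distrib)
  qed
  ultimately show "(\<lambda>e. \<Sum>r=1..m. hurwitz_num (real r / real m) (- e) / (- 1 - e)) has_fps_expansion
      fps_exp (- of_real (ln (real m))) * zeta_fps 1"
    by (rule has_fps_expansion_transform)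
qed

lemma fps_exp_nth_upto_2:
  fixes c :: complex
  shows "fps_nth (fps_exp c) 0 = 1" "fps_nth (fps_exp c) (Suc 0) = c" "fps_nth (fps_exp c) 2 = c ^ 2 / 2"
  by (simp_all add: fps_exp_def)

text \<open>This supplies the cosine transform at the remaining frequency l = m.\<close>

lemma sum_stieltjes_1:
  assumes m: "m > 0"
  shows "(\<Sum>r=1..m. stieltjes 1 (real r / real m)) =
     of_nat m * (stieltjes 1 1 - of_real (euler_mascheroni * ln (real m) + ln (real m) ^ 2 / 2))"
proof -
  have n: "fps_nth (num_fps 1) 0 = 1" "fps_nth (num_fps 1) (Suc 0) = of_real euler_mascheroni"
    "fps_nth (num_fps 1) 2 = - stieltjes 1 1"
    using num_fps_nth_stieltjes[of 1 1] by (simp_all add: stieltjes_0_1)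
  have "(\<Sum>r=1..m. - stieltjes 1 (real r / real m)) = (\<Sum>r=1..m. fps_nth (num_fps (real r / real m)) 2)"
    by (intro sum.cong refl) (simp only: num_fps_nth_stieltjes)
  also have "\<dots> = fps_nth (fps_const (of_nat m) * (fps_exp (of_real (ln (real m))) * num_fps 1)) 2"
    unfolding num_fps_distribution[OF m, symmetric] by (simp add: fps_sum_nth)
  also have "\<dots> = of_nat m * (- stieltjes 1 1 + of_real (ln (real m)) * of_real euler_mascheroni + of_real (ln (real m)) ^ 2 / 2)"
    by (simp add: fps_nth_mult_upto_3 fps_exp_nth_upto_2 n)
  finally show ?thesis by (simp add: sum_negf minus_equation_iff algebra_simps)
qed

text \<open>Coefficients 2 and 1 of the distribution relation at s = -e. The term r = m also occurs
  on the right with factor 1, so zeta''(0, 1) cancels and the sums are elementary. The second one is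
  Gauss's multiplication formula in logarithmic form.\<close>

lemma
  assumes m: "m > 0"
  shows sum_hurwitz_zeta_dd0: "(\<Sum>l=1..m-1. hurwitz_zeta_dd0 (real l / real m)) =
      of_real (- ln (real m) * ln (2 * pi) - ln (real m) ^ 2 / 2)"
    and sum_ln_Gamma: "(\<Sum>l=1..m-1. ln (Gamma (real l / real m))) =
      (real m - 1) / 2 * ln (2 * pi) - ln (real m) / 2"
proof -
  have z: "fps_nth (zeta_fps 1) 0 = - 1 / 2" "fps_nth (zeta_fps 1) (Suc 0) = of_real (ln (2 * pi) / 2)"
    using zeta_fps_nth_0[of 1] zeta_fps_nth_1[of 1] by simp_all
  have split: "(\<Sum>r=1..m. f r) = (\<Sum>r=1..m-1. f r) + f m" for f :: "nat \<Rightarrow> complex"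
    using m by (cases m) auto
  have D: "(\<Sum>r=1..m. fps_nth (zeta_fps (real r / real m)) n) =
      fps_nth (fps_exp (- of_real (ln (real m))) * zeta_fps 1) n" for n
    unfolding zeta_fps_distribution[OF m, symmetric] by (simp add: fps_sum_nth)
  have "(\<Sum>l=1..m-1. hurwitz_zeta_dd0 (real l / real m) / 2) =
      (\<Sum>l=1..m-1. fps_nth (zeta_fps (real l / real m)) 2)"
    by (intro sum.cong refl zeta_fps_nth_2 [symmetric]) auto
  also have "\<dots> = fps_nth (fps_exp (- of_real (ln (real m))) * zeta_fps 1) 2 - fps_nth (zeta_fps 1) 2"
    using D[of 2] m unfolding split by (simp add: algebra_simps)
  also have "\<dots> = of_real (- ln (real m) * ln (2 * pi) - ln (real m) ^ 2 / 2) / 2"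
    by (simp add: fps_nth_mult_upto_3 fps_exp_nth_upto_2 z field_simps)
  finally show "(\<Sum>l=1..m-1. hurwitz_zeta_dd0 (real l / real m)) =
      of_real (- ln (real m) * ln (2 * pi) - ln (real m) ^ 2 / 2)"
    by (simp flip: sum_divide_distrib)
  have "(\<Sum>l=1..m-1. complex_of_real (ln (2 * pi) / 2 - ln (Gamma (real l / real m)))) =
      (\<Sum>l=1..m-1. fps_nth (zeta_fps (real l / real m)) 1)"
    by (intro sum.cong refl zeta_fps_nth_1 [symmetric]) auto
  also have "\<dots> = fps_nth (fps_exp (- of_real (ln (real m))) * zeta_fps 1) (Suc 0) - fps_nth (zeta_fps 1) (Suc 0)"
    using D[of "Suc 0"] m unfolding split by (simp only: eq_diff_eq) simp
  also have "\<dots> = of_real (ln (real m) / 2)"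
    by (simp add: fps_nth_mult_upto_3 fps_exp_nth_upto_2 z)
  finally have "complex_of_real (\<Sum>l=1..m-1. ln (2 * pi) / 2 - ln (Gamma (real l / real m))) = of_real (ln (real m) / 2)"
    by simp
  hence "(\<Sum>l=1..m-1. ln (2 * pi) / 2 - ln (Gamma (real l / real m))) = ln (real m) / 2"
    by (simp only: of_real_eq_iff)
  thus "(\<Sum>l=1..m-1. ln (Gamma (real l / real m))) =
      (real m - 1) / 2 * ln (2 * pi) - ln (real m) / 2"
    using m by (simp add: sum_subtractf of_nat_diff algebra_simps)
qed

text \<open>The bilinear form of Parseval's identity, with squares instead of squared absolute
  values, as suits the complex-valued \<open>stieltjes\<close>. It rests on a^2 + b^2 = (a + i b)(a
  - i b), whose factors are transforms with conjugate characters.\<close>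

lemma finite_Parseval:
  fixes x :: "nat \<Rightarrow> complex"
  assumes m: "m > 0"
  defines "t \<equiv> (\<lambda>r l. 2 * pi * real r * real l / real m)"
  shows "of_nat m * (\<Sum>r=1..m. x r ^ 2) =
    (\<Sum>l=1..m. (\<Sum>r=1..m. of_real (cos (t r l)) * x r) ^ 2 + (\<Sum>r=1..m. of_real (sin (t r l)) * x r) ^ 2)"
proof -
  have c: "cis (t r l) = cis (2 * pi * (real l / real m)) ^ r"
    "cis (- t r l) = cis (- 2 * pi * (real l / real m)) ^ r" for r l
    by (simp_all add: Complex.DeMoivre t_def mult_ac)
  have "(\<Sum>r=1..m. of_real (cos (t r l)) * x r) ^ 2 + (\<Sum>r=1..m. of_real (sin (t r l)) * x r) ^ 2 =
      (\<Sum>r=1..m. \<Sum>q=1..m. x r * x q * (cis (2 * pi * (real l / real m)) ^ r * cis (- 2 * pi * (real l / real m)) ^ q))" for l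
  proof -
    define a b where "a = (\<Sum>r=1..m. of_real (cos (t r l)) * x r)" and "b = (\<Sum>r=1..m. of_real (sin (t r l)) * x r)"
    have "a + \<i> * b = (\<Sum>r=1..m. cis (t r l) * x r)" "a - \<i> * b = (\<Sum>r=1..m. cis (- t r l) * x r)"
    proof -
      have cis: "cis y = of_real (cos y) + \<i> * of_real (sin y)" for y by (simp add: complex_eq_iff)
      show "a + \<i> * b = (\<Sum>r=1..m. cis (t r l) * x r)" "a - \<i> * b = (\<Sum>r=1..m. cis (- t r l) * x r)"
        by (simp_all add: a_def b_def sum_distrib_left cis algebra_simps flip: sum.distrib sum_subtractf)
    qed
    moreover have "a ^ 2 + b ^ 2 = (a + \<i> * b) * (a - \<i> * b)"
      by (simp add: power2_eq_square algebra_simps)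
    ultimately show ?thesis
      unfolding a_def [symmetric] b_def [symmetric]
      by (simp add: sum_product c mult_ac)
  qed
  hence "(\<Sum>l=1..m. (\<Sum>r=1..m. of_real (cos (t r l)) * x r) ^ 2 + (\<Sum>r=1..m. of_real (sin (t r l)) * x r) ^ 2) =
      (\<Sum>l=1..m. \<Sum>r=1..m. \<Sum>q=1..m. x r * x q * (cis (2 * pi * (real l / real m)) ^ r * cis (- 2 * pi * (real l / real m)) ^ q))"
    by simp
  also have "\<dots> = (\<Sum>r=1..m. \<Sum>l=1..m. \<Sum>q=1..m. x r * x q * (cis (2 * pi * (real l / real m)) ^ r * cis (- 2 * pi * (real l / real m)) ^ q))"
    by (rule sum.swap)
  also have "\<dots> = (\<Sum>r=1..m. \<Sum>q=1..m. \<Sum>l=1..m. x r * x q * (cis (2 * pi * (real l / real m)) ^ r * cis (- 2 * pi * (real l / real m)) ^ q))"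
    by (intro sum.cong refl sum.swap)
  also have "\<dots> = (\<Sum>r=1..m. \<Sum>q=1..m. x r * x q * (if r = q then of_nat m else 0))"
    unfolding sum_distrib_left [symmetric]
    by (intro sum.cong refl arg_cong2[where f = "(*)"] sum_cis_orthogonality m)
  also have "\<dots> = (\<Sum>r=1..m. of_nat m * x r ^ 2)"
    by (intro sum.cong refl) (simp add: if_distrib[of "(*) _"] power2_eq_square mult_ac cong: if_cong)
  finally show ?thesis by (simp add: sum_distrib_left)
qed

subsection \<open>The quadratic sum\<close>

text \<open>The right side is the shape in which the constant arises: the first summand comes from l
  = m, the next two from the ln 2 beside ln sin in the cosine transforms, the last from the sine
  transforms. \<open>S\<close> is the sum of ln sin(pi l / m). After splitting ln(2 pi m), both
  sides are polynomials in the logarithms, gamma and pi with coefficients rational in m.\<close>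

lemma C_const_eq:
  fixes m :: real
  assumes m: "m > 0"
  defines "L \<equiv> ln m" and "A \<equiv> \<gamma> + ln (2 * pi * m)"
  defines "S \<equiv> ln m - (m - 1) * ln 2"
  shows "C_const m = m * (\<gamma> * L + L ^ 2 / 2) ^ 2 + m * A * ln 2 * (2 * (- L * ln (2 * pi) - L ^ 2 / 2))
    + m * A ^ 2 * ((m - 1) * ln 2 ^ 2 + 2 * ln 2 * S)
    + pi ^ 2 * m / 4 * ((ln pi + A) ^ 2 * (m - 1) + 4 * A ^ 2 * ((m - 1) * (2 * m - 1) / (6 * m))
      + 2 * ln pi * S - 4 * (ln pi + A) * ((m - 1) / 2 * ln (2 * pi) - L / 2)
      - 2 * (ln pi + A) * S + 2 * A * S - 2 * A * (ln pi + A) * (m - 1))"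
proof -
  define l2 lp p g where "l2 = ln (2::real)" and "lp = ln pi" and "p = pi" and "g = (\<gamma>::real)"
  have 1: "ln (2 * pi * m) = l2 + lp + L" "ln (2 * pi) = l2 + lp"
    using m by (simp_all add: ln_mult l2_def lp_def L_def)
  have m0: "m \<noteq> 0" using m by simp
  show ?thesis
    unfolding C_const_def A_def S_def 1
    unfolding L_def [symmetric] l2_def [symmetric] lp_def [symmetric] g_def [symmetric]
    unfolding p_def [symmetric]
    using m0 by (simp add: field_simps power2_eq_square power3_eq_cube power4_eq_xxxx)
qed

lemma sum_reflect:
  fixes f :: "nat \<Rightarrow> 'a :: comm_monoid_add"
  shows "(\<Sum>l=1..m-1. f (m - l)) = (\<Sum>l=1..m-1. f l)"
  by (rule sum.reindex_bij_witness[of _ "\<lambda>l. m - l" "\<lambda>l. m - l"]) auto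


lemma sum_upto_real: "(\<Sum>l=1..n. real l) = real n * (real n + 1) / 2"
  by (induction n) (auto simp: field_simps)

lemma sum_squares_upto_real: "(\<Sum>l=1..n. real l ^ 2) = real n * (real n + 1) * (2 * real n + 1) / 6"
  by (induction n) (auto simp: field_simps power2_eq_square)

theorem theorem3:
  fixes m :: nat
  assumes "m \<ge> 2"
  shows "(\<Sum>r = 1..m - 1. (stieltjes 1 (real r / real m)) ^ 2) =
      of_real (real m - 1) * (stieltjes 1 1) ^ 2
    - of_nat m * stieltjes 1 1 * of_real (2 * \<gamma> + ln (real m)) * of_real (ln (real m))
    + of_nat m / 4 * (\<Sum>l = 1..m - 1.
        (hurwitz_zeta_dd0 (real l / real m) + hurwitz_zeta_dd0 (1 - real l / real m)) ^ 2)
    + of_nat m * of_real (\<gamma> + ln (2 * pi * real m)) * (\<Sum>l = 1..m - 1.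
        (hurwitz_zeta_dd0 (real l / real m) + hurwitz_zeta_dd0 (1 - real l / real m))
          * of_real (ln (sin (pi * real l / real m))))
    + of_real (real m * pi ^ 2 * (\<Sum>l = 1..m - 1. (ln (Gamma (real l / real m))) ^ 2))
    + of_real (2 * pi ^ 2 * (\<gamma> + ln (2 * pi * real m))
        * (\<Sum>l = 1..m - 1. real l * ln (Gamma (real l / real m))))
    + of_real (real m / 4 * (4 * (\<gamma> + ln (2 * pi * real m)) ^ 2 - pi ^ 2)
        * (\<Sum>l = 1..m - 1. (ln (sin (pi * real l / real m))) ^ 2))
    + of_real (C_const (real m))"
proof -
  define M where "M = real m"
  have m: "m > 0" and M: "M > 0" using assms by (auto simp: M_def)
  define L A where "L = ln M" and "A = \<gamma> + ln (2 * pi * M)"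
  define d where "d l = hurwitz_zeta_dd0 (real l / M) + hurwitz_zeta_dd0 (1 - real l / M)" for l
  define s where "s l = ln (sin (pi * real l / M))" for l :: nat
  define g where "g l = ln (Gamma (real l / M))" for l :: nat
  define c where "c = stieltjes 1 1"
  define S where "S = ln M - (M - 1) * ln 2"
  let ?I = "{1..m - 1}"
  have I: "l \<in> {1..<m}" if "l \<in> ?I" for l
    using that m by auto
  have refl_arg: "real (m - l) / M = 1 - real l / M" if "l \<in> ?I" for l
    using that M by (auto simp: M_def field_simps of_nat_diff)
  have frac: "0 < real l / M" "real l / M < 1" if "l \<in> ?I" for l
    using that M by (auto simp: M_def)
  have cardI: "real (card ?I) = M - 1" using m by (simp add: M_def of_nat_diff)
  have g_reflect: "g (m - l) = ln pi - s l - g l" if "l \<in> ?I" for l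
    using ln_Gamma_reflection[OF frac[OF that]] refl_arg[OF that] by (simp add: g_def s_def)
  have s_reflect: "s (m - l) = s l" if "l \<in> ?I" for l
  proof -
    have "pi * real (m - l) / M = pi - pi * real l / M"
      using arg_cong[OF refl_arg[OF that], of "(*) pi"] by (simp add: right_diff_distrib)
    thus ?thesis by (simp add: s_def)
  qed
  have sum_g: "(\<Sum>l\<in>?I. g l) = (M - 1) / 2 * ln (2 * pi) - L / 2"
    using sum_ln_Gamma[OF m] by (simp add: g_def M_def L_def)
  \<comment> \<open>Reflecting l to m - l in the sum of ln Gamma expresses the sum of ln sin by
    Gauss's formula.\<close>
  have sum_s: "(\<Sum>l\<in>?I. s l) = S"
  proof -
    have "(\<Sum>l\<in>?I. g l) = (\<Sum>l\<in>?I. ln pi - s l - g l)"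
      using sum_reflect[of g m] g_reflect by simp
    also have "\<dots> = (M - 1) * ln pi - (\<Sum>l\<in>?I. s l) - (\<Sum>l\<in>?I. g l)"
      using cardI by (simp add: sum_subtractf)
    finally show ?thesis unfolding sum_g by (simp add: S_def L_def ln_mult field_simps)
  qed
  \<comment> \<open>The same reflection, under which ln sin is invariant, eliminates the mixed sum
    in favour of the sum of squares of ln sin.\<close>
  have sum_gs: "(\<Sum>l\<in>?I. g l * s l) = (ln pi * S - (\<Sum>l\<in>?I. s l ^ 2)) / 2"
  proof -
    have "(\<Sum>l\<in>?I. g l * s l) = (\<Sum>l\<in>?I. (ln pi - s l - g l) * s l)"
      using sum_reflect[of "\<lambda>l. g l * s l" m] g_reflect s_reflect by simp
    also have "\<dots> = ln pi * S - (\<Sum>l\<in>?I. s l ^ 2) - (\<Sum>l\<in>?I. g l * s l)"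
      by (simp add: sum_s [symmetric] sum_subtractf sum_distrib_left left_diff_distrib power2_eq_square)
    finally show ?thesis by simp
  qed
  have sum_ls: "(\<Sum>l\<in>?I. real l * s l) = M / 2 * S"
  proof -
    have "(\<Sum>l\<in>?I. real l * s l) = (\<Sum>l\<in>?I. real (m - l) * s l)"
      using sum_reflect[of "\<lambda>l. real l * s l" m] s_reflect by simp
    also have "\<dots> = (\<Sum>l\<in>?I. M * s l - real l * s l)"
      by (intro sum.cong refl) (auto simp: M_def of_nat_diff left_diff_distrib)
    also have "\<dots> = M * S - (\<Sum>l\<in>?I. real l * s l)"
      by (simp add: sum_s [symmetric] sum_subtractf sum_distrib_left)
    finally show ?thesis by simp
  qed
  have sum_l: "(\<Sum>l\<in>?I. real l) = M * (M - 1) / 2"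
    using sum_upto_real[of "m - 1"] m by (simp add: M_def of_nat_diff)
  have sum_ll: "(\<Sum>l\<in>?I. real l ^ 2) = (M - 1) * M * (2 * M - 1) / 6"
    using sum_squares_upto_real[of "m - 1"] m by (simp add: M_def of_nat_diff)
  have sum_d: "(\<Sum>l\<in>?I. d l) = of_real (2 * (- L * ln (2 * pi) - L ^ 2 / 2))"
  proof -
    have "(\<Sum>l\<in>?I. hurwitz_zeta_dd0 (1 - real l / M)) = (\<Sum>l\<in>?I. hurwitz_zeta_dd0 (real l / M))"
      using sum_reflect[of "\<lambda>l. hurwitz_zeta_dd0 (real l / M)" m] refl_arg by simp
    thus ?thesis
      using sum_hurwitz_zeta_dd0[OF m] by (simp add: d_def sum.distrib M_def L_def)
  qed
  define a where "a l = (\<Sum>r=1..m. of_real (cos (2 * pi * real r * real l / real m)) * stieltjes 1 (real r / real m))" for l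
  define b where "b l = (\<Sum>r=1..m. of_real (sin (2 * pi * real r * real l / real m)) * stieltjes 1 (real r / real m))" for l
  have a: "a l = of_real (M / 2) * d l + of_real (M * A) * of_real (ln 2 + s l)" if "l \<in> ?I" for l
    using stieltjes_cos_sum[OF I[OF that]] by (simp add: a_def d_def s_def M_def A_def)
  \<comment> \<open>The reflection formula removes ln Gamma(1 - l/m), so that only one ln Gamma and
    one ln sin per l remain to be squared.\<close>
  have b: "b l = of_real (pi * M / 2 * (2 * g l + s l - (ln pi + A) + 2 * A / M * real l))" if "l \<in> ?I" for l
  proof -
    have "b l = of_real (pi * M / 2 * (g l - g (m - l) - A * (1 - 2 * (real l / M))))"
      using stieltjes_sin_sum[OF I[OF that]] refl_arg[OF that] by (simp add: b_def g_def M_def A_def)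
    also have "g l - g (m - l) - A * (1 - 2 * (real l / M)) = 2 * g l + s l - (ln pi + A) + 2 * A / M * real l"
      using g_reflect[OF that] by (simp add: algebra_simps)
    finally show ?thesis .
  qed
  have cs: "cos (2 * pi * real r) = 1" "sin (2 * pi * real r) = 0" for r
    using cos_int_2pin[of "int r"] sin_int_2pin[of "int r"] by simp_all
  \<comment> \<open>At l = m all angles are multiples of 2 pi; this index is not covered by
    \<open>stieltjes_cos_sum\<close>.\<close>
  have am: "a m = of_real M * (c - of_real (\<gamma> * L + L ^ 2 / 2))"
    using sum_stieltjes_1[OF m] m by (simp add: a_def cs M_def L_def c_def)
  have bm: "b m = 0"
    using m by (simp add: b_def cs)
  have sum_a2: "(\<Sum>l\<in>?I. a l ^ 2) = of_real (M ^ 2 / 4) * (\<Sum>l\<in>?I. d l ^ 2)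
     + of_real (M ^ 2 * A) * (\<Sum>l\<in>?I. d l * of_real (s l))
     + of_real (M ^ 2 * A * ln 2 * (2 * (- L * ln (2 * pi) - L ^ 2 / 2))
       + M ^ 2 * A ^ 2 * ((M - 1) * ln 2 ^ 2 + 2 * ln 2 * S + (\<Sum>l\<in>?I. s l ^ 2)))"
  proof -
    have "(\<Sum>l\<in>?I. a l ^ 2) = (\<Sum>l\<in>?I. of_real (M ^ 2 / 4) * d l ^ 2 + of_real (M ^ 2 * A) * (d l * of_real (s l))
        + of_real (M ^ 2 * A * ln 2) * d l + of_real (M ^ 2 * A ^ 2 * (ln 2 ^ 2 + 2 * ln 2 * s l + s l ^ 2)))"
      by (intro sum.cong refl) (simp add: a power2_eq_square field_simps)
    also have "\<dots> = of_real (M ^ 2 / 4) * (\<Sum>l\<in>?I. d l ^ 2) + of_real (M ^ 2 * A) * (\<Sum>l\<in>?I. d l * of_real (s l))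
        + of_real (M ^ 2 * A * ln 2) * (\<Sum>l\<in>?I. d l)
        + of_real (M ^ 2 * A ^ 2 * (\<Sum>l\<in>?I. ln 2 ^ 2 + 2 * ln 2 * s l + s l ^ 2))"
    proof -
      have e: "complex_of_real (M ^ 2 * A ^ 2 * (\<Sum>l\<in>?I. ln 2 ^ 2 + 2 * ln 2 * s l + s l ^ 2)) =
          (\<Sum>l\<in>?I. of_real (M ^ 2 * A ^ 2 * (ln 2 ^ 2 + 2 * ln 2 * s l + s l ^ 2)))"
        by (simp only: sum_distrib_left of_real_sum)
      show ?thesis unfolding e by (simp only: sum.distrib sum_distrib_left)
    qed
    also have "(\<Sum>l\<in>?I. ln 2 ^ 2 + 2 * ln 2 * s l + s l ^ 2) = (M - 1) * ln 2 ^ 2 + 2 * ln 2 * S + (\<Sum>l\<in>?I. s l ^ 2)"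
      using cardI by (simp add: sum.distrib sum_s [symmetric] sum_distrib_left)
    finally show ?thesis unfolding sum_d by simp
  qed
  have sum_b2: "(\<Sum>l\<in>?I. b l ^ 2) = of_real (pi ^ 2 * M ^ 2 / 4 * (4 * (\<Sum>l\<in>?I. g l ^ 2) - (\<Sum>l\<in>?I. s l ^ 2)
      + 8 * A / M * (\<Sum>l\<in>?I. real l * g l) + (ln pi + A) ^ 2 * (M - 1) + 4 * A ^ 2 * ((M - 1) * (2 * M - 1) / (6 * M))
      + 2 * ln pi * S - 4 * (ln pi + A) * ((M - 1) / 2 * ln (2 * pi) - L / 2)
      - 2 * (ln pi + A) * S + 2 * A * S - 2 * A * (ln pi + A) * (M - 1)))"
  proof -
    define B where "B = ln pi + A"
    have "(\<Sum>l\<in>?I. b l ^ 2) = of_real (\<Sum>l\<in>?I. (pi * M / 2 * (2 * g l + s l - B + 2 * A / M * real l)) ^ 2)"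
      unfolding of_real_sum by (intro sum.cong refl) (simp only: b B_def of_real_power)
    also have "(\<Sum>l\<in>?I. (pi * M / 2 * (2 * g l + s l - B + 2 * A / M * real l)) ^ 2) =
      (\<Sum>l\<in>?I. pi ^ 2 * M ^ 2 / 4 * (4 * g l ^ 2 + s l ^ 2 + B ^ 2 + 4 * A ^ 2 / M ^ 2 * real l ^ 2 + 4 * (g l * s l)
        - 4 * B * g l + 8 * A / M * (real l * g l) - 2 * B * s l + 4 * A / M * (real l * s l) - 4 * A * B / M * real l))"
      using M by (intro sum.cong refl) (simp add: power2_eq_square field_simps)
    also have "\<dots> = pi ^ 2 * M ^ 2 / 4 * (4 * (\<Sum>l\<in>?I. g l ^ 2) + (\<Sum>l\<in>?I. s l ^ 2) + (\<Sum>l\<in>?I. B ^ 2)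
        + 4 * A ^ 2 / M ^ 2 * (\<Sum>l\<in>?I. real l ^ 2) + 4 * (\<Sum>l\<in>?I. g l * s l)
        - 4 * B * (\<Sum>l\<in>?I. g l) + 8 * A / M * (\<Sum>l\<in>?I. real l * g l) - 2 * B * (\<Sum>l\<in>?I. s l)
        + 4 * A / M * (\<Sum>l\<in>?I. real l * s l) - 4 * A * B / M * (\<Sum>l\<in>?I. real l))"
      by (simp only: sum.distrib sum_subtractf sum_distrib_left [symmetric])
    also have "(\<Sum>l\<in>?I. B ^ 2) = B ^ 2 * (M - 1)" using cardI by simp
    also have "4 * A ^ 2 / M ^ 2 * (\<Sum>l\<in>?I. real l ^ 2) = 4 * A ^ 2 * ((M - 1) * (2 * M - 1) / (6 * M))"
      unfolding sum_ll using M by (simp add: power2_eq_square field_simps)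
    also have "4 * A / M * (\<Sum>l\<in>?I. real l * s l) = 2 * A * S"
      unfolding sum_ls using M by simp
    also have "4 * A * B / M * (\<Sum>l\<in>?I. real l) = 2 * A * B * (M - 1)"
      unfolding sum_l using M by simp
    \<comment> \<open>Twice the sum of squares of ln sin is subtracted from one copy; this produces
      the -pi^2 in the coefficient 4 (gamma + ln(2 pi m))^2 - pi^2.\<close>
    also have "4 * (\<Sum>l\<in>?I. g l * s l) = 2 * ln pi * S - 2 * (\<Sum>l\<in>?I. s l ^ 2)"
      unfolding sum_gs by simp
    finally show ?thesis unfolding sum_g sum_s B_def by (simp add: algebra_simps)
  qed
  have split: "(\<Sum>r=1..m. f r) = (\<Sum>r\<in>?I. f r) + f m" for f :: "nat \<Rightarrow> complex"
    using m by (cases m) auto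
  have P: "of_real M * ((\<Sum>r\<in>?I. stieltjes 1 (real r / real m) ^ 2) + c ^ 2) =
      (\<Sum>l\<in>?I. a l ^ 2) + (\<Sum>l\<in>?I. b l ^ 2) + a m ^ 2"
    using finite_Parseval[OF m, of "\<lambda>r. stieltjes 1 (real r / real m)"] m
    unfolding a_def [symmetric] b_def [symmetric] split
    by (simp add: bm sum.distrib M_def c_def)
  define Sss Sgg Slg X where "Sss = (\<Sum>l\<in>?I. s l ^ 2)" and "Sgg = (\<Sum>l\<in>?I. g l ^ 2)"
    and "Slg = (\<Sum>l\<in>?I. real l * g l)" and "X = \<gamma> * L + L ^ 2 / 2"
  define Sdd Sds where "Sdd = (\<Sum>l\<in>?I. d l ^ 2)" and "Sds = (\<Sum>l\<in>?I. d l * of_real (s l))"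
  define G where "G = (ln pi + A) ^ 2 * (M - 1) + 4 * A ^ 2 * ((M - 1) * (2 * M - 1) / (6 * M))
      + 2 * ln pi * S - 4 * (ln pi + A) * ((M - 1) / 2 * ln (2 * pi) - L / 2)
      - 2 * (ln pi + A) * S + 2 * A * S - 2 * A * (ln pi + A) * (M - 1)"
  define H where "H = A * ln 2 * (2 * (- L * ln (2 * pi) - L ^ 2 / 2)) + A ^ 2 * ((M - 1) * ln 2 ^ 2 + 2 * ln 2 * S)"
  have C: "C_const M = M * X ^ 2 + M * H + pi ^ 2 * M / 4 * G"
    using C_const_eq[OF M] unfolding X_def H_def G_def L_def A_def S_def
    by (simp add: distrib_left mult.assoc)
  have a2: "(\<Sum>l\<in>?I. a l ^ 2) = of_real M * (of_real (M / 4) * Sdd + of_real (M * A) * Sds + of_real (M * H + M * A ^ 2 * Sss))"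
    unfolding sum_a2 Sdd_def [symmetric] Sds_def [symmetric] Sss_def [symmetric] H_def
    by (simp add: algebra_simps power2_eq_square)
  have b2: "(\<Sum>l\<in>?I. b l ^ 2) = of_real M * of_real (pi ^ 2 * M * Sgg - pi ^ 2 * M / 4 * Sss + 2 * pi ^ 2 * A * Slg + pi ^ 2 * M / 4 * G)"
  proof -
    have "pi ^ 2 * M ^ 2 / 4 * (4 * Sgg - Sss + 8 * A / M * Slg + G) =
        M * (pi ^ 2 * M * Sgg - pi ^ 2 * M / 4 * Sss + 2 * pi ^ 2 * A * Slg + pi ^ 2 * M / 4 * G)"
      using M by (simp add: field_simps power2_eq_square)
    moreover have "(\<Sum>l\<in>?I. b l ^ 2) = of_real (pi ^ 2 * M ^ 2 / 4 * (4 * Sgg - Sss + 8 * A / M * Slg + G))"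
      unfolding sum_b2 Sgg_def [symmetric] Slg_def [symmetric] Sss_def [symmetric] G_def
      by (simp only: add_diff_eq add.assoc [symmetric])
    ultimately show ?thesis by (simp only: of_real_mult)
  qed
  have M0: "complex_of_real M \<noteq> 0" using M by simp
  have "of_real M * ((\<Sum>r\<in>?I. stieltjes 1 (real r / real m) ^ 2) + c ^ 2) =
     of_real M * (of_real (M / 4) * Sdd + of_real (M * A) * Sds + of_real (M * H + M * A ^ 2 * Sss)
      + of_real (pi ^ 2 * M * Sgg - pi ^ 2 * M / 4 * Sss + 2 * pi ^ 2 * A * Slg + pi ^ 2 * M / 4 * G)
      + of_real M * (c - of_real X) ^ 2)"
    unfolding P a2 b2 am X_def [symmetric] by (simp add: distrib_left power2_eq_square mult_ac)
  hence "(\<Sum>r\<in>?I. stieltjes 1 (real r / real m) ^ 2) + c ^ 2 =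
      of_real (M / 4) * Sdd + of_real (M * A) * Sds + of_real (M * H + M * A ^ 2 * Sss)
      + of_real (pi ^ 2 * M * Sgg - pi ^ 2 * M / 4 * Sss + 2 * pi ^ 2 * A * Slg + pi ^ 2 * M / 4 * G)
      + of_real M * (c - of_real X) ^ 2"
    using M0 by (simp only: mult_cancel_left) simp
  hence "(\<Sum>r\<in>?I. stieltjes 1 (real r / real m) ^ 2) =
      of_real (M / 4) * Sdd + of_real (M * A) * Sds + of_real (M * H + M * A ^ 2 * Sss)
      + of_real (pi ^ 2 * M * Sgg - pi ^ 2 * M / 4 * Sss + 2 * pi ^ 2 * A * Slg + pi ^ 2 * M / 4 * G)
      + of_real M * (c - of_real X) ^ 2 - c ^ 2"
    by (simp only: eq_diff_eq)
  \<comment> \<open>Expanding M (c - X)^2 - c^2 yields (M - 1) c^2 and, because 2 X = (2 gamma + L)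
    L, the linear term in c; M X^2 is absorbed by the constant.\<close>
  also have "\<dots> = of_real (M - 1) * c ^ 2 - of_real M * c * of_real (2 * \<gamma> + L) * of_real L
      + of_real M / 4 * Sdd + of_real M * of_real A * Sds + of_real (M * pi ^ 2 * Sgg)
      + of_real (2 * pi ^ 2 * A * Slg) + of_real (M / 4 * (4 * A ^ 2 - pi ^ 2) * Sss) + of_real (C_const M)"
    unfolding C X_def by (simp add: field_simps power2_eq_square)
  finally show ?thesis
    unfolding Sdd_def Sds_def Sgg_def Slg_def Sss_def d_def s_def g_def c_def A_def L_def M_def by simp
qed

end
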